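(* Suppose that $\phi$ is an essentially linear fractional selfmap of $\mathbb{U}$ fixing $1$. Suppose that $\phi'(1) = 1$, so that the Denjoy-Wolff point of $\phi$ is $1$. Let $a = \phi''(1)$, so that $\mathrm{Re}(a) > 0$. Then, for the composition operator $C_\phi: H^2(\mathbb{U})\to H^2(\mathbb{U})$, $$\mathrm{Sp}(C_\phi) = \mathrm{Sp}_e(C_\phi) = \{e^{-at}: t\ge 0\}\cup\{0\}.$$
   Context: $\mathbb{U}$ is the open unit disc in $\mathbb{C}$ and $H^2(\mathbb{U})$ is the classical Hardy space of analytic functions on $\mathbb{U}$ with square-summable Maclaurin coefficients. An (analytic) selfmap of $\mathbb{U}$ is an analytic function $\phi$ on $\mathbb{U}$ with $\phi(\mathbb{U})\subseteq\mathbb{U}$; $C_\phi f = f\circ\phi$ is the composition operator, which is bounded on $H^2(\mathbb{U})$. For a bounded operator $T$ on a Hilbert space, $\mathrm{Sp}(T)$ is its spectrum and $\mathrm{Sp}_e(T)$ is its essential spectrum, $\{\lambda : T-\lambda I \text{ is not Fredholm}\}$. A selfmap $\phi$ is essentially linear fractional if there is $\eta\in\partial\mathbb{U}$ such that: (a) $\phi(\mathbb{U})$ is contained in a proper subdisc of $\mathbb{U}$ internally tangent to the unit circle at $\eta$; (b) the set $\phi^{-1}(\{\eta\}) := \{\zeta\in\partial\mathbb{U} : \eta \text{ belongs to the cluster set of } \phi \text{ at } \zeta\}$ consists of exactly one element, say $\zeta_0$; (c) $\phi'''$ extends continuously to $\mathbb{U}\cup\{\zeta_0\}$. Consequently $\phi,\phi',\phi''$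 also extend continuously to $\zeta_0$, and values at $\zeta_0$ denote values of these extensions. If $\phi$ fixes the boundary point $1$, then $\eta=\zeta_0=1$. Denjoy-Wolff point: if $\phi$ is not an elliptic automorphism of $\mathbb{U}$, the unique point $\omega$ of the closed disc with $\phi^{[n]}(z)\to\omega$ for each $z\in\mathbb{U}$, where $\phi^{[n]}$ is the $n$-th iterate. *)

theory Defs
  imports "HOL-Complex_Analysis.Complex_Analysis"
begin

section \<open>Operators on complex normed spaces\<close>

class complex_normed_vector = real_normed_vector +
  fixes scaleC :: "complex \<Rightarrow> 'a \<Rightarrow> 'a"  (infixr "*\<^sub>C" 75)
  assumes scaleC_add_right: "c *\<^sub>C (x + y) = c *\<^sub>C x + c *\<^sub>C y"
    and scaleC_add_left: "(c + d) *\<^sub>C x = c *\<^sub>C x + d *\<^sub>C x"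
    and scaleC_scaleC: "c *\<^sub>C (d *\<^sub>C x) = (c * d) *\<^sub>C x"
    and scaleC_of_real: "complex_of_real r *\<^sub>C x = r *\<^sub>R x"
    and norm_scaleC: "norm (c *\<^sub>C x) = cmod c * norm x"

global_interpretation cvec: vector_space "scaleC :: complex \<Rightarrow> 'a \<Rightarrow> 'a::complex_normed_vector"
  using scaleC_of_real[of 1]
  by unfold_locales (auto simp: scaleC_add_right scaleC_add_left scaleC_scaleC)

definition bounded_clinear :: "('a::complex_normed_vector \<Rightarrow> 'b::complex_normed_vector) \<Rightarrow> bool"
  where "bounded_clinear T \<longleftrightarrow> bounded_linear T \<and> (\<forall>c x. T (c *\<^sub>C x) = c *\<^sub>C T x)"

definition spectrum :: "('a::complex_normed_vector \<Rightarrow> 'a) \<Rightarrow> complex set"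
  where "spectrum T = {l. \<not> (\<exists>S. bounded_clinear S \<and>
    (\<forall>x. S (T x - l *\<^sub>C x) = x) \<and> (\<forall>x. T (S x) - l *\<^sub>C S x = x))}"

text \<open>The last conjunct of \<open>fredholm\<close> says that the quotient of the codomain by the range of the
  operator is finite-dimensional.\<close>

definition fredholm :: "('a::complex_normed_vector \<Rightarrow> 'b::complex_normed_vector) \<Rightarrow> bool"
  where "fredholm T \<longleftrightarrow> bounded_clinear T
    \<and> (\<exists>B. finite B \<and> {x. T x = 0} \<subseteq> cvec.span B)
    \<and> closed (range T)
    \<and> (\<exists>B. finite B \<and> cvec.span (range T \<union> B) = UNIV)"

definition essential_spectrum :: "('a::complex_normed_vector \<Rightarrow> 'a) \<Rightarrow> complex set"
  where "essential_spectrum T = {l. \<not> fredholm (\<lambda>x. T x - l *\<^sub>C x)}"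


section \<open>The Hardy space of the unit disc\<close>

definition maclaurin_coeff :: "(complex \<Rightarrow> complex) \<Rightarrow> nat \<Rightarrow> complex"
  where "maclaurin_coeff f n = (deriv ^^ n) f 0 / fact n"

text \<open>Functions on the disc are represented by total functions that vanish off the disc, so that
  equality in the type is equality on the disc.\<close>

definition hardy2_set :: "(complex \<Rightarrow> complex) set"
  where "hardy2_set = {f. f holomorphic_on ball 0 1 \<and> (\<forall>z. z \<notin> ball 0 1 \<longrightarrow> f z = 0)
    \<and> summable (\<lambda>n. (cmod (maclaurin_coeff f n))\<^sup>2)}"

lemma maclaurin_coeff_zero [simp]: "maclaurin_coeff (\<lambda>z. 0) n = 0"
  by (simp add: maclaurin_coeff_def)

lemma maclaurin_coeff_add:
  assumes "f holomorphic_on ball 0 1" "g holomorphic_on ball 0 1"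
  shows "maclaurin_coeff (\<lambda>z. f z + g z) n = maclaurin_coeff f n + maclaurin_coeff g n"
  using higher_deriv_add[OF assms, of 0 n] by (simp add: maclaurin_coeff_def add_divide_distrib)

lemma maclaurin_coeff_cmult:
  assumes "f holomorphic_on ball 0 1"
  shows "maclaurin_coeff (\<lambda>z. c * f z) n = c * maclaurin_coeff f n"
  using higher_deriv_cmult[OF assms, of 0 n c] by (simp add: maclaurin_coeff_def)

lemma hardy2_zero: "(\<lambda>z. 0) \<in> hardy2_set"
  by (simp add: hardy2_set_def)

lemma hardy2_cmult: "f \<in> hardy2_set \<Longrightarrow> (\<lambda>z. c * f z) \<in> hardy2_set"
  by (auto simp: hardy2_set_def maclaurin_coeff_cmult norm_mult power_mult_distrib
      intro!: holomorphic_intros summable_mult)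

lemma hardy2_add:
  assumes "f \<in> hardy2_set" "g \<in> hardy2_set"
  shows "(\<lambda>z. f z + g z) \<in> hardy2_set"
proof -
  let ?a = "maclaurin_coeff f" and ?b = "maclaurin_coeff g"
  have bound: "(cmod (?a n + ?b n))\<^sup>2 \<le> 2 * (cmod (?a n))\<^sup>2 + 2 * (cmod (?b n))\<^sup>2" for n
  proof -
    have "(cmod (?a n + ?b n))\<^sup>2 \<le> (cmod (?a n) + cmod (?b n))\<^sup>2"
      by (intro power_mono norm_triangle_ineq) auto
    also have "\<dots> \<le> 2 * (cmod (?a n))\<^sup>2 + 2 * (cmod (?b n))\<^sup>2"
      using sum_squares_bound[of "cmod (?a n)" "cmod (?b n)"] by (simp add: power2_sum)
    finally show ?thesis .
  qed
  have "summable (\<lambda>n. 2 * (cmod (?a n))\<^sup>2 + 2 * (cmod (?b n))\<^sup>2)"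
    using assms by (intro summable_add summable_mult) (auto simp: hardy2_set_def)
  then have "summable (\<lambda>n. (cmod (?a n + ?b n))\<^sup>2)"
    by (rule summable_comparison_test'[where N = 0]) (simp add: bound)
  then show ?thesis
    using assms by (auto simp: hardy2_set_def maclaurin_coeff_add intro!: holomorphic_intros)
qed

lemma hardy2_uminus: "f \<in> hardy2_set \<Longrightarrow> (\<lambda>z. - f z) \<in> hardy2_set"
  by (drule hardy2_cmult[of _ "-1"]) simp

lemma hardy2_diff: "f \<in> hardy2_set \<Longrightarrow> g \<in> hardy2_set \<Longrightarrow> (\<lambda>z. f z - g z) \<in> hardy2_set"
  by (drule (1) hardy2_add[OF _ hardy2_uminus]) simp

definition hardy2_norm :: "(complex \<Rightarrow> complex) \<Rightarrow> real"
  where "hardy2_norm f = sqrt (\<Sum>n. (cmod (maclaurin_coeff f n))\<^sup>2)"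

lemma hardy2_norm_cmult:
  assumes "f \<in> hardy2_set"
  shows "hardy2_norm (\<lambda>z. c * f z) = cmod c * hardy2_norm f"
proof -
  have "(\<Sum>n. (cmod (maclaurin_coeff (\<lambda>z. c * f z) n))\<^sup>2)
      = (cmod c)\<^sup>2 * (\<Sum>n. (cmod (maclaurin_coeff f n))\<^sup>2)"
    using assms by (simp add: hardy2_set_def maclaurin_coeff_cmult norm_mult power_mult_distrib suminf_mult)
  then show ?thesis
    by (simp add: hardy2_norm_def real_sqrt_mult)
qed

lemma hardy2_norm_eq_0:
  assumes "f \<in> hardy2_set"
  shows "hardy2_norm f = 0 \<longleftrightarrow> f = (\<lambda>z. 0)"
proof
  assume "hardy2_norm f = 0"
  then have "\<forall>n. maclaurin_coeff f n = 0"
    using assms by (subst (asm) hardy2_norm_def) (simp add: hardy2_set_def suminf_eq_zero_iff)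
  then have "(deriv ^^ n) f 0 = 0" for n
    by (simp add: maclaurin_coeff_def)
  then have "f z = 0" if "z \<in> ball 0 1" for z
    using holomorphic_fun_eq_0_on_ball[of f 0 1 z] assms that by (simp add: hardy2_set_def)
  then show "f = (\<lambda>z. 0)"
    using assms by (auto simp: hardy2_set_def)
qed (simp add: hardy2_norm_def)

lemma hardy2_norm_triangle:
  assumes "f \<in> hardy2_set" "g \<in> hardy2_set"
  shows "hardy2_norm (\<lambda>z. f z + g z) \<le> hardy2_norm f + hardy2_norm g"
proof -
  have partial: "L2_set (\<lambda>n. cmod (maclaurin_coeff h n)) {..<N} \<le> hardy2_norm h"
    if "h \<in> hardy2_set" for h N
    using that unfolding L2_set_def hardy2_norm_def hardy2_set_def
    by (auto intro!: sum_le_suminf)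
  have nonneg: "0 \<le> hardy2_norm h" if "h \<in> hardy2_set" for h
    using that by (auto simp: hardy2_norm_def hardy2_set_def intro!: suminf_nonneg)
  let ?c = "maclaurin_coeff (\<lambda>z. f z + g z)"
  have "(\<Sum>n<N. (cmod (?c n))\<^sup>2) \<le> (hardy2_norm f + hardy2_norm g)\<^sup>2" for N
  proof -
    have "L2_set (\<lambda>n. cmod (?c n)) {..<N}
        \<le> L2_set (\<lambda>n. cmod (maclaurin_coeff f n) + cmod (maclaurin_coeff g n)) {..<N}"
      using assms by (intro L2_set_mono) (auto simp: hardy2_set_def maclaurin_coeff_add norm_triangle_ineq)
    also have "\<dots> \<le> hardy2_norm f + hardy2_norm g"
      by (intro order_trans[OF L2_set_triangle_ineq] add_mono partial assms)
    finally have "(L2_set (\<lambda>n. cmod (?c n)) {..<N})\<^sup>2 \<le> (hardy2_norm f + hardy2_norm g)\<^sup>2"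
      by (intro power_mono) auto
    then show ?thesis
      by (simp add: L2_set_def sum_nonneg)
  qed
  then have "(\<Sum>n. (cmod (?c n))\<^sup>2) \<le> (hardy2_norm f + hardy2_norm g)\<^sup>2"
    using hardy2_add[OF assms] by (intro suminf_le_const) (auto simp: hardy2_set_def)
  then have "hardy2_norm (\<lambda>z. f z + g z) \<le> sqrt ((hardy2_norm f + hardy2_norm g)\<^sup>2)"
    unfolding hardy2_norm_def[of "\<lambda>z. f z + g z"] by (rule real_sqrt_le_mono)
  also have "\<dots> = hardy2_norm f + hardy2_norm g"
    using nonneg assms by simp
  finally show ?thesis .
qed

typedef hardy2 = hardy2_set
  morphisms hardy2_fun Hardy2
  using hardy2_zero by blast

setup_lifting type_definition_hardy2

instantiation hardy2 :: complex_normed_vector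
begin

lift_definition zero_hardy2 :: hardy2 is "\<lambda>z. 0" by (rule hardy2_zero)
lift_definition plus_hardy2 :: "hardy2 \<Rightarrow> hardy2 \<Rightarrow> hardy2" is "\<lambda>f g z. f z + g z" by (rule hardy2_add)
lift_definition minus_hardy2 :: "hardy2 \<Rightarrow> hardy2 \<Rightarrow> hardy2" is "\<lambda>f g z. f z - g z" by (rule hardy2_diff)
lift_definition uminus_hardy2 :: "hardy2 \<Rightarrow> hardy2" is "\<lambda>f z. - f z" by (rule hardy2_uminus)
lift_definition scaleC_hardy2 :: "complex \<Rightarrow> hardy2 \<Rightarrow> hardy2" is "\<lambda>c f z. c * f z" by (rule hardy2_cmult)
lift_definition scaleR_hardy2 :: "real \<Rightarrow> hardy2 \<Rightarrow> hardy2" is "\<lambda>r f z. of_real r * f z" by (rule hardy2_cmult)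
lift_definition norm_hardy2 :: "hardy2 \<Rightarrow> real" is hardy2_norm .

definition dist_hardy2 :: "hardy2 \<Rightarrow> hardy2 \<Rightarrow> real" where "dist_hardy2 f g = norm (f - g)"
definition sgn_hardy2 :: "hardy2 \<Rightarrow> hardy2" where "sgn_hardy2 f = inverse (norm f) *\<^sub>R f"
definition uniformity_hardy2 :: "(hardy2 \<times> hardy2) filter"
  where "uniformity_hardy2 = (INF e\<in>{0<..}. principal {(f, g). dist f g < e})"
definition open_hardy2 :: "hardy2 set \<Rightarrow> bool"
  where "open_hardy2 U \<longleftrightarrow> (\<forall>f\<in>U. \<forall>\<^sub>F (f', g) in uniformity. f' = f \<longrightarrow> g \<in> U)"

instance
proof
  fix f g h :: hardy2 and c d :: complex and r s :: real and U :: "hardy2 set"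
  show "f + g + h = f + (g + h)" by transfer (simp add: algebra_simps)
  show "f + g = g + f" by transfer (simp add: algebra_simps)
  show "0 + f = f" by transfer simp
  show "- f + f = 0" by transfer simp
  show "f - g = f + - g" by transfer simp
  show "r *\<^sub>R (f + g) = r *\<^sub>R f + r *\<^sub>R g" by transfer (simp add: algebra_simps)
  show "(r + s) *\<^sub>R f = r *\<^sub>R f + s *\<^sub>R f" by transfer (simp add: algebra_simps)
  show "r *\<^sub>R s *\<^sub>R f = (r * s) *\<^sub>R f" by transfer (simp add: algebra_simps)
  show "1 *\<^sub>R f = f" by transfer simp
  show "c *\<^sub>C (f + g) = c *\<^sub>C f + c *\<^sub>C g" by transfer (simp add: algebra_simps)
  show "(c + d) *\<^sub>C f = c *\<^sub>C f + d *\<^sub>C f" by transfer (simp add: algebra_simps)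
  show "c *\<^sub>C d *\<^sub>C f = (c * d) *\<^sub>C f" by transfer (simp add: algebra_simps)
  show "complex_of_real r *\<^sub>C f = r *\<^sub>R f" by transfer simp
  show "(norm f = 0) = (f = 0)" by transfer (rule hardy2_norm_eq_0)
  show "norm (f + g) \<le> norm f + norm g" by transfer (rule hardy2_norm_triangle)
  show "norm (r *\<^sub>R f) = \<bar>r\<bar> * norm f" by transfer (simp add: hardy2_norm_cmult)
  show "norm (c *\<^sub>C f) = cmod c * norm f" by transfer (rule hardy2_norm_cmult)
  show "dist f g = norm (f - g)" by (rule dist_hardy2_def)
  show "sgn f = inverse (norm f) *\<^sub>R f" by (rule sgn_hardy2_def)
  show "uniformity = (INF e\<in>{0<..}. principal {(f, g :: hardy2). dist f g < e})"
    by (rule uniformity_hardy2_def)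
  show "open U = (\<forall>f\<in>U. \<forall>\<^sub>F (f', g) in uniformity. f' = f \<longrightarrow> g \<in> U)"
    by (rule open_hardy2_def)
qed

end


section \<open>Selfmaps of the disc and composition operators\<close>

definition disc_selfmap :: "(complex \<Rightarrow> complex) \<Rightarrow> bool"
  where "disc_selfmap \<phi> \<longleftrightarrow> \<phi> holomorphic_on ball 0 1 \<and> \<phi> ` ball 0 1 \<subseteq> ball 0 1"

text \<open>For a selfmap \<open>\<phi>\<close> of the disc the argument of \<open>Hardy2\<close> lies in \<open>hardy2_set\<close>, by
  Littlewood's subordination theorem.\<close>

definition composition_operator :: "(complex \<Rightarrow> complex) \<Rightarrow> hardy2 \<Rightarrow> hardy2"
  where "composition_operator \<phi> f =
    Hardy2 (\<lambda>z. if z \<in> ball 0 1 then hardy2_fun f (\<phi> z) else 0)"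

definition cluster_set :: "(complex \<Rightarrow> complex) \<Rightarrow> complex \<Rightarrow> complex set"
  where "cluster_set \<phi> \<zeta> = {w. \<exists>z. (\<forall>n. z n \<in> ball 0 1) \<and> z \<longlonglongrightarrow> \<zeta> \<and> (\<lambda>n. \<phi> (z n)) \<longlonglongrightarrow> w}"

definition essentially_linear_fractional :: "(complex \<Rightarrow> complex) \<Rightarrow> bool"
  where "essentially_linear_fractional \<phi> \<longleftrightarrow> disc_selfmap \<phi> \<and>
    (\<exists>\<eta>\<in>sphere 0 1.
      (\<exists>c r. r > 0 \<and> ball c r \<subset> ball 0 1 \<and> sphere c r \<inter> sphere 0 1 = {\<eta>}
        \<and> \<phi> ` ball 0 1 \<subseteq> ball c r)
      \<and> (\<exists>\<zeta>\<^sub>0. {\<zeta> \<in> sphere 0 1. \<eta> \<in> cluster_set \<phi> \<zeta>} = {\<zeta>\<^sub>0}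
        \<and> (\<exists>g. continuous_on (insert \<zeta>\<^sub>0 (ball 0 1)) g
              \<and> (\<forall>z\<in>ball 0 1. g z = (deriv ^^ 3) \<phi> z))))"

text \<open>The boundary value at \<open>\<zeta>\<close> of the continuous extension of a function on the disc.\<close>

abbreviation has_boundary_value :: "(complex \<Rightarrow> complex) \<Rightarrow> complex \<Rightarrow> complex \<Rightarrow> bool"
  where "has_boundary_value f \<zeta> w \<equiv> (f \<longlongrightarrow> w) (at \<zeta> within ball 0 1)"

definition denjoy_wolff_point :: "(complex \<Rightarrow> complex) \<Rightarrow> complex \<Rightarrow> bool"
  where "denjoy_wolff_point \<phi> \<omega> \<longleftrightarrow> \<omega> \<in> cball 0 1 \<and> (\<forall>z\<in>ball 0 1. (\<lambda>n. (\<phi> ^^ n) z) \<longlonglongrightarrow> \<omega>)"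

end

theory Submission
  imports Defs
begin

text \<open>
  In the coordinate \<open>V = 2 / (1 - z)\<close> the disc is the half-plane \<open>Re V > 1\<close>, and \<open>\<phi>\<close> becomes
  \<open>V \<mapsto> V + a + O(1 / V)\<close> with an increment of real part at least \<open>\<delta> > 0\<close>; this gives the Denjoy-Wolff
  point. After division by \<open>V\<close>, the translation by \<open>b\<close> acts on the Hardy space as multiplication by
  \<open>exp (- b s)\<close> on \<open>L\<^sup>2(0, \<infinity>)\<close>, hence the translation minus a scalar \<open>l\<close> is
  bounded below by the distance of \<open>l\<close> to the spiral \<open>exp (- b s)\<close>, \<open>s \<ge> 0\<close>.

  Upper bound: the spectrum off \<open>0\<close> does not change when \<open>\<phi>\<close> is restricted to a smaller half-plane
  \<open>Re V > 1 / r\<close> (the spectra of \<open>A B\<close> and \<open>B A\<close> agree off \<open>0\<close>), and as \<open>r \<rightarrow> 0\<close> the rescaled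
  composition operators approach the translations by \<open>r a\<close> in norm, whose spirals do not depend on \<open>r\<close>.
  Off the spiral the operators are thus bounded below, and surjectivity propagates from infinity.

  Lower bound: \<open>exp (- t V)\<close> times slowly varying bumps concentrated near \<open>1\<close> are approximate
  eigenvectors for \<open>exp (- a t)\<close> that tend to \<open>0\<close> pointwise but not in norm.
\<close>

section \<open>Circle means and the Hardy norm\<close>

text \<open>Two discrepancies separate the composition operator from a translation: the increment is
  not constant, and the division by \<open>V\<close> leaves a weight \<open>V / (V + b)\<close>.
  They become small only with \<open>b\<close>; hence the passage to small \<open>r\<close>, where
  the rescaled increment r a + O(r^2) makes both vanish while the lower bound, which depends on the
  spiral alone, stays put. With an increment depending on \<open>z\<close> the operator is recovered
  from constant translations by the Cauchy formula in the translation parameter, with weights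
  analytic in \<open>z\<close>. The Hardy norm is defined by coefficients, whereas bounded
  multipliers and inner factors act pointwise. Means over the m-th roots of unity mediate between
  the two, since Parseval is exact on polynomials of degree below \<open>m\<close>. In the lower
  bound the point 0 gets its own sequence: \<open>t\<close> grows, and the bumps spread fast enough
  to keep the error small. That the vectors do not tend to 0 in norm is seen by cancelling the inner
  factor and evaluating at a single point.\<close>

lemma maclaurin_sums:
  assumes "f holomorphic_on ball 0 1" "z \<in> ball 0 1"
  shows "(\<lambda>n. maclaurin_coeff f n * z ^ n) sums f z"
  using holomorphic_power_series[OF assms] by (simp add: maclaurin_coeff_def)

lemma power_series_on_disc:
  assumes sums: "\<And>z. z \<in> ball 0 1 \<Longrightarrow> (\<lambda>n. c n * z ^ n) sums f z"
  shows "f holomorphic_on ball 0 1" "maclaurin_coeff f n = c n"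
proof -
  have conv: "conv_radius c \<ge> 1"
  proof (rule conv_radius_geI_ex')
    fix r :: real assume "0 < r" "ereal r < 1"
    then show "summable (\<lambda>n. c n * of_real r ^ n)"
      using sums[of "of_real r"] by (auto simp: sums_iff)
  qed
  have conv': "fps_conv_radius (Abs_fps c) \<ge> 1"
    using conv by (simp add: fps_conv_radius_def)
  have eval: "eval_fps (Abs_fps c) z = f z" if "z \<in> ball 0 1" for z
    using sums[OF that] by (simp add: eval_fps_def sums_iff)
  have "eval_fps (Abs_fps c) holomorphic_on ball 0 1"
  proof (rule holomorphic_on_eval_fps)
    show "ball 0 1 \<subseteq> eball 0 (fps_conv_radius (Abs_fps c))"
      using conv' by (auto simp: eball_def one_ereal_def intro: less_le_trans[of _ "ereal 1"])
  qed
  then show "f holomorphic_on ball 0 1"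
    by (rule holomorphic_transform) (use eval in auto)
  have "eventually (\<lambda>z. z \<in> ball 0 1) (nhds (0::complex))"
    by (intro eventually_nhds_in_open) auto
  then have "f has_fps_expansion Abs_fps c"
    using conv' unfolding has_fps_expansion_def
    by (auto elim!: eventually_mono simp: eval intro: less_le_trans[of 0 1])
  from fps_nth_fps_expansion[OF this, of n] show "maclaurin_coeff f n = c n"
    by (simp add: maclaurin_coeff_def)
qed

text \<open>A finite substitute for the quadratic integral mean on the circle of radius
  \<open>r\<close>: a finite sum passes to pointwise limits and inherits pointwise bounds at
  once.\<close>

definition circle_mean :: "nat \<Rightarrow> real \<Rightarrow> (complex \<Rightarrow> complex) \<Rightarrow> real"
  where "circle_mean m r f =
    L2_set (\<lambda>j. cmod (f (of_real r * cis (2 * pi * real j / real m)))) {..<m} / sqrt (real m)"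

text \<open>Both exponents lie below \<open>m\<close>, so their difference is a multiple of
  \<open>m\<close> only if it is 0; otherwise the sum is geometric, its ratio being an m-th root of
  unity other than 1.\<close>

lemma sum_roots_of_unity:
  assumes "n < m" "k < m"
  shows "(\<Sum>j<m. cis (2 * pi * real j / real m) ^ n * cnj (cis (2 * pi * real j / real m) ^ k))
    = (if n = k then of_nat m else 0)"
proof -
  let ?t = "2 * pi * (real n - real k) / real m"
  let ?q = "cis ?t"
  have trm: "cis (2 * pi * real j / real m) ^ n * cnj (cis (2 * pi * real j / real m) ^ k) = ?q ^ j" for j
    by (simp add: Complex.DeMoivre cis_cnj cis_mult) (simp add: field_simps diff_divide_distrib)
  have qm: "?q ^ m = 1"
  proof -
    have "?q ^ m = cis (2 * pi * of_int (int n - int k))"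
      using assms by (simp add: Complex.DeMoivre)
    also have "\<dots> = 1"
      by (rule cis_multiple_2pi) auto
    finally show ?thesis .
  qed
  show ?thesis
  proof (cases "n = k")
    case True
    then show ?thesis unfolding trm by simp
  next
    case False
    have "?q \<noteq> 1"
    proof
      assume "?q = 1"
      then have "cos ?t = 1" by (simp add: complex_eq_iff)
      then obtain i :: int where i: "?t = of_int i * (2 * pi)"
        by (auto simp: cos_one_2pi_int mult.commute)
      then have "2 * pi * (real n - real k) = 2 * pi * (of_int i * real m)"
        using assms by (simp add: field_simps)
      then have "real n - real k = of_int i * real m"
        by (subst (asm) mult_cancel_left) simp
      then have "of_int (int n - int k) = (of_int (i * int m) :: real)" by simp
      then have e: "int n - int k = i * int m" by linarith
      have "i \<noteq> 0" using e False by auto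
      then have "\<bar>i * int m\<bar> \<ge> int m" by (auto simp: abs_mult mult_le_cancel_right1)
      then show False using e assms by linarith
    qed
    then have "(\<Sum>j<m. ?q ^ j) = 0" using geometric_sum[of ?q m] qm by simp
    then show ?thesis unfolding trm using False by simp
  qed
qed

text \<open>Parseval without an error term: degree below \<open>m\<close> excludes aliasing among
  the \<open>m\<close> nodes.\<close>

lemma circle_mean_poly:
  assumes "m > 0"
  shows "circle_mean m r (\<lambda>z. \<Sum>n<m. c n * z ^ n) = L2_set (\<lambda>n. cmod (c n) * r ^ n) {..<m}"
proof -
  let ?z = "\<lambda>j. cis (2 * pi * real j / real m)"
  define d where "d n = c n * of_real r ^ n" for n
  have "complex_of_real (\<Sum>j<m. (cmod (\<Sum>n<m. d n * ?z j ^ n))\<^sup>2)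
      = (\<Sum>j<m. (\<Sum>n<m. d n * ?z j ^ n) * cnj (\<Sum>k<m. d k * ?z j ^ k))"
    by (simp only: of_real_sum complex_norm_square)
  also have "\<dots> = (\<Sum>j<m. \<Sum>n<m. \<Sum>k<m. d n * cnj (d k) * (?z j ^ n * cnj (?z j ^ k)))"
    by (simp add: sum_product mult_ac)
  also have "\<dots> = (\<Sum>n<m. \<Sum>j<m. \<Sum>k<m. d n * cnj (d k) * (?z j ^ n * cnj (?z j ^ k)))"
    by (rule sum.swap)
  also have "\<dots> = (\<Sum>n<m. \<Sum>k<m. \<Sum>j<m. d n * cnj (d k) * (?z j ^ n * cnj (?z j ^ k)))"
    by (intro sum.cong refl sum.swap)
  also have "\<dots> = (\<Sum>n<m. \<Sum>k<m. d n * cnj (d k) * (if n = k then of_nat m else 0))"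
    by (intro sum.cong refl) (simp only: sum_distrib_left[symmetric] sum_roots_of_unity lessThan_iff)
  also have "\<dots> = (\<Sum>n<m. d n * cnj (d n) * of_nat m)"
    by (intro sum.cong refl) (simp add: sum.delta if_distrib cong: if_cong)
  also have "\<dots> = complex_of_real (real m * (\<Sum>n<m. (cmod (d n))\<^sup>2))"
    by (simp only: of_real_sum of_real_mult complex_norm_square sum_distrib_left mult_ac of_real_of_nat_eq)
  finally have *: "(\<Sum>j<m. (cmod (\<Sum>n<m. d n * ?z j ^ n))\<^sup>2) = real m * (\<Sum>n<m. (cmod (d n))\<^sup>2)"
    by (simp only: of_real_eq_iff)
  have **: "(\<Sum>n<m. c n * (of_real r * ?z j) ^ n) = (\<Sum>n<m. d n * ?z j ^ n)" for j
    by (simp add: d_def power_mult_distrib mult_ac)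
  have "(cmod (d n))\<^sup>2 = (cmod (c n) * r ^ n)\<^sup>2" for n
    by (simp add: d_def norm_mult norm_power power_mult_distrib flip: power_abs)
  with * ** show ?thesis
    using assms by (simp add: circle_mean_def L2_set_def real_sqrt_mult)
qed

lemma circle_mean_triangle:
  "circle_mean m r (\<lambda>z. f z + g z) \<le> circle_mean m r f + circle_mean m r g"
proof -
  let ?z = "\<lambda>j. of_real r * cis (2 * pi * real j / real m)"
  have "L2_set (\<lambda>j. cmod (f (?z j) + g (?z j))) {..<m}
      \<le> L2_set (\<lambda>j. cmod (f (?z j)) + cmod (g (?z j))) {..<m}"
    by (intro L2_set_mono norm_triangle_ineq) auto
  also have "\<dots> \<le> L2_set (\<lambda>j. cmod (f (?z j))) {..<m} + L2_set (\<lambda>j. cmod (g (?z j))) {..<m}"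
    by (rule L2_set_triangle_ineq)
  finally show ?thesis
    by (simp add: circle_mean_def divide_right_mono flip: add_divide_distrib)
qed

lemma circle_mean_mono:
  assumes "\<And>z. cmod z = r \<Longrightarrow> cmod (f z) \<le> cmod (g z)" "r \<ge> 0"
  shows "circle_mean m r f \<le> circle_mean m r g"
  unfolding circle_mean_def
  by (intro divide_right_mono L2_set_mono assms) (auto simp: norm_mult assms(2))

lemma circle_mean_const:
  assumes "m > 0" shows "circle_mean m r (\<lambda>z. c) = cmod c"
  using assms by (simp add: circle_mean_def L2_set_constant)

lemma circle_mean_cmult: "circle_mean m r (\<lambda>z. c * f z) = cmod c * circle_mean m r f"
  by (simp add: circle_mean_def norm_mult L2_set_right_distrib)

lemma circle_mean_nonneg: "circle_mean m r f \<ge> 0"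
  by (simp add: circle_mean_def L2_set_nonneg)

lemma circle_mean_sup:
  assumes "\<And>z. cmod z = r \<Longrightarrow> cmod (f z) \<le> B" "r \<ge> 0" "m > 0" "B \<ge> 0"
  shows "circle_mean m r f \<le> B"
  using circle_mean_mono[of r f "\<lambda>z. of_real B" m] assms by (simp add: circle_mean_const)

text \<open>The bound is uniform on the circle, hence it also bounds the circle mean of the
  tail.\<close>

lemma maclaurin_tail_tendsto_0:
  assumes f: "f holomorphic_on ball 0 1" and r: "0 \<le> r" "r < 1"
  obtains \<tau> where "\<tau> \<longlonglongrightarrow> 0" "\<And>m z. cmod z = r \<Longrightarrow> cmod (f z - (\<Sum>n<m. maclaurin_coeff f n * z ^ n)) \<le> \<tau> m"
proof -
  let ?c = "maclaurin_coeff f"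
  \<comment> \<open>Convergence at some s > r gives absolute convergence at
    \<open>r\<close>.\<close>
  obtain s where s: "r < s" "s < 1" using r dense by blast
  have "summable (\<lambda>n. ?c n * of_real s ^ n)"
    using maclaurin_sums[OF f, of "of_real s"] s r by (auto simp: sums_iff)
  then have "summable (\<lambda>n. norm (?c n * of_real r ^ n))"
    by (rule powser_insidea) (use s r in auto)
  then have sm: "summable (\<lambda>n. cmod (?c n) * r ^ n)"
    using r by (simp add: norm_mult norm_power)
  define \<tau> where "\<tau> m = (\<Sum>n. cmod (?c (n + m)) * r ^ (n + m))" for m
  have "\<tau> \<longlonglongrightarrow> 0"
    unfolding \<tau>_def by (rule suminf_exist_split2[OF sm])
  moreover have "cmod (f z - (\<Sum>n<m. ?c n * z ^ n)) \<le> \<tau> m" if "cmod z = r" for m z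
  proof -
    have "(\<lambda>n. ?c n * z ^ n) sums f z" using maclaurin_sums[OF f] that r by auto
    then have *: "f z - (\<Sum>n<m. ?c n * z ^ n) = (\<Sum>n. ?c (n + m) * z ^ (n + m))"
      using suminf_split_initial_segment[of "\<lambda>n. ?c n * z ^ n" m] by (simp add: sums_iff)
    show ?thesis unfolding * \<tau>_def
      using summable_ignore_initial_segment[OF sm, of m] that
      by (intro norm_suminf_le) (auto simp: norm_mult norm_power)
  qed
  ultimately show ?thesis using that by blast
qed

text \<open>The truncation to degree below \<open>m\<close> has its mean computed exactly by
  \<open>circle_mean_poly\<close>, and the tail contributes at most \<open>\<tau> m\<close>. The
  bound \<open>X m\<close> may depend on \<open>m\<close> because only its limit is
  compared.\<close>

lemma circle_mean_lower:
  assumes f: "f holomorphic_on ball 0 1" and r: "0 \<le> r" "r < 1"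
    and X: "X \<longlonglongrightarrow> B" "\<And>m. m > 0 \<Longrightarrow> circle_mean m r f \<le> X m"
  shows "L2_set (\<lambda>n. cmod (maclaurin_coeff f n) * r ^ n) {..<N} \<le> B"
proof -
  obtain \<tau> where \<tau>: "\<tau> \<longlonglongrightarrow> 0" 
    "\<And>m z. cmod z = r \<Longrightarrow> cmod (f z - (\<Sum>n<m. maclaurin_coeff f n * z ^ n)) \<le> \<tau> m"
    using maclaurin_tail_tendsto_0[OF f r] by blast
  have nonneg: "0 \<le> \<tau> m" for m
    using order_trans[OF norm_ge_zero \<tau>(2)[of "of_real r" m]] r by simp
  have *: "L2_set (\<lambda>n. cmod (maclaurin_coeff f n) * r ^ n) {..<N} \<le> X m + \<tau> m" if m: "m \<ge> max N 1" for m
  proof -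
    let ?P = "\<lambda>z. \<Sum>n<m. maclaurin_coeff f n * z ^ n"
    have "L2_set (\<lambda>n. cmod (maclaurin_coeff f n) * r ^ n) {..<N}
        \<le> L2_set (\<lambda>n. cmod (maclaurin_coeff f n) * r ^ n) {..<m}"
      using m unfolding L2_set_def by (intro real_sqrt_le_mono sum_mono2) auto
    also have "\<dots> = circle_mean m r ?P"
      using m by (subst circle_mean_poly) auto
    also have "\<dots> = circle_mean m r (\<lambda>z. f z + (?P z - f z))" by simp
    also have "\<dots> \<le> circle_mean m r f + circle_mean m r (\<lambda>z. ?P z - f z)"
      by (rule circle_mean_triangle)
    also have "\<dots> \<le> X m + \<tau> m"
      using m r \<tau>(2)[of _ m] nonneg
      by (intro add_mono X circle_mean_sup) (auto simp: norm_minus_commute)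
    finally show ?thesis .
  qed
  have "(\<lambda>m. X m + \<tau> m) \<longlonglongrightarrow> B + 0" by (intro tendsto_intros X \<tau>)
  then show ?thesis
    by (intro LIMSEQ_le_const[of "\<lambda>m. X m + \<tau> m"]) (use * in \<open>auto intro!: exI[of _ "max N 1"]\<close>)
qed

text \<open>Hardy norm at most \<open>M\<close>, phrased with partial sums so that it applies to
  functions not yet known to lie in the space and survives limits easily.\<close>

definition hardy_le :: "(complex \<Rightarrow> complex) \<Rightarrow> real \<Rightarrow> bool"
  where "hardy_le f M \<longleftrightarrow> f holomorphic_on ball 0 1 \<and> 0 \<le> M \<and>
    (\<forall>N. L2_set (\<lambda>n. cmod (maclaurin_coeff f n)) {..<N} \<le> M)"

text \<open>Here \<open>m\<close> grows at fixed radius before the radius tends to 1. The dependence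
  of the bound on \<open>r\<close> serves the singular inner factor, whose modulus approaches 1 only
  at the circle.\<close>

lemma hardy_leI_limit:
  assumes f: "f holomorphic_on ball 0 1" and g: "(g \<longlongrightarrow> M) (at_left 1)" and M: "0 \<le> M"
    and X: "\<And>r. \<lbrakk>0 < r; r < 1\<rbrakk> \<Longrightarrow> \<exists>X. X \<longlonglongrightarrow> g r \<and> (\<forall>m>0. circle_mean m r f \<le> X m)"
  shows "hardy_le f M"
  unfolding hardy_le_def
proof (intro conjI allI f M)
  fix N
  let ?L = "\<lambda>r. L2_set (\<lambda>n. cmod (maclaurin_coeff f n) * r ^ n) {..<N}"
  have "(?L \<longlongrightarrow> ?L 1) (at_left 1)"
    unfolding L2_set_def by (intro tendsto_intros)
  moreover have "eventually (\<lambda>r. ?L r \<le> g r) (at_left (1::real))"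
    unfolding eventually_at_left_field
  proof (intro exI[of _ 0] conjI allI impI)
    fix r :: real assume "0 < r" "r < 1"
    then show "?L r \<le> g r" using X[of r] circle_mean_lower[OF f, of r _ "g r"] by auto
  qed auto
  ultimately have "?L 1 \<le> M"
    by (intro tendsto_le[OF _ g, of ?L "?L 1"]) auto
  then show "L2_set (\<lambda>n. cmod (maclaurin_coeff f n)) {..<N} \<le> M" by simp
qed

lemma hardy_leI:
  assumes "f holomorphic_on ball 0 1" "0 \<le> M"
    and "\<And>r. \<lbrakk>0 < r; r < 1\<rbrakk> \<Longrightarrow> \<exists>X. X \<longlonglongrightarrow> M \<and> (\<forall>m>0. circle_mean m r f \<le> X m)"
  shows "hardy_le f M"
  by (rule hardy_leI_limit[where g = "\<lambda>_. M"]) (use assms in auto)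

section \<open>Point evaluations and operations on norm bounds\<close>

lemma sum_geometric_norm_le:
  assumes "cmod w < 1"
  shows "(\<Sum>n<N. (cmod w)\<^sup>2 ^ n) \<le> 1 / (1 - (cmod w)\<^sup>2)"
proof -
  have r2: "(cmod w)\<^sup>2 < 1" using assms by (simp add: power_less_one_iff abs_square_less_1)
  have "(\<Sum>n<N. (cmod w)\<^sup>2 ^ n) \<le> (\<Sum>n. (cmod w)\<^sup>2 ^ n)"
    using r2 by (intro sum_le_suminf summable_geometric) auto
  then show ?thesis using r2 by (subst (asm) suminf_geometric) auto
qed

text \<open>Cauchy-Schwarz against the powers of |z|, whose squares form a geometric series from the
  index \<open>m\<close> on.\<close>

lemma hardy_le_tail:
  assumes f: "hardy_le f M" and r: "cmod z < 1"
  shows "cmod (f z - (\<Sum>n<m. maclaurin_coeff f n * z ^ n)) \<le> M * (cmod z ^ m / sqrt (1 - (cmod z)\<^sup>2))"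
proof -
  let ?c = "maclaurin_coeff f" and ?r = "cmod z"
  have hol: "f holomorphic_on ball 0 1" and M: "0 \<le> M" using f by (auto simp: hardy_le_def)
  have r2: "?r\<^sup>2 < 1" using r by (simp add: power_less_one_iff abs_square_less_1)
  have *: "cmod ((\<Sum>n<N. ?c n * z ^ n) - (\<Sum>n<m. ?c n * z ^ n)) \<le> M * (?r ^ m / sqrt (1 - ?r\<^sup>2))"
    if "N \<ge> m" for N
  proof -
    have "(\<Sum>n<N. ?c n * z ^ n) - (\<Sum>n<m. ?c n * z ^ n) = (\<Sum>n\<in>{m..<N}. ?c n * z ^ n)"
      using that by (metis atLeast0LessThan sum_diff_nat_ivl zero_le)
    also have "cmod \<dots> \<le> (\<Sum>n\<in>{m..<N}. \<bar>cmod (?c n)\<bar> * \<bar>?r ^ n\<bar>)"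
      by (rule order_trans[OF norm_sum]) (simp add: norm_mult norm_power)
    also have "\<dots> \<le> L2_set (\<lambda>n. cmod (?c n)) {m..<N} * L2_set (\<lambda>n. ?r ^ n) {m..<N}"
      by (rule L2_set_mult_ineq)
    also have "\<dots> \<le> M * (?r ^ m / sqrt (1 - ?r\<^sup>2))"
    proof (intro mult_mono)
      have "L2_set (\<lambda>n. cmod (?c n)) {m..<N} \<le> L2_set (\<lambda>n. cmod (?c n)) {..<N}"
        unfolding L2_set_def by (intro real_sqrt_le_mono sum_mono2) auto
      also have "\<dots> \<le> M" using f by (auto simp: hardy_le_def)
      finally show "L2_set (\<lambda>n. cmod (?c n)) {m..<N} \<le> M" .
      have "(\<Sum>n\<in>{m..<N}. (?r ^ n)\<^sup>2) = (\<Sum>n<N-m. ?r\<^sup>2 ^ (n + m))"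
        using that by (intro sum.reindex_bij_witness[of _ "\<lambda>n. n + m" "\<lambda>n. n - m"])
          (auto simp: power_mult[symmetric] mult.commute)
      also have "\<dots> = ?r\<^sup>2 ^ m * (\<Sum>n<N-m. ?r\<^sup>2 ^ n)"
        by (simp add: power_add sum_distrib_left mult_ac)
      also have "\<dots> \<le> ?r\<^sup>2 ^ m * (1 / (1 - ?r\<^sup>2))"
        by (intro mult_left_mono sum_geometric_norm_le r) simp
      finally have "L2_set (\<lambda>n. ?r ^ n) {m..<N} \<le> sqrt (?r\<^sup>2 ^ m * (1 / (1 - ?r\<^sup>2)))"
        unfolding L2_set_def by (rule real_sqrt_le_mono)
      also have "\<dots> = ?r ^ m / sqrt (1 - ?r\<^sup>2)"
        by (simp add: real_sqrt_mult real_sqrt_divide real_sqrt_power)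
      finally show "L2_set (\<lambda>n. ?r ^ n) {m..<N} \<le> ?r ^ m / sqrt (1 - ?r\<^sup>2)" .
    qed (auto simp: M L2_set_nonneg)
    finally show ?thesis .
  qed
  have "(\<lambda>N. \<Sum>n<N. ?c n * z ^ n) \<longlonglongrightarrow> f z"
    using maclaurin_sums[OF hol, of z] r by (auto simp: sums_def)
  then have "(\<lambda>N. cmod ((\<Sum>n<N. ?c n * z ^ n) - (\<Sum>n<m. ?c n * z ^ n)))
      \<longlonglongrightarrow> cmod (f z - (\<Sum>n<m. ?c n * z ^ n))"
    by (intro tendsto_intros)
  then show ?thesis
    by (rule LIMSEQ_le_const2) (use * in auto)
qed

lemma hardy_le_point:
  assumes "hardy_le f M" "cmod z < 1"
  shows "cmod (f z) \<le> M / sqrt (1 - (cmod z)\<^sup>2)"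
  using hardy_le_tail[OF assms, of 0] by simp

text \<open>The polynomial part has mean at most \<open>M\<close> by Parseval, and the tail is
  estimated in sup norm. The excess factor tends to 1 as \<open>m\<close> grows, so nothing is lost
  in the limit.\<close>

lemma circle_mean_upper:
  assumes f: "hardy_le f M" and r: "0 \<le> r" "r < 1" and m: "m > 0"
  shows "circle_mean m r f \<le> M * (1 + r ^ m / sqrt (1 - r\<^sup>2))"
proof -
  let ?c = "maclaurin_coeff f" and ?P = "\<lambda>z. \<Sum>n<m. maclaurin_coeff f n * z ^ n"
  have M: "0 \<le> M" using f by (auto simp: hardy_le_def)
  have r2: "r\<^sup>2 < 1" using r by (simp add: power_less_one_iff abs_square_less_1)
  have "circle_mean m r f = circle_mean m r (\<lambda>z. ?P z + (f z - ?P z))" by simp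
  also have "\<dots> \<le> circle_mean m r ?P + circle_mean m r (\<lambda>z. f z - ?P z)"
    by (rule circle_mean_triangle)
  also have "circle_mean m r ?P \<le> M"
  proof -
    have "circle_mean m r ?P \<le> L2_set (\<lambda>n. cmod (?c n)) {..<m}"
      unfolding circle_mean_poly[OF m] using r
      by (intro L2_set_mono) (auto simp: mult_left_le power_le_one)
    also have "\<dots> \<le> M" using f by (auto simp: hardy_le_def)
    finally show ?thesis .
  qed
  also have "circle_mean m r (\<lambda>z. f z - ?P z) \<le> M * (r ^ m / sqrt (1 - r\<^sup>2))"
  proof (rule circle_mean_sup)
    fix z assume "cmod z = r"
    then show "cmod (f z - ?P z) \<le> M * (r ^ m / sqrt (1 - r\<^sup>2))"
      using hardy_le_tail[OF f, of z m] r by simp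
  qed (use r r2 M m in auto)
  finally show ?thesis by (simp add: algebra_simps)
qed

lemma circle_bound_tendsto:
  assumes "0 \<le> r" "r < (1::real)"
  shows "(\<lambda>m. M * (1 + r ^ m / sqrt (1 - r\<^sup>2))) \<longlonglongrightarrow> M"
proof -
  have "(\<lambda>m. M * (1 + r ^ m / sqrt (1 - r\<^sup>2))) \<longlonglongrightarrow> M * (1 + 0 / sqrt (1 - r\<^sup>2))"
    using assms by (intro tendsto_intros LIMSEQ_power_zero) (auto simp: power_eq_1_iff abs_square_eq_1)
  then show ?thesis by simp
qed

text \<open>A pointwise bound on \<open>u\<close> is invisible to coefficients, but circle means are
  monotone in the modulus; going over to means and back costs only factors that tend to 1.\<close>

lemma hardy_le_mult:
  assumes g: "hardy_le g M" and u: "u holomorphic_on ball 0 1" "\<And>z. z \<in> ball 0 1 \<Longrightarrow> cmod (u z) \<le> s"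
  shows "hardy_le (\<lambda>z. u z * g z) (s * M)"
proof (rule hardy_leI)
  have s: "0 \<le> s" using u(2)[of 0] order_trans[OF norm_ge_zero] by auto
  have M: "0 \<le> M" and gh: "g holomorphic_on ball 0 1" using g by (auto simp: hardy_le_def)
  show "(\<lambda>z. u z * g z) holomorphic_on ball 0 1" by (intro holomorphic_intros u gh)
  show "0 \<le> s * M" using s M by simp
  fix r :: real assume r: "0 < r" "r < 1"
  let ?X = "\<lambda>m. (s * M) * (1 + r ^ m / sqrt (1 - r\<^sup>2))"
  have "circle_mean m r (\<lambda>z. u z * g z) \<le> ?X m" if "m > 0" for m
  proof -
    have "circle_mean m r (\<lambda>z. u z * g z) \<le> circle_mean m r (\<lambda>z. of_real s * g z)"
      using r s by (intro circle_mean_mono) (auto simp: norm_mult intro!: mult_right_mono u)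
    also have "\<dots> = s * circle_mean m r g" using s by (simp add: circle_mean_cmult)
    also have "\<dots> \<le> s * (M * (1 + r ^ m / sqrt (1 - r\<^sup>2)))"
      using s r that by (intro mult_left_mono circle_mean_upper g) auto
    finally show ?thesis by (simp add: mult.assoc)
  qed
  then show "\<exists>X. X \<longlonglongrightarrow> s * M \<and> (\<forall>m>0. circle_mean m r (\<lambda>z. u z * g z) \<le> X m)"
    using circle_bound_tendsto[of r] r by (intro exI[of _ ?X]) auto
qed

lemma hardy_le_bounded:
  assumes u: "u holomorphic_on ball 0 1" "\<And>z. z \<in> ball 0 1 \<Longrightarrow> cmod (u z) \<le> s"
  shows "hardy_le u s"
proof -
  have "hardy_le (\<lambda>z. 1) 1"
  proof (rule hardy_leI)
    fix r :: real
    show "\<exists>X. X \<longlonglongrightarrow> 1 \<and> (\<forall>m>0. circle_mean m r (\<lambda>z. 1) \<le> X m)"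
      by (rule exI[of _ "\<lambda>_. 1"]) (simp add: circle_mean_const)
  qed auto
  from hardy_le_mult[OF this u] show ?thesis by simp
qed

text \<open>A Fatou lemma for Hardy norms: for fixed \<open>m\<close> and \<open>r\<close> the
  circle mean involves finitely many points, so pointwise convergence suffices.\<close>

lemma hardy_le_limit:
  assumes f: "\<And>k::nat. hardy_le (f k) M" "g holomorphic_on ball 0 1"
    and lim: "\<And>z. z \<in> ball 0 1 \<Longrightarrow> (\<lambda>k. f k z) \<longlonglongrightarrow> g z"
  shows "hardy_le g M"
proof (rule hardy_leI)
  show "0 \<le> M" using f(1) by (auto simp: hardy_le_def)
  fix r :: real assume r: "0 < r" "r < 1"
  have "circle_mean m r g \<le> M * (1 + r ^ m / sqrt (1 - r\<^sup>2))" if "m > 0" for m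
  proof (rule LIMSEQ_le_const2)
    show "(\<lambda>k. circle_mean m r (f k)) \<longlonglongrightarrow> circle_mean m r g"
      unfolding circle_mean_def L2_set_def using r that
      by (intro tendsto_intros lim) (auto simp: norm_mult)
    show "\<exists>N. \<forall>n\<ge>N. circle_mean m r (f n) \<le> M * (1 + r ^ m / sqrt (1 - r\<^sup>2))"
      using circle_mean_upper[OF f(1)] r that by auto
  qed
  then show "\<exists>X. X \<longlonglongrightarrow> M \<and> (\<forall>m>0. circle_mean m r g \<le> X m)"
    using circle_bound_tendsto[of r M] r by (intro exI[of _ "\<lambda>m. M * (1 + r ^ m / sqrt (1 - r\<^sup>2))"]) auto
qed (rule f)

lemma hardy_le_add:
  assumes f: "hardy_le f A" and g: "hardy_le g B"
  shows "hardy_le (\<lambda>z. f z + g z) (A + B)"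
  unfolding hardy_le_def
proof (intro conjI allI)
  have hol: "f holomorphic_on ball 0 1" "g holomorphic_on ball 0 1"
    using f g by (auto simp: hardy_le_def)
  then show "(\<lambda>z. f z + g z) holomorphic_on ball 0 1" by (intro holomorphic_intros)
  show "0 \<le> A + B" using f g by (auto simp: hardy_le_def)
  fix N
  have "L2_set (\<lambda>n. cmod (maclaurin_coeff (\<lambda>z. f z + g z) n)) {..<N}
      \<le> L2_set (\<lambda>n. cmod (maclaurin_coeff f n) + cmod (maclaurin_coeff g n)) {..<N}"
    by (intro L2_set_mono) (auto simp: maclaurin_coeff_add hol norm_triangle_ineq)
  also have "\<dots> \<le> A + B"
    by (intro order_trans[OF L2_set_triangle_ineq] add_mono) (use f g in \<open>auto simp: hardy_le_def\<close>)
  finally show "L2_set (\<lambda>n. cmod (maclaurin_coeff (\<lambda>z. f z + g z) n)) {..<N} \<le> A + B" .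
qed

lemma hardy_le_cmult:
  assumes f: "hardy_le f A" 
  shows "hardy_le (\<lambda>z. c * f z) (cmod c * A)"
  using hardy_le_mult[OF f, of "\<lambda>_. c" "cmod c"] by simp

lemma hardy_le_sum:
  assumes "\<And>i. i \<in> I \<Longrightarrow> hardy_le (f i) (A i)"
  shows "hardy_le (\<lambda>z. \<Sum>i\<in>I. f i z) (\<Sum>i\<in>I. A i)"
  using assms
proof (induction I rule: infinite_finite_induct)
  case (insert x F)
  then show ?case by (auto intro!: hardy_le_add)
qed (use hardy_le_bounded[of "\<lambda>z. 0" 0] in auto)

lemma hardy_le_mono: "hardy_le f A \<Longrightarrow> A \<le> B \<Longrightarrow> hardy_le f B"
  unfolding hardy_le_def by (meson order_trans)

lemma hardy_le_cong:
  assumes "hardy_le f A" "\<And>z. z \<in> ball 0 1 \<Longrightarrow> f z = g z"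
  shows "hardy_le g A"
proof (rule hardy_le_limit[of "\<lambda>_. f"])
  show "g holomorphic_on ball 0 1"
    using assms holomorphic_transform[of f "ball 0 1" g] by (auto simp: hardy_le_def)
qed (use assms in auto)

section \<open>Subordination and completeness\<close>

lemma one_minus_cnj_mult_nonzero:
  assumes "cmod w < 1" "cmod z < 1" shows "1 - cnj w * z \<noteq> 0"
proof
  assume "1 - cnj w * z = 0"
  then have "cmod (cnj w * z) = 1" by simp
  moreover have "cmod (cnj w * z) < 1" 
    using norm_mult_less[of "cnj w" 1 z 1] assms by simp
  ultimately show False by simp
qed

lemma maclaurin_coeff_kernel:
  assumes "cmod w < 1"
  shows "(\<lambda>z. c / (1 - cnj w * z)) holomorphic_on ball 0 1"
    "maclaurin_coeff (\<lambda>z. c / (1 - cnj w * z)) n = c * cnj w ^ n"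
proof -
  have *: "(\<lambda>n. c * cnj w ^ n * z ^ n) sums (c / (1 - cnj w * z))" if "z \<in> ball 0 1" for z
  proof -
    have "cmod (cnj w * z) < 1"
      using norm_mult_less[of "cnj w" 1 z 1] assms that by simp
    from sums_mult[OF geometric_sums[OF this], of c] show ?thesis
      by (simp add: power_mult_distrib mult.assoc)
  qed
  show "(\<lambda>z. c / (1 - cnj w * z)) holomorphic_on ball 0 1"
    "maclaurin_coeff (\<lambda>z. c / (1 - cnj w * z)) n = c * cnj w ^ n"
    by (rule power_series_on_disc[OF *]; assumption)+
qed

lemma cmod_add_power2: "(cmod (x + y))\<^sup>2 = (cmod x)\<^sup>2 + (cmod y)\<^sup>2 + 2 * Re (cnj x * y)"
  unfolding cmod_power2 by (simp add: power2_eq_square algebra_simps)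

text \<open>A function vanishing at \<open>w\<close> is orthogonal to the reproducing kernel at \<open>w\<close>.\<close>

lemma hardy_le_kernel_add:
  assumes g: "hardy_le g M" "g w = 0" and w: "cmod w < 1"
  shows "hardy_le (\<lambda>z. c / (1 - cnj w * z) + g z) (sqrt ((cmod c)\<^sup>2 / (1 - (cmod w)\<^sup>2) + M\<^sup>2))"
    (is "hardy_le ?h (sqrt ?B)")
  unfolding hardy_le_def
proof (intro conjI allI)
  have hol: "g holomorphic_on ball 0 1" using g by (auto simp: hardy_le_def)
  note kernel = maclaurin_coeff_kernel[OF w]
  show "?h holomorphic_on ball 0 1" by (intro holomorphic_on_add kernel hol)
  have r2: "(cmod w)\<^sup>2 < 1" using w by (simp add: power_less_one_iff abs_square_less_1)
  then have B: "0 \<le> ?B" by simp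
  then show "0 \<le> sqrt ?B" by simp
  let ?g = "maclaurin_coeff g"
  define S where "S N = (\<Sum>n<N. (cmod (maclaurin_coeff ?h n))\<^sup>2)" for N
  \<comment> \<open>Partial sums of the series of \<open>g\<close> at \<open>w\<close>: they collect
    the cross terms below and tend to \<open>g w = 0\<close>.\<close>
  define t where "t = (\<lambda>N. \<Sum>n<N. ?g n * w ^ n)"
  have t: "t \<longlonglongrightarrow> 0"
    using maclaurin_sums[OF hol, of w] w g(2) by (simp add: sums_def t_def)
  have S: "S N \<le> ?B + 2 * Re (cnj c * t N)" for N
  proof -
    have "S N = (\<Sum>n<N. (cmod (c * cnj w ^ n + ?g n))\<^sup>2)"
      unfolding S_def by (simp add: maclaurin_coeff_add kernel hol)
    also have "\<dots> = (\<Sum>n<N. (cmod c)\<^sup>2 * (cmod w)\<^sup>2 ^ n + (cmod (?g n))\<^sup>2 + 2 * Re (cnj c * (?g n * w ^ n)))"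
    proof (intro sum.cong refl)
      fix n
      have "(cmod (c * cnj w ^ n + ?g n))\<^sup>2
          = (cmod (c * cnj w ^ n))\<^sup>2 + (cmod (?g n))\<^sup>2 + 2 * Re (cnj (c * cnj w ^ n) * ?g n)"
        by (rule cmod_add_power2)
      then show "(cmod (c * cnj w ^ n + ?g n))\<^sup>2
          = (cmod c)\<^sup>2 * (cmod w)\<^sup>2 ^ n + (cmod (?g n))\<^sup>2 + 2 * Re (cnj c * (?g n * w ^ n))"
        by (simp add: norm_mult norm_power power_mult_distrib mult_ac flip: power_mult)
    qed
    also have "\<dots> = (cmod c)\<^sup>2 * (\<Sum>n<N. (cmod w)\<^sup>2 ^ n) + (\<Sum>n<N. (cmod (?g n))\<^sup>2) + 2 * Re (cnj c * t N)"
      by (simp add: sum.distrib sum_distrib_left t_def Re_sum)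
    also have "\<dots> \<le> (cmod c)\<^sup>2 * (1 / (1 - (cmod w)\<^sup>2)) + M\<^sup>2 + 2 * Re (cnj c * t N)"
    proof (intro add_mono mult_left_mono sum_geometric_norm_le w order_refl)
      have "L2_set (\<lambda>n. cmod (?g n)) {..<N} \<le> M" "0 \<le> M" using g by (auto simp: hardy_le_def)
      then have "(L2_set (\<lambda>n. cmod (?g n)) {..<N})\<^sup>2 \<le> M\<^sup>2" by (intro power_mono L2_set_nonneg)
      then show "(\<Sum>n<N. (cmod (?g n))\<^sup>2) \<le> M\<^sup>2" by (simp add: L2_set_def sum_nonneg)
    qed auto
    finally show ?thesis by simp
  qed
  fix N
  have "S N \<le> ?B"
  proof (rule LIMSEQ_le_const)
    show "(\<lambda>N. ?B + 2 * Re (cnj c * t N)) \<longlonglongrightarrow> ?B"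
      by (rule tendsto_eq_intros t refl)+ simp
    \<comment> \<open>\<open>S\<close> is nondecreasing, so the bound at any later \<open>k\<close>
      holds at \<open>N\<close> too; letting \<open>k\<close> grow removes the cross term.\<close>
    have "S N \<le> ?B + 2 * Re (cnj c * t k)" if "k \<ge> N" for k
      using that by (intro order_trans[OF _ S]) (auto simp: S_def intro!: sum_mono2)
    then show "\<exists>K. \<forall>k\<ge>K. S N \<le> ?B + 2 * Re (cnj c * t k)" by blast
  qed
  then show "L2_set (\<lambda>n. cmod (maclaurin_coeff ?h n)) {..<N} \<le> sqrt ?B"
    unfolding L2_set_def S_def by (rule real_sqrt_le_mono)
qed

text \<open>The sum is \<open>c 0\<close> plus \<phi> times a sum with one term less. Because \<phi>
  vanishes at \<open>w\<close>, the second part is orthogonal to the kernel at \<open>w\<close>, so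
  squared norms add up, and multiplication by \<phi> does not increase the norm. The kernel factor
  stands in for the constant 1, which has this orthogonality when w = 0.\<close>

lemma subordination_poly:
  assumes \<phi>: "disc_selfmap \<phi>" "\<phi> w = 0" and w: "cmod w < 1"
  shows "hardy_le (\<lambda>z. 1 / (1 - cnj w * z) * (\<Sum>k<n. c k * \<phi> z ^ k))
    (sqrt ((\<Sum>k<n. (cmod (c k))\<^sup>2) / (1 - (cmod w)\<^sup>2)))"
proof (induction n arbitrary: c)
  case 0
  show ?case using hardy_le_bounded[of "\<lambda>z. 0" 0] by simp
next
  case (Suc n)
  have r2: "(cmod w)\<^sup>2 < 1" using w by (simp add: power_less_one_iff abs_square_less_1)
  let ?A = "(\<Sum>k<n. (cmod (c (Suc k)))\<^sup>2) / (1 - (cmod w)\<^sup>2)"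
  have "hardy_le (\<lambda>z. \<phi> z * (1 / (1 - cnj w * z) * (\<Sum>k<n. c (Suc k) * \<phi> z ^ k))) (1 * sqrt ?A)"
    by (intro hardy_le_mult Suc.IH[of "\<lambda>k. c (Suc k)"])
      (use \<phi>(1) in \<open>auto simp: disc_selfmap_def image_subset_iff less_imp_le\<close>)
  then have "hardy_le (\<lambda>z. c 0 / (1 - cnj w * z) + \<phi> z * (1 / (1 - cnj w * z) * (\<Sum>k<n. c (Suc k) * \<phi> z ^ k)))
      (sqrt ((cmod (c 0))\<^sup>2 / (1 - (cmod w)\<^sup>2) + (1 * sqrt ?A)\<^sup>2))"
    by (rule hardy_le_kernel_add) (use \<phi> w in auto)
  moreover have "(1 * sqrt ?A)\<^sup>2 = ?A" using r2 by (simp add: sum_nonneg)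
  then have "(cmod (c 0))\<^sup>2 / (1 - (cmod w)\<^sup>2) + (1 * sqrt ?A)\<^sup>2
      = (\<Sum>k<Suc n. (cmod (c k))\<^sup>2) / (1 - (cmod w)\<^sup>2)"
    by (simp only: sum.lessThan_Suc_shift add_divide_distrib)
  moreover have "c 0 / (1 - cnj w * z) + \<phi> z * (1 / (1 - cnj w * z) * (\<Sum>k<n. c (Suc k) * \<phi> z ^ k))
      = 1 / (1 - cnj w * z) * (\<Sum>k<Suc n. c k * \<phi> z ^ k)" for z
    by (simp add: sum.lessThan_Suc_shift sum_distrib_left sum_divide_distrib add_divide_distrib mult_ac del: sum.lessThan_Suc)
  ultimately show ?case by simp
qed

lemma subordination_zero:
  assumes f: "hardy_le f M" and \<phi>: "disc_selfmap \<phi>" "\<phi> w = 0" and w: "cmod w < 1"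
  shows "hardy_le (\<lambda>z. 1 / (1 - cnj w * z) * f (\<phi> z)) (M / sqrt (1 - (cmod w)\<^sup>2))"
proof (rule hardy_le_limit)
  let ?c = "maclaurin_coeff f"
  have hol: "f holomorphic_on ball 0 1" and M: "0 \<le> M" using f by (auto simp: hardy_le_def)
  have \<phi>': "\<phi> holomorphic_on ball 0 1" "\<phi> ` ball 0 1 \<subseteq> ball 0 1" using \<phi> by (auto simp: disc_selfmap_def)
  have r2: "(cmod w)\<^sup>2 < 1" using w by (simp add: power_less_one_iff abs_square_less_1)
  show "hardy_le (\<lambda>z. 1 / (1 - cnj w * z) * (\<Sum>k<n. ?c k * \<phi> z ^ k)) (M / sqrt (1 - (cmod w)\<^sup>2))" for n
  proof (rule hardy_le_mono[OF subordination_poly[OF \<phi> w]])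
    have "L2_set (\<lambda>n. cmod (?c n)) {..<n} \<le> M" using f by (auto simp: hardy_le_def)
    then have "L2_set (\<lambda>n. cmod (?c n)) {..<n} / sqrt (1 - (cmod w)\<^sup>2) \<le> M / sqrt (1 - (cmod w)\<^sup>2)"
      using r2 by (intro divide_right_mono) auto
    then show "sqrt ((\<Sum>k<n. (cmod (?c k))\<^sup>2) / (1 - (cmod w)\<^sup>2)) \<le> M / sqrt (1 - (cmod w)\<^sup>2)"
      by (simp add: real_sqrt_divide L2_set_def)
  qed
  have "(f \<circ> \<phi>) holomorphic_on ball 0 1"
    using holomorphic_on_compose_gen[OF \<phi>'(1) hol \<phi>'(2)] .
  then show "(\<lambda>z. 1 / (1 - cnj w * z) * f (\<phi> z)) holomorphic_on ball 0 1"
    by (intro holomorphic_on_mult maclaurin_coeff_kernel w) (simp add: o_def)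
  show "(\<lambda>n. 1 / (1 - cnj w * z) * (\<Sum>k<n. ?c k * \<phi> z ^ k)) \<longlonglongrightarrow> 1 / (1 - cnj w * z) * f (\<phi> z)"
    if "z \<in> ball 0 1" for z
    using maclaurin_sums[OF hol, of "\<phi> z"] \<phi>'(2) that
    by (intro tendsto_intros) (auto simp: sums_def image_subset_iff)
qed

lemma disc_selfmap_Moebius:
  assumes "cmod w < 1" shows "disc_selfmap (Moebius_function 0 w)"
  using assms Moebius_function_holomorphic Moebius_function_norm_lt_1 by (auto simp: disc_selfmap_def)

lemma disc_selfmap_compose:
  "disc_selfmap f \<Longrightarrow> disc_selfmap g \<Longrightarrow> disc_selfmap (\<lambda>z. f (g z))"
  unfolding disc_selfmap_def
  using holomorphic_on_compose_gen[of g "ball 0 1" f "ball 0 1"] by (auto simp: o_def)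

text \<open>A Moebius map splits \<phi> into a selfmap fixing 0, for which subordination is
  contractive, and an automorphism vanishing at \<open>- \<phi> 0\<close>. Removing the kernel
  weight that belongs to that zero costs a factor of at most 2.\<close>

theorem littlewood_subordination:
  assumes f: "hardy_le f M" and \<phi>: "disc_selfmap \<phi>"
  shows "hardy_le (\<lambda>z. f (\<phi> z)) (2 / sqrt (1 - (cmod (\<phi> 0))\<^sup>2) * M)"
proof -
  let ?v = "\<phi> 0" and ?m = "Moebius_function 0"
  have v: "cmod ?v < 1" and maps: "\<And>z. cmod z < 1 \<Longrightarrow> cmod (\<phi> z) < 1"
    using \<phi> by (auto simp: disc_selfmap_def image_subset_iff)
  then have v': "cmod (- ?v) < 1" by simp
  have "hardy_le (\<lambda>z. 1 / (1 - cnj (- ?v) * z) * f (?m (- ?v) z)) (M / sqrt (1 - (cmod (- ?v))\<^sup>2))"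
    by (intro subordination_zero f disc_selfmap_Moebius v' Moebius_function_eq_zero)
  then have "hardy_le (\<lambda>z. (1 - cnj (- ?v) * z) * (1 / (1 - cnj (- ?v) * z) * f (?m (- ?v) z)))
      (2 * (M / sqrt (1 - (cmod (- ?v))\<^sup>2)))"
  proof (rule hardy_le_mult)
    fix z :: complex assume "z \<in> ball 0 1"
    then have "cmod (cnj (- ?v) * z) \<le> 1"
      using v by (simp add: norm_mult mult_le_one)
    then show "cmod (1 - cnj (- ?v) * z) \<le> 2"
      using norm_triangle_ineq4[of 1 "cnj (- ?v) * z"] by simp
  qed (intro holomorphic_intros)
  then have "hardy_le (\<lambda>z. f (?m (- ?v) z)) (2 * (M / sqrt (1 - (cmod (- ?v))\<^sup>2)))"
    by (rule hardy_le_cong) (use one_minus_cnj_mult_nonzero[OF v'] in auto)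
  then have "hardy_le (\<lambda>z. 1 / (1 - cnj 0 * z) * f (?m (- ?v) (?m ?v (\<phi> z))))
      (2 * (M / sqrt (1 - (cmod (- ?v))\<^sup>2)) / sqrt (1 - (cmod 0)\<^sup>2))"
    by (rule subordination_zero)
      (use v in \<open>auto intro!: disc_selfmap_compose[OF disc_selfmap_Moebius \<phi>] simp: Moebius_function_eq_zero\<close>)
  then show ?thesis
    by (rule hardy_le_cong[OF hardy_le_mono]) (use v maps Moebius_function_compose in auto)
qed

section \<open>Elements of \<open>hardy2\<close>, point evaluation and completeness\<close>

lemma hardy2_holomorphic: "hardy2_fun f holomorphic_on ball 0 1"
  using hardy2_fun[of f] by (simp add: hardy2_set_def)

lemma hardy2_eqI: 
  assumes "\<And>z. z \<in> ball 0 1 \<Longrightarrow> hardy2_fun f z = hardy2_fun g z"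
  shows "f = g"
proof -
  have "hardy2_fun f z = hardy2_fun g z" for z
    using assms hardy2_fun[of f] hardy2_fun[of g] by (cases "z \<in> ball 0 1") (auto simp: hardy2_set_def)
  then show ?thesis by (metis ext hardy2_fun_inject)
qed

lemma hardy2_summable: "summable (\<lambda>n. (cmod (maclaurin_coeff (hardy2_fun f) n))\<^sup>2)"
  using hardy2_fun[of f] by (simp add: hardy2_set_def)

lemma norm_hardy2_eq: "norm f = sqrt (\<Sum>n. (cmod (maclaurin_coeff (hardy2_fun f) n))\<^sup>2)"
  by (simp add: norm_hardy2.rep_eq hardy2_norm_def)

lemma hardy_le_norm: "hardy_le (hardy2_fun f) (norm f)"
  unfolding hardy_le_def L2_set_def norm_hardy2_eq
  by (auto intro!: hardy2_holomorphic real_sqrt_le_mono sum_le_suminf hardy2_summable suminf_nonneg)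

definition to_hardy2 :: "(complex \<Rightarrow> complex) \<Rightarrow> hardy2"
  where "to_hardy2 g = Hardy2 (\<lambda>z. if z \<in> ball 0 1 then g z else 0)"

lemma hardy_le_summable:
  assumes "hardy_le f M"
  shows "summable (\<lambda>n. (cmod (maclaurin_coeff f n))\<^sup>2)" "sqrt (\<Sum>n. (cmod (maclaurin_coeff f n))\<^sup>2) \<le> M"
proof -
  have M: "0 \<le> M" using assms by (simp add: hardy_le_def)
  have *: "(\<Sum>n<N. (cmod (maclaurin_coeff f n))\<^sup>2) \<le> M\<^sup>2" for N
  proof -
    have "(L2_set (\<lambda>n. cmod (maclaurin_coeff f n)) {..<N})\<^sup>2 \<le> M\<^sup>2"
      using assms by (intro power_mono L2_set_nonneg) (auto simp: hardy_le_def)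
    then show ?thesis by (simp add: L2_set_def sum_nonneg)
  qed
  then show s: "summable (\<lambda>n. (cmod (maclaurin_coeff f n))\<^sup>2)"
    by (intro summableI_nonneg_bounded[where x = "M\<^sup>2"]) auto
  have "(\<Sum>n. (cmod (maclaurin_coeff f n))\<^sup>2) \<le> M\<^sup>2"
    by (intro suminf_le_const s *)
  then show "sqrt (\<Sum>n. (cmod (maclaurin_coeff f n))\<^sup>2) \<le> M"
    using M by (metis real_sqrt_le_mono real_sqrt_abs abs_of_nonneg)
qed

lemma norm_le_hardy_le: "hardy_le (hardy2_fun f) M \<Longrightarrow> norm f \<le> M"
  unfolding norm_hardy2_eq by (rule hardy_le_summable)

lemma
  assumes "hardy_le g M"
  shows hardy2_fun_to_hardy2: "z \<in> ball 0 1 \<Longrightarrow> hardy2_fun (to_hardy2 g) z = g z"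
    and norm_to_hardy2: "norm (to_hardy2 g) \<le> M"
proof -
  let ?g = "\<lambda>z. if z \<in> ball 0 1 then g z else 0"
  have h: "hardy_le ?g M" by (rule hardy_le_cong[OF assms]) auto
  then have "?g \<in> hardy2_set"
    using hardy_le_summable(1)[OF h] by (auto simp: hardy2_set_def hardy_le_def)
  then have *: "hardy2_fun (to_hardy2 g) = ?g"
    by (simp add: to_hardy2_def Hardy2_inverse)
  show "z \<in> ball 0 1 \<Longrightarrow> hardy2_fun (to_hardy2 g) z = g z" by (simp add: *)
  show "norm (to_hardy2 g) \<le> M" by (rule norm_le_hardy_le) (simp only: * h)
qed

lemma hardy2_eval_le:
  assumes "cmod z < 1"
  shows "cmod (hardy2_fun f z) \<le> norm f / sqrt (1 - (cmod z)\<^sup>2)"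
  by (rule hardy_le_point[OF hardy_le_norm assms])

lemma hardy2_eval_tendsto:
  assumes "X \<longlonglongrightarrow> f" "cmod z < 1"
  shows "(\<lambda>n. hardy2_fun (X n) z) \<longlonglongrightarrow> hardy2_fun f z"
proof (rule LIM_zero_cancel, rule Lim_null_comparison)
  show "\<forall>\<^sub>F n in sequentially. cmod (hardy2_fun (X n) z - hardy2_fun f z) \<le> norm (X n - f) / sqrt (1 - (cmod z)\<^sup>2)"
    using hardy2_eval_le[OF assms(2), of "X _ - f"] by (simp add: minus_hardy2.rep_eq)
  have "(\<lambda>n. norm (X n - f) / sqrt (1 - (cmod z)\<^sup>2)) \<longlonglongrightarrow> norm (f - f) / sqrt (1 - (cmod z)\<^sup>2)"
    using assms(2) by (intro tendsto_intros assms) (auto simp: power_eq_1_iff abs_square_eq_1)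
  then show "(\<lambda>n. norm (X n - f) / sqrt (1 - (cmod z)\<^sup>2)) \<longlonglongrightarrow> 0" by simp
qed

lemma maclaurin_coeff_hardy2_diff:
  "maclaurin_coeff (hardy2_fun (f - g)) n = maclaurin_coeff (hardy2_fun f) n - maclaurin_coeff (hardy2_fun g) n"
  using maclaurin_coeff_add[OF hardy2_holomorphic[of "f - g"] hardy2_holomorphic[of g], of n]
  by (simp add: minus_hardy2.rep_eq)

lemma maclaurin_coeff_hardy2_le: "cmod (maclaurin_coeff (hardy2_fun f) n) \<le> norm f"
proof -
  have "cmod (maclaurin_coeff (hardy2_fun f) n) \<le> L2_set (\<lambda>n. cmod (maclaurin_coeff (hardy2_fun f) n)) {..<Suc n}"
    by (intro member_le_L2_set) auto
  also have "\<dots> \<le> norm f" using hardy_le_norm[of f] by (auto simp: hardy_le_def)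
  finally show ?thesis .
qed

text \<open>The coefficients converge one by one; their limits are bounded, hence define a power
  series on the disc, and the Cauchy estimates for finite sections pass to the limit in the second
  index. Completeness feeds the fixed-point and Baire arguments.\<close>

instance hardy2 :: banach
proof
  fix X :: "nat \<Rightarrow> hardy2" assume X: "Cauchy X"
  let ?c = "\<lambda>k n. maclaurin_coeff (hardy2_fun (X k)) n"
  have "Cauchy (\<lambda>k. ?c k n)" for n
  proof (rule metric_CauchyI)
    fix e :: real assume "e > 0"
    then obtain N where "\<forall>m\<ge>N. \<forall>k\<ge>N. dist (X m) (X k) < e" using X by (auto simp: Cauchy_def)
    moreover have "dist (?c m n) (?c k n) \<le> dist (X m) (X k)" for m k
      using maclaurin_coeff_hardy2_le[of "X m - X k" n] by (simp add: dist_norm maclaurin_coeff_hardy2_diff)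
    ultimately show "\<exists>N. \<forall>m\<ge>N. \<forall>k\<ge>N. dist (?c m n) (?c k n) < e"
      by (meson le_less_trans)
  qed
  then have "convergent (\<lambda>k. ?c k n)" for n by (rule Cauchy_convergent)
  then obtain d where d: "\<And>n. (\<lambda>k. ?c k n) \<longlonglongrightarrow> d n" unfolding convergent_def by metis
  obtain K where K: "\<And>k. norm (X k) \<le> K" 
    using Cauchy_Bseq[OF X] by (auto simp: Bseq_def)
  have dK: "cmod (d n) \<le> K" for n
    using LIMSEQ_le_const2[OF tendsto_norm[OF d[of n]], of K] maclaurin_coeff_hardy2_le K order_trans by blast
  define g where "g z = (\<Sum>n. d n * z ^ n)" for z
  have sums: "(\<lambda>n. d n * z ^ n) sums g z" if "z \<in> ball 0 1" for z
  proof -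
    have "summable (\<lambda>n. K * cmod z ^ n)" using that by (intro summable_mult summable_geometric) auto
    then have "summable (\<lambda>n. d n * z ^ n)"
      by (rule summable_comparison_test'[where N = 0]) (auto simp: norm_mult norm_power dK mult_right_mono)
    then show ?thesis by (simp add: g_def summable_sums)
  qed
  note g = power_series_on_disc[OF sums]
  have coeff: "maclaurin_coeff (\<lambda>z. hardy2_fun (X k) z - g z) n = ?c k n - d n" for k n
    using maclaurin_coeff_add[OF hardy2_holomorphic[of "X k"] holomorphic_on_minus[OF g(1)], of n]
      maclaurin_coeff_cmult[OF g(1), of "-1" n] g(2)[of n] by simp
  have diff: "hardy_le (\<lambda>z. hardy2_fun (X k) z - g z) e" if "\<forall>m\<ge>N. \<forall>k\<ge>N. dist (X m) (X k) < e" "k \<ge> N" for N k e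
    unfolding hardy_le_def
  proof (intro conjI allI)
    show "(\<lambda>z. hardy2_fun (X k) z - g z) holomorphic_on ball 0 1"
      by (intro holomorphic_intros hardy2_holomorphic g)
    have "dist (X k) (X k) < e" using that by blast
    then show "0 \<le> e" by simp
    fix M
    show "L2_set (\<lambda>n. cmod (maclaurin_coeff (\<lambda>z. hardy2_fun (X k) z - g z) n)) {..<M} \<le> e"
    proof (rule LIMSEQ_le_const2)
      show "(\<lambda>m. L2_set (\<lambda>n. cmod (?c k n - ?c m n)) {..<M}) \<longlonglongrightarrow>
        L2_set (\<lambda>n. cmod (maclaurin_coeff (\<lambda>z. hardy2_fun (X k) z - g z) n)) {..<M}"
        unfolding L2_set_def coeff by (intro tendsto_intros d)
      have "L2_set (\<lambda>n. cmod (?c k n - ?c m n)) {..<M} \<le> e" if "m \<ge> N" for m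
      proof -
        have "L2_set (\<lambda>n. cmod (?c k n - ?c m n)) {..<M} \<le> norm (X k - X m)"
          using hardy_le_norm[of "X k - X m"] by (simp add: hardy_le_def maclaurin_coeff_hardy2_diff)
        also have "\<dots> \<le> e" using that \<open>\<forall>m\<ge>N. \<forall>k\<ge>N. dist (X m) (X k) < e\<close> \<open>k \<ge> N\<close>
          by (simp add: dist_norm less_imp_le)
        finally show ?thesis .
      qed
      then show "\<exists>K. \<forall>m\<ge>K. L2_set (\<lambda>n. cmod (?c k n - ?c m n)) {..<M} \<le> e" by blast
    qed
  qed
  obtain N1 where N1: "\<forall>m\<ge>N1. \<forall>k\<ge>N1. dist (X m) (X k) < 1" using X by (auto simp: Cauchy_def) (metis zero_less_one)
  \<comment> \<open>\<open>g\<close> is an element of the space minus a function of norm at most 1;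
    this places \<open>g\<close> in the space, so that convergence to it can be stated.\<close>
  have "hardy_le (\<lambda>z. hardy2_fun (X N1) z + (-1) * (hardy2_fun (X N1) z - g z)) (norm (X N1) + cmod (-1) * 1)"
    by (intro hardy_le_add hardy_le_cmult hardy_le_norm diff[OF N1]) auto
  then have gle: "hardy_le g (norm (X N1) + cmod (-1) * 1)" by simp
  have "X \<longlonglongrightarrow> to_hardy2 g"
  proof (rule metric_LIMSEQ_I)
    fix e :: real assume "e > 0"
    then have "e / 2 > 0" by simp
    then obtain N where N: "\<forall>m\<ge>N. \<forall>k\<ge>N. dist (X m) (X k) < e / 2" using X unfolding Cauchy_def by blast
    have "dist (X k) (to_hardy2 g) < e" if "k \<ge> N" for k
    proof -
      have "hardy_le (hardy2_fun (X k - to_hardy2 g)) (e / 2)"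
        by (rule hardy_le_cong[OF diff[OF N that]])
          (simp add: minus_hardy2.rep_eq hardy2_fun_to_hardy2[OF gle])
      then have "norm (X k - to_hardy2 g) \<le> e / 2" by (rule norm_le_hardy_le)
      then show ?thesis using \<open>e > 0\<close> by (simp add: dist_norm)
    qed
    then show "\<exists>N. \<forall>k\<ge>N. dist (X k) (to_hardy2 g) < e" by blast
  qed
  then show "convergent X" by (auto simp: convergent_def)
qed

text \<open>Weighted composition operator: the weight 1 gives \<open>composition_operator\<close>,
  while half-plane translations carry a nontrivial weight.\<close>

definition wcomp :: "(complex \<Rightarrow> complex) \<Rightarrow> (complex \<Rightarrow> complex) \<Rightarrow> hardy2 \<Rightarrow> hardy2"
  where "wcomp u \<phi> f = to_hardy2 (\<lambda>z. u z * hardy2_fun f (\<phi> z))"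

lemma hardy_le_wcomp:
  assumes \<phi>: "disc_selfmap \<phi>" and u: "u holomorphic_on ball 0 1" "\<And>z. z \<in> ball 0 1 \<Longrightarrow> cmod (u z) \<le> s"
  shows "hardy_le (\<lambda>z. u z * hardy2_fun f (\<phi> z)) (s * (2 / sqrt (1 - (cmod (\<phi> 0))\<^sup>2) * norm f))"
  by (intro hardy_le_mult littlewood_subordination hardy_le_norm \<phi> u)

lemma
  assumes \<phi>: "disc_selfmap \<phi>" and u: "u holomorphic_on ball 0 1" "\<And>z. z \<in> ball 0 1 \<Longrightarrow> cmod (u z) \<le> s"
  shows hardy2_fun_wcomp: "z \<in> ball 0 1 \<Longrightarrow> hardy2_fun (wcomp u \<phi> f) z = u z * hardy2_fun f (\<phi> z)"
    and bounded_clinear_wcomp: "bounded_clinear (wcomp u \<phi>)"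
proof -
  have *: "hardy2_fun (wcomp u \<phi> f) z = u z * hardy2_fun f (\<phi> z)" if "z \<in> ball 0 1" for z f
    unfolding wcomp_def using hardy2_fun_to_hardy2[OF hardy_le_wcomp[OF assms]] that by simp
  then show "z \<in> ball 0 1 \<Longrightarrow> hardy2_fun (wcomp u \<phi> f) z = u z * hardy2_fun f (\<phi> z)" .
  have "bounded_linear (wcomp u \<phi>)"
  proof (rule bounded_linear_intro)
    show "norm (wcomp u \<phi> f) \<le> norm f * (s * (2 / sqrt (1 - (cmod (\<phi> 0))\<^sup>2)))" for f
      unfolding wcomp_def using norm_to_hardy2[OF hardy_le_wcomp[OF assms], of f] by (simp add: mult_ac)
  qed (auto intro!: hardy2_eqI simp: * plus_hardy2.rep_eq scaleR_hardy2.rep_eq algebra_simps)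
  then show "bounded_clinear (wcomp u \<phi>)"
    by (auto simp: bounded_clinear_def * scaleC_hardy2.rep_eq intro!: hardy2_eqI)
qed

lemma
  assumes "disc_selfmap \<phi>"
  shows hardy2_fun_composition:
      "z \<in> ball 0 1 \<Longrightarrow> hardy2_fun (composition_operator \<phi> f) z = hardy2_fun f (\<phi> z)"
    and bounded_clinear_composition: "bounded_clinear (composition_operator \<phi>)"
proof -
  have *: "composition_operator \<phi> = wcomp (\<lambda>z. 1) \<phi>"
    by (simp add: fun_eq_iff composition_operator_def wcomp_def to_hardy2_def)
  show "z \<in> ball 0 1 \<Longrightarrow> hardy2_fun (composition_operator \<phi> f) z = hardy2_fun f (\<phi> z)"
    using hardy2_fun_wcomp[OF assms, of "\<lambda>z. 1" 1] by (simp add: *)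
  show "bounded_clinear (composition_operator \<phi>)"
    using bounded_clinear_wcomp[OF assms, of "\<lambda>z. 1" 1] by (simp add: *)
qed

section \<open>Reproducing kernels in the half-plane coordinate\<close>

lemma cmod_less_1_iff:
  assumes "z \<noteq> 1" shows "cmod z < 1 \<longleftrightarrow> Re (2 / (1 - z)) > 1"
proof -
  have pos: "(cmod (1 - z))\<^sup>2 > 0" using assms by simp
  have "Re (2 / (1 - z)) = 2 * (1 - Re z) / (cmod (1 - z))\<^sup>2"
    unfolding cmod_power2 Re_divide by simp
  then have "Re (2 / (1 - z)) > 1 \<longleftrightarrow> (cmod (1 - z))\<^sup>2 < 2 * (1 - Re z)"
    using pos by (simp add: less_divide_eq)
  also have "\<dots> \<longleftrightarrow> (cmod z)\<^sup>2 < 1\<^sup>2"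
    unfolding cmod_power2 by (simp add: power2_eq_square algebra_simps) 
  also have "\<dots> \<longleftrightarrow> cmod z < 1"
    by (simp add: abs_square_less_1)
  finally show ?thesis by simp
qed

text \<open>In the coordinate \<open>2 / (1 - z)\<close>, which maps the disc to the half-plane \<open>Re > 1\<close>, the
  selfmap \<open>hp_shift u\<close> is the translation by \<open>u\<close>.\<close>

definition hp_shift :: "(complex \<Rightarrow> complex) \<Rightarrow> complex \<Rightarrow> complex"
  where "hp_shift u z = 1 - (1 - z) / (1 + u z * (1 - z) / 2)"

text \<open>With V = 2 / (1 - z) the denominator is (V + b) / V, and both V and V + b have real part
  above 1.\<close>

lemma hp_denominator:
  assumes "cmod z < 1" "0 \<le> Re b"
  shows "1 + b * (1 - z) / 2 \<noteq> 0" "cmod (1 / (1 + b * (1 - z) / 2)) \<le> 1 + cmod b"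
proof -
  have z: "z \<noteq> 1" using assms by auto
  let ?V = "2 / (1 - z)"
  have V: "Re ?V > 1" using cmod_less_1_iff[OF z] assms by simp
  have pos: "Re (?V + b) > 1" using V assms by simp
  then have ge: "cmod (?V + b) > 1" using complex_Re_le_cmod[of "?V + b"] by linarith
  have eq: "1 + b * (1 - z) / 2 = (?V + b) / ?V" using z by (simp add: field_simps)
  have V0: "?V \<noteq> 0" using z by simp
  have nz: "?V + b \<noteq> 0" using ge by auto
  show "1 + b * (1 - z) / 2 \<noteq> 0" unfolding eq using V0 nz by simp
  have "cmod (1 / (1 + b * (1 - z) / 2)) = cmod ?V / cmod (?V + b)"
    unfolding eq by (simp add: norm_divide norm_mult mult.commute)
  also have "\<dots> \<le> (cmod (?V + b) + cmod b) / cmod (?V + b)"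
    using norm_triangle_ineq4[of "?V + b" b] by (intro divide_right_mono) auto
  also have "\<dots> = 1 + cmod b / cmod (?V + b)" using nz by (simp add: add_divide_distrib)
  also have "\<dots> \<le> 1 + cmod b"
    using ge by (auto simp: divide_le_eq mult_le_cancel_left1)
  finally show "cmod (1 / (1 + b * (1 - z) / 2)) \<le> 1 + cmod b" .
qed

lemma
  assumes z: "cmod z < 1" and u: "0 \<le> Re (u z)"
  shows hp_shift_coord: "2 / (1 - hp_shift u z) = 2 / (1 - z) + u z"
    and hp_shift_in_disc: "cmod (hp_shift u z) < 1"
    and hp_shift_neq_1: "hp_shift u z \<noteq> 1"
proof -
  have z1: "z \<noteq> 1" using z by auto
  note nz = hp_denominator[OF z u]
  show c: "2 / (1 - hp_shift u z) = 2 / (1 - z) + u z"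
    using nz(1) z1 by (simp add: hp_shift_def field_simps)
  show n: "hp_shift u z \<noteq> 1" using nz(1) z1 by (simp add: hp_shift_def)
  show "cmod (hp_shift u z) < 1"
    unfolding cmod_less_1_iff[OF n] c using cmod_less_1_iff[OF z1] z u by simp
qed

lemma disc_selfmap_hp_shift:
  assumes u: "u holomorphic_on ball 0 1" "\<And>z. z \<in> ball 0 1 \<Longrightarrow> 0 \<le> Re (u z)"
  shows "disc_selfmap (hp_shift u)"
  unfolding disc_selfmap_def
proof
  show "hp_shift u holomorphic_on ball 0 1"
    unfolding hp_shift_def using hp_denominator(1) u(2) by (intro holomorphic_intros u) auto
  show "hp_shift u ` ball 0 1 \<subseteq> ball 0 1" using hp_shift_in_disc u(2) by auto
qed

section \<open>Gram matrices of kernels and the Laplace transform\<close>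

lemma hardy2_fun_sum: "hardy2_fun (\<Sum>i\<in>I. f i) z = (\<Sum>i\<in>I. hardy2_fun (f i) z)"
  by (induction I rule: infinite_finite_induct) (auto simp: zero_hardy2.rep_eq plus_hardy2.rep_eq)

text \<open>Up to the factor 1 / (P + 1) this is the reproducing kernel at the conjugate of (P - 1)
  / (P + 1). In V = 2 / (1 - z) it equals V / (2 (V + P - 1)), so after division by V a translation
  of V just moves the parameter \<open>P\<close>.\<close>

definition hker :: "complex \<Rightarrow> hardy2"
  where "hker P = to_hardy2 (\<lambda>z. 1 / (2 + (P - 1) * (1 - z)))"

lemma cayley_less_1:
  assumes "Re P > 0"
  shows "P + 1 \<noteq> 0" "cmod ((P - 1) / (P + 1)) < 1"
proof -
  show nz: "P + 1 \<noteq> 0" using assms by (auto simp: complex_eq_iff)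
  have "(cmod (P - 1))\<^sup>2 < (cmod (P + 1))\<^sup>2"
    unfolding cmod_power2 using assms by (simp add: power2_eq_square algebra_simps)
  then have "cmod (P - 1) < cmod (P + 1)" by (rule power_less_imp_less_base) auto
  then show "cmod ((P - 1) / (P + 1)) < 1" using nz by (simp add: norm_divide)
qed

lemma
  assumes P: "Re P > 0"
  shows hker_sums: "z \<in> ball 0 1 \<Longrightarrow> (\<lambda>n. 1 / (P + 1) * ((P - 1) / (P + 1)) ^ n * z ^ n) sums hardy2_fun (hker P) z"
    and hardy2_fun_hker: "z \<in> ball 0 1 \<Longrightarrow> hardy2_fun (hker P) z = 1 / (2 + (P - 1) * (1 - z))"
proof -
  let ?v = "(P - 1) / (P + 1)"
  note P1 = cayley_less_1[OF P]
  have w: "cmod (cnj ?v) < 1" using P1(2) by (simp only: complex_mod_cnj)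
  have e: "1 / (P + 1) / (1 - ?v * z) = 1 / (2 + (P - 1) * (1 - z))" for z
  proof -
    have "(P + 1) * (1 - ?v * z) = 2 + (P - 1) * (1 - z)" using P1(1) by (simp add: field_simps)
    then show ?thesis by (metis divide_divide_eq_left)
  qed
  have "hardy_le (\<lambda>z. 1 / (P + 1) / (1 - cnj (cnj ?v) * z) + 0) (sqrt ((cmod (1 / (P + 1)))\<^sup>2 / (1 - (cmod (cnj ?v))\<^sup>2) + 0\<^sup>2))"
    by (rule hardy_le_kernel_add[OF _ _ w]) (use hardy_le_bounded[of "\<lambda>z. 0" 0] in auto)
  then have *: "hardy_le (\<lambda>z. 1 / (2 + (P - 1) * (1 - z))) (sqrt ((cmod (1 / (P + 1)))\<^sup>2 / (1 - (cmod (cnj ?v))\<^sup>2) + 0\<^sup>2))"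
    by (simp only: add_0_right complex_cnj_cnj e)
  show f: "z \<in> ball 0 1 \<Longrightarrow> hardy2_fun (hker P) z = 1 / (2 + (P - 1) * (1 - z))" for z
    unfolding hker_def by (rule hardy2_fun_to_hardy2[OF *])
  assume z: "z \<in> ball 0 1"
  have "cmod (?v * z) < 1" using norm_mult_less[OF P1(2), of z 1] z by simp
  from sums_mult[OF geometric_sums[OF this], of "1 / (P + 1)"]
  show "(\<lambda>n. 1 / (P + 1) * ?v ^ n * z ^ n) sums hardy2_fun (hker P) z"
    by (simp add: f[OF z] flip: e) (simp add: power_mult_distrib power_divide mult_ac)
qed

text \<open>Evaluates the geometric series arising from two kernels. The variables are independent
  because \<open>q\<close> will be the conjugate of a second parameter.\<close>

lemma cayley_gram:
  fixes p q :: complex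
  assumes "p + 1 \<noteq> 0" "q + 1 \<noteq> 0"
  shows "(p + 1) * (q + 1) * (1 - (p - 1) / (p + 1) * ((q - 1) / (q + 1))) = 2 * (p + q)"
proof -
  define x y where "x = (p - 1) / (p + 1)" and "y = (q - 1) / (q + 1)"
  have "(p + 1) * (q + 1) * (1 - x * y) = (p + 1) * (q + 1) - ((p + 1) * x) * ((q + 1) * y)"
    by (simp add: algebra_simps)
  also have "\<dots> = (p + 1) * (q + 1) - (p - 1) * (q - 1)" using assms by (simp add: x_def y_def)
  also have "\<dots> = 2 * (p + q)" by (simp add: algebra_simps)
  finally show ?thesis by (simp add: x_def y_def)
qed

text \<open>Expanding the squared moduli of the coefficients gives geometric series in
  \<open>n\<close>; what remains is half the Gram matrix of the functions exp (- P s) on the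
  half-line.\<close>

lemma norm_sum_hker:
  assumes I: "finite I" and P: "\<And>i. i \<in> I \<Longrightarrow> Re (P i) > 0"
  shows "complex_of_real ((norm (\<Sum>i\<in>I. d i *\<^sub>C hker (P i)))\<^sup>2)
    = (\<Sum>i\<in>I. \<Sum>j\<in>I. d i * cnj (d j) / (2 * (P i + cnj (P j))))"
proof -
  let ?v = "\<lambda>i. (P i - 1) / (P i + 1)"
  let ?f = "\<Sum>i\<in>I. d i *\<^sub>C hker (P i)"
  let ?c = "\<lambda>n. \<Sum>i\<in>I. d i * (1 / (P i + 1) * ?v i ^ n)"
  have s: "(\<lambda>n. ?c n * z ^ n) sums hardy2_fun ?f z" if "z \<in> ball 0 1" for z
  proof -
    have "(\<lambda>n. \<Sum>i\<in>I. d i * (1 / (P i + 1) * ?v i ^ n * z ^ n)) sums (\<Sum>i\<in>I. d i * hardy2_fun (hker (P i)) z)"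
      by (intro sums_sum sums_mult hker_sums P that)
    then show ?thesis
      by (simp add: hardy2_fun_sum scaleC_hardy2.rep_eq sum_distrib_right mult.assoc)
  qed
  have c: "maclaurin_coeff (hardy2_fun ?f) n = ?c n" for n
    by (rule power_series_on_disc(2)[OF s])
  have "(\<lambda>n. (cmod (?c n))\<^sup>2) sums (norm ?f)\<^sup>2"
    using hardy2_summable[of ?f] unfolding norm_hardy2_eq c
    by (simp add: summable_sums suminf_nonneg)
  then have "(\<lambda>n. complex_of_real ((cmod (?c n))\<^sup>2)) sums complex_of_real ((norm ?f)\<^sup>2)"
    by (rule sums_of_real)
  moreover have "complex_of_real ((cmod (?c n))\<^sup>2)
      = (\<Sum>i\<in>I. \<Sum>j\<in>I. d i * cnj (d j) * (1 / ((P i + 1) * (cnj (P j) + 1)) * (?v i * cnj (?v j)) ^ n))" for n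
    unfolding complex_norm_square cnj_sum sum_product
    by (intro sum.cong refl) (simp add: power_mult_distrib power_divide mult_ac)
  moreover have "(\<lambda>n. \<Sum>i\<in>I. \<Sum>j\<in>I. d i * cnj (d j) * (1 / ((P i + 1) * (cnj (P j) + 1)) * (?v i * cnj (?v j)) ^ n))
    sums (\<Sum>i\<in>I. \<Sum>j\<in>I. d i * cnj (d j) / (2 * (P i + cnj (P j))))"
  proof (intro sums_sum)
    fix i j assume ij: "i \<in> I" "j \<in> I"
    note Pi = cayley_less_1[OF P[OF ij(1)]] and Pj = cayley_less_1[OF P[OF ij(2)]]
    have nzj: "cnj (P j) + 1 \<noteq> 0" using Pj(1) by (metis complex_cnj_add complex_cnj_one complex_cnj_zero_iff)
    have nz: "P i + cnj (P j) \<noteq> 0" using P ij by (auto simp: complex_eq_iff) (metis add_pos_pos less_irrefl)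
    have "cmod (?v i * cnj (?v j)) < 1"
      using norm_mult_less[OF Pi(2), of "cnj (?v j)" 1] Pj(2) by (simp only: complex_mod_cnj mult_1)
    from geometric_sums[OF this]
    have "(\<lambda>n. d i * cnj (d j) * (1 / ((P i + 1) * (cnj (P j) + 1)) * (?v i * cnj (?v j)) ^ n)) sums
      (d i * cnj (d j) * (1 / ((P i + 1) * (cnj (P j) + 1)) * (1 / (1 - ?v i * cnj (?v j)))))"
      by (intro sums_mult)
    also have "1 / ((P i + 1) * (cnj (P j) + 1)) * (1 / (1 - ?v i * cnj (?v j))) = 1 / (2 * (P i + cnj (P j)))"
    proof -
      have Pj_eq: "(cnj (P j) - 1) / (cnj (P j) + 1) = cnj (?v j)" by simp
      have "(P i + 1) * (cnj (P j) + 1) * (1 - ?v i * cnj (?v j)) = 2 * (P i + cnj (P j))"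
        by (rule cayley_gram[OF Pi(1) nzj, unfolded Pj_eq])
      then show ?thesis by (metis divide_divide_eq_left mult_1 times_divide_eq_left times_divide_eq_right)
    qed
    finally show "(\<lambda>n. d i * cnj (d j) * (1 / ((P i + 1) * (cnj (P j) + 1)) * (?v i * cnj (?v j)) ^ n)) sums
      (d i * cnj (d j) / (2 * (P i + cnj (P j))))" by simp
  qed
  ultimately show ?thesis by (simp add: sums_unique2)
qed

lemma has_integral_complex_exp:
  fixes c :: complex
  assumes "c \<noteq> 0" "0 \<le> T"
  shows "((\<lambda>s. exp (- c * of_real s)) has_integral (1 / c - exp (- c * of_real T) / c)) {0..T}"
proof -
  have "((\<lambda>s. exp (- c * of_real s)) has_integral
    (- exp (- c * of_real T) / c) - (- exp (- c * of_real 0) / c)) {0..T}"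
  proof (rule fundamental_theorem_of_calculus)
    fix x :: real
    have "((\<lambda>s. - exp (- c * s) / c) has_field_derivative exp (- c * of_real x)) (at (of_real x))"
      using assms by (auto intro!: derivative_eq_intros)
    from has_vector_derivative_real_field[OF this]
    show "((\<lambda>s. - exp (- c * of_real s) / c) has_vector_derivative exp (- c * of_real x)) (at x within {0..T})"
      by (rule has_vector_derivative_at_within)
  qed fact
  then show ?thesis by simp
qed

text \<open>The Laplace transform identifies \<open>hker P\<close> with the exponential \<open>exp (- P s)\<close> in \<open>L\<^sup>2\<close> of the half-line.\<close>

lemma norm_sum_hker_integral:
  fixes P d :: "'i \<Rightarrow> complex"
  assumes I: "finite I" and P: "\<And>i. i \<in> I \<Longrightarrow> Re (P i) > 0"
  obtains R where "R \<longlonglongrightarrow> 2 * (norm (\<Sum>i\<in>I. d i *\<^sub>C hker (P i)))\<^sup>2"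
    "\<And>n. ((\<lambda>s. (cmod (\<Sum>i\<in>I. d i * exp (- P i * of_real s)))\<^sup>2) has_integral R n) {0..real n}"
proof -
  let ?p = "\<lambda>i j. P i + cnj (P j)"
  \<comment> \<open>Integrals over {0..n} with a limit in \<open>n\<close> keep every integral
    proper.\<close>
  define R where "R n = (\<Sum>i\<in>I. \<Sum>j\<in>I. d i * cnj (d j) * (1 / ?p i j - exp (- ?p i j * of_real (real n)) / ?p i j))" for n :: nat
  have nz: "?p i j \<noteq> 0" if "i \<in> I" "j \<in> I" for i j
    using P[OF that(1)] P[OF that(2)] by (auto simp: complex_eq_iff)
  have int: "((\<lambda>s. complex_of_real ((cmod (\<Sum>i\<in>I. d i * exp (- P i * of_real s)))\<^sup>2)) has_integral R n) {0..real n}" for n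
  proof -
    have e: "complex_of_real ((cmod (\<Sum>i\<in>I. d i * exp (- P i * of_real s)))\<^sup>2)
      = (\<Sum>i\<in>I. \<Sum>j\<in>I. d i * cnj (d j) * exp (- ?p i j * of_real s))" for s
      unfolding complex_norm_square cnj_sum sum_product
      by (intro sum.cong refl) (simp add: exp_cnj mult_exp_exp algebra_simps)
    show ?thesis unfolding e R_def
    proof (intro has_integral_sum I has_integral_mult_right)
      fix i j assume ij: "i \<in> I" "j \<in> I"
      show "((\<lambda>s. exp (- ?p i j * of_real s)) has_integral (1 / ?p i j - exp (- ?p i j * of_real (real n)) / ?p i j)) {0..real n}"
        by (rule has_integral_complex_exp) (use nz[OF ij] in auto)
    qed
  qed
  have "((\<lambda>s. (cmod (\<Sum>i\<in>I. d i * exp (- P i * of_real s)))\<^sup>2) has_integral Re (R n)) {0..real n}" for n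
    using has_integral_linear[OF int[of n] bounded_linear_Re] by (simp add: o_def)
  moreover have "R \<longlonglongrightarrow> (\<Sum>i\<in>I. \<Sum>j\<in>I. d i * cnj (d j) * (1 / ?p i j - 0 / ?p i j))"
    unfolding R_def
  proof (intro tendsto_intros nz)
    fix i j assume ij: "i \<in> I" "j \<in> I"
    have "(\<lambda>n. exp (- Re (?p i j)) ^ n) \<longlonglongrightarrow> 0"
      using P[OF ij(1)] P[OF ij(2)] by (intro LIMSEQ_power_zero) simp
    then have "(\<lambda>n. cmod (exp (- ?p i j * of_real (real n)))) \<longlonglongrightarrow> 0"
      by (simp add: exp_of_nat_mult[symmetric] algebra_simps)
    then show "(\<lambda>n. exp (- ?p i j * of_real (real n))) \<longlonglongrightarrow> 0"
      by (rule tendsto_norm_zero_cancel)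
  qed
  then have "(\<lambda>n. Re (R n)) \<longlonglongrightarrow> Re (\<Sum>i\<in>I. \<Sum>j\<in>I. d i * cnj (d j) * (1 / ?p i j - 0 / ?p i j))"
    by (rule tendsto_Re)
  moreover have "(\<Sum>i\<in>I. \<Sum>j\<in>I. d i * cnj (d j) * (1 / ?p i j - 0 / ?p i j)) = 2 * complex_of_real ((norm (\<Sum>i\<in>I. d i *\<^sub>C hker (P i)))\<^sup>2)"
    by (subst norm_sum_hker[OF I P]) (auto simp: sum_distrib_left simp del: distrib_left_numeral)
  then have "Re (\<Sum>i\<in>I. \<Sum>j\<in>I. d i * cnj (d j) * (1 / ?p i j - 0 / ?p i j)) = 2 * (norm (\<Sum>i\<in>I. d i *\<^sub>C hker (P i)))\<^sup>2"
    by (simp del: of_real_power)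
  ultimately show ?thesis using that[of "\<lambda>n. Re (R n)"] by simp
qed

text \<open>Plancherel as an inequality: domination of exponential sums at every point of the
  half-line becomes domination of Hardy norms. The index sets may differ because subtracting a
  scalar from a translation doubles the number of kernels.\<close>

lemma norm_hker_comparison:
  fixes P d :: "'i \<Rightarrow> complex" and P' d' :: "'j \<Rightarrow> complex"
  assumes I: "finite I" "\<And>i. i \<in> I \<Longrightarrow> Re (P i) > 0"
    and J: "finite J" "\<And>i. i \<in> J \<Longrightarrow> Re (P' i) > 0"
    and M: "0 \<le> M"
    and le: "\<And>s. s \<ge> 0 \<Longrightarrow> cmod (\<Sum>i\<in>J. d' i * exp (- P' i * of_real s)) \<le> M * cmod (\<Sum>i\<in>I. d i * exp (- P i * of_real s))"
  shows "norm (\<Sum>i\<in>J. d' i *\<^sub>C hker (P' i)) \<le> M * norm (\<Sum>i\<in>I. d i *\<^sub>C hker (P i))"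
proof -
  obtain R where R: "R \<longlonglongrightarrow> 2 * (norm (\<Sum>i\<in>I. d i *\<^sub>C hker (P i)))\<^sup>2"
    "\<And>n. ((\<lambda>s. (cmod (\<Sum>i\<in>I. d i * exp (- P i * of_real s)))\<^sup>2) has_integral R n) {0..real n}"
    using norm_sum_hker_integral[where P = P and d = d, OF I] by blast
  obtain R' where R': "R' \<longlonglongrightarrow> 2 * (norm (\<Sum>i\<in>J. d' i *\<^sub>C hker (P' i)))\<^sup>2"
    "\<And>n. ((\<lambda>s. (cmod (\<Sum>i\<in>J. d' i * exp (- P' i * of_real s)))\<^sup>2) has_integral R' n) {0..real n}"
    using norm_sum_hker_integral[where P = P' and d = d', OF J] by blast
  have "R' n \<le> M\<^sup>2 * R n" for n
  proof (rule has_integral_le[OF R'(2) has_integral_mult_right[OF R(2)]])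
    fix s assume "s \<in> {0..real n}"
    then show "(cmod (\<Sum>i\<in>J. d' i * exp (- P' i * of_real s)))\<^sup>2 \<le> M\<^sup>2 * (cmod (\<Sum>i\<in>I. d i * exp (- P i * of_real s)))\<^sup>2"
      unfolding power_mult_distrib[symmetric] by (intro power_mono le) auto
  qed
  then have "2 * (norm (\<Sum>i\<in>J. d' i *\<^sub>C hker (P' i)))\<^sup>2 \<le> M\<^sup>2 * (2 * (norm (\<Sum>i\<in>I. d i *\<^sub>C hker (P i)))\<^sup>2)"
    by (intro LIMSEQ_le[OF R'(1) tendsto_mult_left[OF R(1)]]) auto
  then have "(norm (\<Sum>i\<in>J. d' i *\<^sub>C hker (P' i)))\<^sup>2 \<le> (M * norm (\<Sum>i\<in>I. d i *\<^sub>C hker (P i)))\<^sup>2"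
    by (simp add: power_mult_distrib)
  then show ?thesis by (rule power2_le_imp_le) (use M in simp)
qed

section \<open>Density of the kernels\<close>

lemma bounded_linear_scaleC: "bounded_linear (\<lambda>x::'a::complex_normed_vector. c *\<^sub>C x)"
proof (rule bounded_linear_intro)
  fix r :: real and x :: 'a
  show "c *\<^sub>C r *\<^sub>R x = r *\<^sub>R c *\<^sub>C x"
    unfolding scaleC_of_real[symmetric] scaleC_scaleC by (simp add: mult.commute)
  show "norm (c *\<^sub>C x) \<le> norm x * cmod c" by (simp add: norm_scaleC)
qed (rule scaleC_add_right)

lemmas tendsto_scaleC = bounded_linear.tendsto[OF bounded_linear_scaleC]

lemma
  fixes S :: "'a::complex_normed_vector set"
  assumes "x \<in> closure (cvec.span S)" 
  shows closure_span_add: "y \<in> closure (cvec.span S) \<Longrightarrow> x + y \<in> closure (cvec.span S)"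
    and closure_span_scale: "c *\<^sub>C x \<in> closure (cvec.span S)"
proof -
  obtain X where X: "\<And>n. X n \<in> cvec.span S" "X \<longlonglongrightarrow> x"
    using assms unfolding closure_sequential by blast
  show "c *\<^sub>C x \<in> closure (cvec.span S)"
    unfolding closure_sequential
    using X tendsto_scaleC[OF X(2), of c] cvec.span_scale by (intro exI[of _ "\<lambda>n. c *\<^sub>C X n"]) auto
  assume "y \<in> closure (cvec.span S)"
  then obtain Y where Y: "\<And>n. Y n \<in> cvec.span S" "Y \<longlonglongrightarrow> y"
    unfolding closure_sequential by blast
  show "x + y \<in> closure (cvec.span S)"
    unfolding closure_sequential
    using cvec.span_add[OF X(1) Y(1)] tendsto_add[OF X(2) Y(2)] by (intro exI[of _ "\<lambda>n. X n + Y n"]) auto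
qed

lemma closure_span_sum:
  fixes S :: "'a::complex_normed_vector set"
  assumes "\<And>i. i \<in> I \<Longrightarrow> f i \<in> closure (cvec.span S)"
  shows "sum f I \<in> closure (cvec.span S)"
  using assms
proof (induction I rule: infinite_finite_induct)
  case (insert x F)
  then show ?case by (auto intro: closure_span_add)
qed (use closure_subset cvec.span_zero in auto)

definition monomial :: "nat \<Rightarrow> hardy2" where "monomial n = to_hardy2 (\<lambda>z. z ^ n)"

lemma hardy2_fun_monomial: "z \<in> ball 0 1 \<Longrightarrow> hardy2_fun (monomial n) z = z ^ n"
  unfolding monomial_def 
  by (rule hardy2_fun_to_hardy2[OF hardy_le_bounded[of _ 1]])
    (auto intro!: holomorphic_intros simp: norm_power power_le_one)

text \<open>Kernels at small real points w generate the monomials one degree at a time: removing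
  from 1 / (1 - w z) its terms below z^n and dividing by w^n leaves z^n / (1 - w z), which tends to
  z^n in norm as w tends to 0.\<close>

lemma hker_dense: "closure (cvec.span (hker ` {P. Re P > 0})) = UNIV"
proof -
  let ?L = "closure (cvec.span (hker ` {P. Re P > 0}))"
  have ker: "hker P \<in> ?L" if "Re P > 0" for P
    by (rule subsetD[OF closure_subset], rule cvec.span_base) (use that in simp)
  have mono: "monomial n \<in> ?L" for n
  proof (induction n rule: less_induct)
    case (less n)
    define w where "w k = 1 / (2 + real k)" for k
    have w: "0 < w k" "w k \<le> 1 / 2" for k by (auto simp: w_def field_simps)
    \<comment> \<open>The parameter whose Cayley transform (P - 1) / (P + 1) is
      \<open>w k\<close>.\<close>
    define P where "P k = complex_of_real ((1 + w k) / (1 - w k))" for k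
    have P: "Re (P k) > 0" for k using w[of k] by (simp add: P_def)
    define X where "X k = (1 / of_real (w k)) ^ n *\<^sub>C ((P k + 1) *\<^sub>C hker (P k) + (\<Sum>l<n. (- (of_real (w k) ^ l)) *\<^sub>C monomial l))" for k
    have X: "X k \<in> ?L" for k
      unfolding X_def by (intro closure_span_scale closure_span_add ker P closure_span_sum less.IH) auto
    have "norm (X k - monomial n) \<le> 2 * w k" for k
    proof (rule norm_le_hardy_le, rule hardy_le_cong[OF hardy_le_bounded])
      let ?w = "complex_of_real (w k)"
      have nz: "1 - ?w * z \<noteq> 0" and bd: "cmod (1 - ?w * z) \<ge> 1 / 2" if "z \<in> ball 0 1" for z
      proof -
        have "cmod (?w * z) \<le> 1 / 2" 
          using that w[of k] mult_mono[of "w k" "1/2" "cmod z" 1] by (simp add: norm_mult)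
        then show "cmod (1 - ?w * z) \<ge> 1 / 2" using norm_triangle_ineq2[of 1 "?w * z"] by simp
        then show "1 - ?w * z \<noteq> 0" by auto
      qed
      show "(\<lambda>z. ?w * z ^ Suc n / (1 - ?w * z)) holomorphic_on ball 0 1"
        using nz by (intro holomorphic_intros) auto
      show "cmod (?w * z ^ Suc n / (1 - ?w * z)) \<le> 2 * w k" if "z \<in> ball 0 1" for z
      proof -
        have "cmod (?w * z ^ Suc n / (1 - ?w * z)) = w k * cmod z ^ Suc n / cmod (1 - ?w * z)"
          using w[of k] by (simp add: norm_divide norm_mult norm_power)
        also have "\<dots> \<le> w k * 1 / (1 / 2)"
          using w[of k] that bd[OF that] by (intro frac_le mult_left_mono power_le_one) auto
        finally show ?thesis by simp
      qed
      fix z :: complex assume z: "z \<in> ball 0 1"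
      have w1: "?w \<noteq> 1" "?w \<noteq> 0" using w[of k] by auto
      have K: "(P k + 1) * (1 / (2 + (P k - 1) * (1 - z))) = 1 / (1 - ?w * z)"
      proof -
        have PW: "P k * (1 - ?w) = 1 + ?w" using w1 by (simp add: P_def)
        have "(P k + 1) * (1 - ?w) = P k * (1 - ?w) + (1 - ?w)" by (simp add: algebra_simps)
        then have 1: "(P k + 1) * (1 - ?w) = 2" unfolding PW by simp
        have "(2 + (P k - 1) * (1 - z)) * (1 - ?w) = 2 * (1 - ?w) + (P k * (1 - ?w) - (1 - ?w)) * (1 - z)"
          by (simp add: algebra_simps)
        then have 2: "(2 + (P k - 1) * (1 - z)) * (1 - ?w) = 2 * (1 - ?w * z)"
          unfolding PW by (simp add: algebra_simps)
        have "(P k + 1) * (1 / (2 + (P k - 1) * (1 - z))) = ((P k + 1) * (1 - ?w)) / ((2 + (P k - 1) * (1 - z)) * (1 - ?w))"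
          using w1 by simp
        also have "\<dots> = (2 * 1) / (2 * (1 - ?w * z))" unfolding 1 2 by (simp only: mult_1_right)
        also have "\<dots> = 1 / (1 - ?w * z)" by (rule mult_divide_mult_cancel_left) simp
        finally show ?thesis .
      qed
      have "hardy2_fun (X k) z = (1 / ?w) ^ n * ((P k + 1) * hardy2_fun (hker (P k)) z
          + (\<Sum>l<n. - (?w ^ l) * hardy2_fun (monomial l) z))"
        by (simp only: X_def hardy2_fun_sum plus_hardy2.rep_eq scaleC_hardy2.rep_eq)
      then have h: "hardy2_fun (X k) z = (1 / ?w) ^ n * (1 / (1 - ?w * z) - (\<Sum>l<n. ?w ^ l * z ^ l))"
        unfolding hardy2_fun_hker[OF P z] hardy2_fun_monomial[OF z] K by (simp add: sum_negf)
      have g: "(\<Sum>l<n. ?w ^ l * z ^ l) = (1 - (?w * z) ^ n) / (1 - ?w * z)"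
        using sum_gp_strict[of "?w * z" n] nz[OF z] by (simp add: power_mult_distrib)
      have "1 / (1 - ?w * z) - (\<Sum>l<n. ?w ^ l * z ^ l) = ?w ^ n * (z ^ n / (1 - ?w * z))"
        unfolding g by (simp add: diff_divide_distrib power_mult_distrib)
      then have "hardy2_fun (X k) z = z ^ n / (1 - ?w * z)"
        using w1 by (simp add: h power_divide)
      then have "hardy2_fun (X k - monomial n) z = z ^ n / (1 - ?w * z) - z ^ n * (1 - ?w * z) / (1 - ?w * z)"
        by (simp only: minus_hardy2.rep_eq hardy2_fun_monomial[OF z] nonzero_mult_div_cancel_right[OF nz[OF z]])
      also have "\<dots> = (z ^ n - z ^ n * (1 - ?w * z)) / (1 - ?w * z)" by (simp only: diff_divide_distrib)
      also have "z ^ n - z ^ n * (1 - ?w * z) = ?w * z ^ Suc n" by (simp add: algebra_simps)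
      finally show "?w * z ^ Suc n / (1 - ?w * z) = hardy2_fun (X k - monomial n) z" ..
    qed
    moreover have "(\<lambda>k. 2 * w k) \<longlonglongrightarrow> 0"
      using LIMSEQ_ignore_initial_segment[OF lim_1_over_n[where 'a = real], of 2]
      by (intro tendsto_mult_right_zero) (simp add: w_def add.commute)
    ultimately have "(\<lambda>k. X k - monomial n) \<longlonglongrightarrow> 0"
      by (intro Lim_null_comparison[where f = "\<lambda>k. X k - monomial n" and g = "\<lambda>k. 2 * w k"]) auto
    then have "X \<longlonglongrightarrow> monomial n" by (rule LIM_zero_cancel)
    then show ?case by (rule closed_sequentially[OF closed_closure X])
  qed
  have "f \<in> ?L" for f
  proof -
    let ?c = "maclaurin_coeff (hardy2_fun f)"
    define X where "X N = (\<Sum>n<N. ?c n *\<^sub>C monomial n)" for N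
    have X: "X N \<in> ?L" for N unfolding X_def by (intro closure_span_sum closure_span_scale mono)
    define t where "t N = (\<Sum>n. (cmod (?c (n + N)))\<^sup>2)" for N
    have t: "t \<longlonglongrightarrow> 0" unfolding t_def by (rule suminf_exist_split2[OF hardy2_summable])
    have "norm (f - X N) \<le> sqrt (t N)" for N
    proof -
      have X1: "(\<lambda>n. (if n < N then 0 else ?c n) * z ^ n) sums hardy2_fun (f - X N) z" if "z \<in> ball 0 1" for z
      proof -
        have "(\<lambda>n. if n \<in> {..<N} then ?c n * z ^ n else 0) sums (\<Sum>n<N. ?c n * z ^ n)"
          by (rule sums_If_finite_set) simp
        from sums_diff[OF maclaurin_sums[OF hardy2_holomorphic that] this]
        have "(\<lambda>n. ?c n * z ^ n - (if n \<in> {..<N} then ?c n * z ^ n else 0)) sums hardy2_fun (f - X N) z"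
          using that by (simp add: minus_hardy2.rep_eq X_def hardy2_fun_sum scaleC_hardy2.rep_eq hardy2_fun_monomial)
        then show ?thesis by (rule sums_cong[THEN iffD1, rotated]) auto
      qed
      have c: "maclaurin_coeff (hardy2_fun (f - X N)) n = (if n < N then 0 else ?c n)" for n
        by (rule power_series_on_disc(2)[OF X1])
      have "(\<Sum>n. (cmod (maclaurin_coeff (hardy2_fun (f - X N)) n))\<^sup>2) = t N"
        using suminf_split_initial_segment[OF hardy2_summable[of "f - X N"], of N] 
        by (simp add: c t_def)
      then show ?thesis by (simp add: norm_hardy2_eq)
    qed
    moreover have "(\<lambda>N. sqrt (t N)) \<longlonglongrightarrow> sqrt 0" by (intro tendsto_intros t)
    ultimately have "(\<lambda>N. f - X N) \<longlonglongrightarrow> 0"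
      by (intro Lim_null_comparison[where f = "\<lambda>N. f - X N" and g = "\<lambda>N. sqrt (t N)"]) auto
    then have "(\<lambda>N. f - (f - X N)) \<longlonglongrightarrow> f - 0" by (intro tendsto_diff tendsto_const)
    then have "X \<longlonglongrightarrow> f" by simp
    then show ?thesis by (rule closed_sequentially[OF closed_closure X])
  qed
  then show ?thesis by blast
qed

text \<open>The weight equals V / (V + b), so on the quotients F = f / V the operator takes F(V) to
  F(V + b).\<close>

definition hp_translation :: "complex \<Rightarrow> hardy2 \<Rightarrow> hardy2"
  where "hp_translation b = wcomp (\<lambda>z. 1 / (1 + b * (1 - z) / 2)) (hp_shift (\<lambda>_. b))"

lemma
  assumes b: "0 \<le> Re b"
  shows bounded_clinear_hp_translation: "bounded_clinear (hp_translation b)"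
    and hardy2_fun_hp_translation: "z \<in> ball 0 1 \<Longrightarrow> hardy2_fun (hp_translation b f) z
      = 1 / (1 + b * (1 - z) / 2) * hardy2_fun f (hp_shift (\<lambda>_. b) z)"
proof -
  have 1: "disc_selfmap (hp_shift (\<lambda>_. b))" using b by (intro disc_selfmap_hp_shift) auto
  have 2: "(\<lambda>z. 1 / (1 + b * (1 - z) / 2)) holomorphic_on ball 0 1"
    using hp_denominator(1) b by (intro holomorphic_intros) auto
  have 3: "cmod (1 / (1 + b * (1 - z) / 2)) \<le> 1 + cmod b" if "z \<in> ball 0 1" for z
    using hp_denominator(2) b that by auto
  show "bounded_clinear (hp_translation b)"
    unfolding hp_translation_def by (rule bounded_clinear_wcomp[OF 1 2 3])
  show "z \<in> ball 0 1 \<Longrightarrow> hardy2_fun (hp_translation b f) z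
      = 1 / (1 + b * (1 - z) / 2) * hardy2_fun f (hp_shift (\<lambda>_. b) z)"
    unfolding hp_translation_def by (rule hardy2_fun_wcomp[OF 1 2 3])
qed

lemma hp_translation_hker:
  assumes b: "0 \<le> Re b" and P: "0 < Re P"
  shows "hp_translation b (hker P) = hker (P + b)"
proof (rule hardy2_eqI)
  fix z :: complex assume z: "z \<in> ball 0 1"
  let ?D = "1 + b * (1 - z) / 2"
  have D: "?D \<noteq> 0" using hp_denominator(1) z b by auto
  have s: "hp_shift (\<lambda>_. b) z \<in> ball 0 1" using hp_shift_in_disc[of z "\<lambda>_. b"] z b by auto
  have "hardy2_fun (hp_translation b (hker P)) z = 1 / ?D * (1 / (2 + (P - 1) * ((1 - z) / ?D)))"
    using s by (simp add: hardy2_fun_hp_translation[OF b z] hardy2_fun_hker[OF P s]) (simp add: hp_shift_def)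
  also have "\<dots> = 1 / (?D * (2 + (P - 1) * ((1 - z) / ?D)))" by simp
  also have "?D * (2 + (P - 1) * ((1 - z) / ?D)) = 2 * ?D + (P - 1) * (1 - z)"
    using D by (simp add: distrib_left)
  also have "\<dots> = 2 + (P + b - 1) * (1 - z)" by (simp add: field_simps)
  finally show "hardy2_fun (hp_translation b (hker P)) z = hardy2_fun (hker (P + b)) z"
    using z b P by (simp add: hardy2_fun_hker)
qed

text \<open>Indexing by finite sets of elements of the space is no restriction on the span: a
  combination of finitely many kernels can be indexed by the kernels themselves.\<close>

lemma hker_span_induct:
  assumes closed: "closed {f. Q f}"
    and Q: "\<And>(I::hardy2 set) d P. finite I \<Longrightarrow> (\<And>i. i \<in> I \<Longrightarrow> Re (P i) > 0) \<Longrightarrow> Q (\<Sum>i\<in>I. d i *\<^sub>C hker (P i))"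
  shows "Q f"
proof -
  have "Q f" if f: "f \<in> cvec.span (hker ` {P. Re P > 0})" for f
  proof -
    obtain t d where t: "f = (\<Sum>a\<in>t. d a *\<^sub>C a)" "finite t" "t \<subseteq> hker ` {P. Re P > 0}"
      using f unfolding cvec.span_explicit by blast
    have "\<forall>a\<in>t. \<exists>P. a = hker P \<and> Re P > 0" using t(3) by auto
    then obtain P where P: "\<And>a. a \<in> t \<Longrightarrow> a = hker (P a)" "\<And>a. a \<in> t \<Longrightarrow> Re (P a) > 0" by metis
    have "f = (\<Sum>a\<in>t. d a *\<^sub>C hker (P a))" unfolding t(1) using P(1) by (intro sum.cong) auto
    then show ?thesis using Q[OF t(2) P(2)] by simp
  qed
  then have "cvec.span (hker ` {P. Re P > 0}) \<subseteq> {f. Q f}" by blast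
  then have "closure (cvec.span (hker ` {P. Re P > 0})) \<subseteq> {f. Q f}" by (rule closure_minimal[OF _ closed])
  then show ?thesis using hker_dense by auto
qed

lemma bounded_clinear_simps:
  assumes "bounded_clinear T"
  shows "bounded_linear T" "T (x + y) = T x + T y" "T (c *\<^sub>C x) = c *\<^sub>C T x" "T (x - y) = T x - T y" "T 0 = 0"
    "T (sum f I) = (\<Sum>i\<in>I. T (f i))" "continuous_on A T"
proof -
  show *: "bounded_linear T" "T (c *\<^sub>C x) = c *\<^sub>C T x" using assms by (auto simp: bounded_clinear_def)
  interpret bounded_linear T by fact
  show "T (x + y) = T x + T y" "T (x - y) = T x - T y" "T 0 = 0" "T (sum f I) = (\<Sum>i\<in>I. T (f i))"
    by (rule add diff zero sum)+
  show "continuous_on A T" by (rule linear_continuous_on[OF *(1)])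
qed

lemma continuous_on_scaleC: "continuous_on A (\<lambda>x::'a::complex_normed_vector. c *\<^sub>C x)"
  by (rule linear_continuous_on[OF bounded_linear_scaleC])

text \<open>On the half-line |exp (- b s)| is at most 1. The bound is uniform in \<open>b\<close>,
  which permits averaging translations over a circle of parameters.\<close>

lemma norm_hp_translation_le:
  assumes b: "0 \<le> Re b" shows "norm (hp_translation b f) \<le> norm f"
proof (induction f rule: hker_span_induct)
  case 1
  show ?case
    by (intro closed_Collect_le continuous_on_norm continuous_on_id bounded_clinear_simps(7)
        bounded_clinear_hp_translation b)
next
  case (2 I d P)
  have "hp_translation b (\<Sum>i\<in>I. d i *\<^sub>C hker (P i)) = (\<Sum>i\<in>I. d i *\<^sub>C hker (P i + b))"
    using 2 by (simp add: bounded_clinear_simps[OF bounded_clinear_hp_translation[OF b]] hp_translation_hker[OF b])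
  moreover have "norm (\<Sum>i\<in>I. d i *\<^sub>C hker (P i + b)) \<le> 1 * norm (\<Sum>i\<in>I. d i *\<^sub>C hker (P i))"
  proof (rule norm_hker_comparison)
    fix s :: real assume "s \<ge> 0"
    have "(\<Sum>i\<in>I. d i * exp (- (P i + b) * of_real s)) = exp (- b * of_real s) * (\<Sum>i\<in>I. d i * exp (- P i * of_real s))"
      unfolding sum_distrib_left by (intro sum.cong refl) (simp add: mult_exp_exp algebra_simps)
    then show "cmod (\<Sum>i\<in>I. d i * exp (- (P i + b) * of_real s)) \<le> 1 * cmod (\<Sum>i\<in>I. d i * exp (- P i * of_real s))"
      using b \<open>s \<ge> 0\<close> by (simp add: norm_mult mult_left_le_one_le)
  qed (use 2 b in \<open>auto intro: add_pos_nonneg\<close>)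
  ultimately show ?case by simp
qed

lemma hp_translation_bounded_below:
  assumes b: "0 \<le> Re b" and d: "0 < \<delta>" "\<And>s. s \<ge> 0 \<Longrightarrow> \<delta> \<le> cmod (exp (- b * of_real s) - l)"
  shows "\<delta> * norm f \<le> norm (hp_translation b f - l *\<^sub>C f)"
proof (induction f rule: hker_span_induct)
  case 1
  show ?case
  proof (rule closed_Collect_le)
    show "continuous_on UNIV (\<lambda>f :: hardy2. \<delta> * norm f)"
      by (intro continuous_intros)
    show "continuous_on UNIV (\<lambda>f. norm (hp_translation b f - l *\<^sub>C f))"
      by (rule continuous_on_norm, rule continuous_on_diff,
        rule bounded_clinear_simps(7)[OF bounded_clinear_hp_translation[OF b]], rule continuous_on_scaleC)
  qed
next
  case (2 I d P)
  note N = bounded_clinear_simps[OF bounded_clinear_hp_translation[OF b]]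
  \<comment> \<open>Over the disjoint union of the index set with itself, the translation minus
    \<open>l\<close> is again a single combination of kernels.\<close>
  let ?P = "case_sum (\<lambda>i. P i + b) P" and ?d = "case_sum d (\<lambda>i. - l * d i)"
  let ?f = "\<Sum>i\<in>I. d i *\<^sub>C hker (P i)"
  have "hp_translation b ?f - l *\<^sub>C ?f = (\<Sum>i\<in>I <+> I. ?d i *\<^sub>C hker (?P i))"
  proof -
    have "hp_translation b ?f = (\<Sum>i\<in>I. d i *\<^sub>C hker (P i + b))"
      using 2 by (simp add: N hp_translation_hker[OF b])
    moreover have "l *\<^sub>C ?f = - (\<Sum>i\<in>I. (- l * d i) *\<^sub>C hker (P i))"
      by (simp add: cvec.scale_sum_right sum_negf)
    ultimately show ?thesis using 2(1) by (simp add: sum.Plus)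
  qed
  moreover have "norm ?f \<le> 1 / \<delta> * norm (\<Sum>i\<in>I <+> I. ?d i *\<^sub>C hker (?P i))"
  proof (rule norm_hker_comparison)
    fix s :: real assume s: "s \<ge> 0"
    let ?S = "\<Sum>i\<in>I. d i * exp (- P i * of_real s)"
    have e: "exp (- (P i + b) * of_real s) = exp (- b * of_real s) * exp (- P i * of_real s)" for i
      by (simp add: mult_exp_exp algebra_simps)
    have "(\<Sum>i\<in>I. d i * exp (- (P i + b) * of_real s)) = exp (- b * of_real s) * ?S"
      unfolding sum_distrib_left by (intro sum.cong refl) (simp only: e mult.left_commute)
    moreover have "(\<Sum>i\<in>I. - l * d i * exp (- P i * of_real s)) = - l * ?S"
      unfolding sum_distrib_left by (simp only: mult.assoc)
    ultimately have "(\<Sum>i\<in>I <+> I. ?d i * exp (- ?P i * of_real s)) = exp (- b * of_real s) * ?S + - l * ?S"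
      by (simp only: sum.Plus[OF 2(1) 2(1)] o_def sum.case)
    also have "\<dots> = (exp (- b * of_real s) - l) * ?S"
      by (simp only: diff_conv_add_uminus distrib_right)
    finally have "cmod (\<Sum>i\<in>I <+> I. ?d i * exp (- ?P i * of_real s)) = cmod (exp (- b * of_real s) - l) * cmod ?S"
      by (simp only: norm_mult)
    also have "\<dots> \<ge> \<delta> * cmod ?S"
      using d(2)[OF s] by (rule mult_right_mono) simp
    finally show "cmod ?S \<le> 1 / \<delta> * cmod (\<Sum>i\<in>I <+> I. ?d i * exp (- ?P i * of_real s))"
      using d(1) by (simp only: pos_le_divide_eq times_divide_eq_left mult_1 mult.commute)
  next
    show "Re (?P i) > 0" if "i \<in> I <+> I" for i
      using that 2(2) b by (auto simp: add_pos_nonneg)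
    show "finite I" "finite (I <+> I)" "\<And>i. i \<in> I \<Longrightarrow> Re (P i) > 0" "0 \<le> 1 / \<delta>"
      using 2 d(1) by simp_all
  qed
  ultimately show ?case
    using d(1) by (simp only: pos_le_divide_eq times_divide_eq_left mult_1 mult.commute)
qed

section \<open>Comparison with translations\<close>

text \<open>The weights are truncations of the geometric series of the Cauchy kernel, so the formula is exact on
  polynomials of degree below \<open>m\<close>.\<close>

lemma discrete_cauchy:
  assumes k: "k holomorphic_on ball 0 1" and t: "0 < t" "t < 1" and y: "cmod y < t"
  shows "(\<lambda>m. (\<Sum>j<m. (\<Sum>l<m. (y / of_real t) ^ l * cnj (cis (2 * pi * real j / real m) ^ l))
      * k (of_real t * cis (2 * pi * real j / real m))) / of_nat m) \<longlonglongrightarrow> k y"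
    (is "?A \<longlonglongrightarrow> k y")
proof -
  let ?c = "maclaurin_coeff k" and ?z = "\<lambda>m j. cis (2 * pi * real j / real m)"
  let ?P = "\<lambda>m z. \<Sum>n<m. ?c n * z ^ n"
  let ?K = "\<lambda>m j. \<Sum>l<m. (y / of_real t) ^ l * cnj (?z m j ^ l)"
  let ?q = "cmod y / t"
  have q: "0 \<le> ?q" "?q < 1" using t y by auto
  obtain \<tau> where \<tau>: "\<tau> \<longlonglongrightarrow> 0" "\<And>m z. cmod z = t \<Longrightarrow> cmod (k z - ?P m z) \<le> \<tau> m"
    using maclaurin_tail_tendsto_0[OF k less_imp_le[OF t(1)] t(2)] by blast
  have exact: "(\<Sum>j<m. ?K m j * ?P m (of_real t * ?z m j)) = of_nat m * ?P m y" for m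
  proof -
    have "(\<Sum>j<m. ?K m j * ?P m (of_real t * ?z m j))
      = (\<Sum>j<m. \<Sum>l<m. \<Sum>n<m. (y / of_real t) ^ l * (?c n * of_real t ^ n) * (?z m j ^ n * cnj (?z m j ^ l)))"
      unfolding sum_product by (intro sum.cong refl) (simp only: power_mult_distrib mult_ac)
    also have "\<dots> = (\<Sum>l<m. \<Sum>j<m. \<Sum>n<m. (y / of_real t) ^ l * (?c n * of_real t ^ n) * (?z m j ^ n * cnj (?z m j ^ l)))"
      by (rule sum.swap)
    also have "\<dots> = (\<Sum>l<m. \<Sum>n<m. \<Sum>j<m. (y / of_real t) ^ l * (?c n * of_real t ^ n) * (?z m j ^ n * cnj (?z m j ^ l)))"
      by (intro sum.cong refl sum.swap)
    also have "\<dots> = (\<Sum>l<m. \<Sum>n<m. (y / of_real t) ^ l * (?c n * of_real t ^ n) * (if n = l then of_nat m else 0))"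
      by (intro sum.cong refl) (simp only: sum_distrib_left[symmetric] sum_roots_of_unity lessThan_iff)
    also have "\<dots> = (\<Sum>l<m. (y / of_real t) ^ l * (?c l * of_real t ^ l) * of_nat m)"
      by (intro sum.cong refl) (simp add: sum.delta if_distrib cong: if_cong)
    also have "\<dots> = of_nat m * ?P m y"
      unfolding sum_distrib_left using t by (intro sum.cong refl) (simp add: power_divide)
    finally show ?thesis .
  qed
  have "cmod (?A m - ?P m y) \<le> 1 / (1 - ?q) * \<tau> m" if m: "m > 0" for m
  proof -
    have "?A m - ?P m y = ((\<Sum>j<m. ?K m j * k (of_real t * ?z m j)) - (\<Sum>j<m. ?K m j * ?P m (of_real t * ?z m j))) / of_nat m"
      using m unfolding exact by (simp add: diff_divide_distrib)
    also have "\<dots> = (\<Sum>j<m. ?K m j * (k (of_real t * ?z m j) - ?P m (of_real t * ?z m j))) / of_nat m"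
      by (simp only: sum_subtractf right_diff_distrib)
    finally have "cmod (?A m - ?P m y) \<le> (\<Sum>j<m. cmod (?K m j * (k (of_real t * ?z m j) - ?P m (of_real t * ?z m j)))) / real m"
      by (simp add: norm_divide divide_right_mono norm_sum)
    also have "\<dots> \<le> (\<Sum>j<m. 1 / (1 - ?q) * \<tau> m) / real m"
    proof (intro divide_right_mono sum_mono)
      fix j
      have "cmod (?K m j) \<le> (\<Sum>l<m. ?q ^ l)"
        using t by (intro sum_norm_le) (simp add: norm_mult norm_power norm_divide)
      also have "\<dots> \<le> (\<Sum>l. ?q ^ l)" using q by (intro sum_le_suminf summable_geometric) auto
      also have "\<dots> = 1 / (1 - ?q)" using q by (intro suminf_geometric) auto
      finally have "cmod (?K m j) \<le> 1 / (1 - ?q)" .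
      then show "cmod (?K m j * (k (of_real t * ?z m j) - ?P m (of_real t * ?z m j))) \<le> 1 / (1 - ?q) * \<tau> m"
        unfolding norm_mult using q t by (intro mult_mono \<tau>(2)) (auto simp: norm_mult)
    qed auto
    also have "\<dots> = 1 / (1 - ?q) * \<tau> m" using m by simp
    finally show ?thesis .
  qed
  then have "\<forall>\<^sub>F m in sequentially. cmod (?A m - ?P m y) \<le> 1 / (1 - ?q) * \<tau> m"
    by (intro eventually_sequentiallyI[of 1]) auto
  moreover have "(\<lambda>m. 1 / (1 - ?q) * \<tau> m) \<longlonglongrightarrow> 1 / (1 - ?q) * 0"
    by (intro tendsto_intros \<tau>)
  ultimately have "(\<lambda>m. ?A m - ?P m y) \<longlonglongrightarrow> 0"
    by (intro Lim_null_comparison[where f = "\<lambda>m. ?A m - ?P m y" and g = "\<lambda>m. 1 / (1 - ?q) * \<tau> m"]) simp_all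
  moreover have "(\<lambda>m. ?P m y) \<longlonglongrightarrow> k y"
    using maclaurin_sums[OF k, of y] y t by (simp add: sums_def)
  ultimately have "(\<lambda>m. (?A m - ?P m y) + ?P m y) \<longlonglongrightarrow> 0 + k y" by (rule tendsto_add)
  then show ?thesis by simp
qed

text \<open>For fixed \<open>z\<close> the map from x to \<open>G x z\<close> is analytic in Re x >
  0. The Cauchy formula on the circle of radius Re b / 2 about \<open>b\<close> thus writes
  \<open>G (b + \<eta> z) z\<close> as an average of translations with constant parameters, all of
  them contractions. Only the weights depend on \<open>z\<close>, and their deviation from the
  weights for \<eta> = 0 is dominated by a geometric series with sum q / (1 - q).\<close>

lemma hp_translation_perturb:
  fixes f :: hardy2
  assumes b: "0 < Re b" and \<eta>: "\<eta> holomorphic_on ball 0 1" "\<And>z. z \<in> ball 0 1 \<Longrightarrow> cmod (\<eta> z) \<le> q * Re b / 2"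
    and q: "0 \<le> q" "q < 1"
  defines "G \<equiv> \<lambda>x z. 1 / (1 + x * (1 - z) / 2) * hardy2_fun f (hp_shift (\<lambda>_. x) z)"
  shows "hardy_le (\<lambda>z. G (b + \<eta> z) z - G b z) (q / (1 - q) * norm f)"
proof -
  let ?r = "complex_of_real (Re b)" and ?z = "\<lambda>m j. cis (2 * pi * real j / real m)"
  \<comment> \<open>The offset in units of Re b: at most q / 2, so its ratio to the circle radius
    1/2 is at most \<open>q\<close>.\<close>
  define Y where "Y z = \<eta> z / ?r" for z
  have Y: "cmod (Y z) \<le> q / 2" if "z \<in> ball 0 1" for z
    using \<eta>(2)[OF that] b by (simp add: Y_def norm_divide field_simps)
  have Yh: "Y holomorphic_on ball 0 1" unfolding Y_def using b by (intro holomorphic_intros \<eta>) auto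
  define k where "k z y = G (b + ?r * y) z" for z y
  have Re_pos: "Re (b + ?r * y) \<ge> 0" if "cmod y < 1" for y
  proof -
    have "- Re y \<le> 1" using abs_Re_le_cmod[of y] that by linarith
    then have "Re b * (- Re y) \<le> Re b * 1" using b by (intro mult_left_mono) auto
    then show ?thesis by simp
  qed
  have kh: "k z holomorphic_on ball 0 1" if z: "z \<in> ball 0 1" for z
  proof -
    have nz: "1 + (b + ?r * y) * (1 - z) / 2 \<noteq> 0" if "y \<in> ball 0 1" for y
      using hp_denominator(1)[of z "b + ?r * y"] z that Re_pos[of y] by simp
    have s: "(\<lambda>y. hp_shift (\<lambda>_. b + ?r * y) z) holomorphic_on ball 0 1"
      unfolding hp_shift_def by (intro holomorphic_intros nz) auto
    have "(hardy2_fun f \<circ> (\<lambda>y. hp_shift (\<lambda>_. b + ?r * y) z)) holomorphic_on ball 0 1"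
    proof (rule holomorphic_on_compose_gen[OF s hardy2_holomorphic])
      show "(\<lambda>y. hp_shift (\<lambda>_. b + ?r * y) z) ` ball 0 1 \<subseteq> ball 0 1"
        using hp_shift_in_disc[of z "\<lambda>_. b + ?r * _"] z Re_pos by auto
    qed
    then show ?thesis unfolding k_def G_def o_def
      by (intro holomorphic_on_mult holomorphic_intros nz) auto
  qed
  \<comment> \<open>The subtracted 1 is the weight for offset 0, where only the term l = 0
    survives.\<close>
  define W where "W m j z = (\<Sum>l<m. (Y z / of_real (1/2)) ^ l * cnj (?z m j ^ l)) - 1" for m j z
  define D where "D m z = (\<Sum>j<m. 1 / of_nat m * (W m j z * hardy2_fun (hp_translation (b + ?r * (of_real (1/2) * ?z m j)) f) z))" for m z
  \<comment> \<open>With at least one node the term l = 0 is present and cancels the 1 in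
    \<open>W\<close>.\<close>
  have D_le: "hardy_le (D (Suc m)) (q / (1 - q) * norm f)" for m
  proof -
    let ?m = "Suc m"
    have "hardy_le (\<lambda>z. 1 / of_nat ?m * (W ?m j z * hardy2_fun (hp_translation (b + ?r * (of_real (1/2) * ?z ?m j)) f) z))
      (cmod (1 / of_nat ?m) * (q / (1 - q) * norm f))" for j
    proof (intro hardy_le_cmult hardy_le_mult)
      have "0 \<le> Re (b + ?r * (of_real (1/2) * ?z ?m j))"
        by (rule Re_pos) (simp add: norm_mult)
      then show "hardy_le (hardy2_fun (hp_translation (b + ?r * (of_real (1/2) * ?z ?m j)) f)) (norm f)"
        by (rule hardy_le_mono[OF hardy_le_norm norm_hp_translation_le])
      show "W ?m j holomorphic_on ball 0 1"
        unfolding W_def by (intro holomorphic_intros Yh) auto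
      fix z :: complex assume z: "z \<in> ball 0 1"
      have "W ?m j z = (\<Sum>l<m. (Y z / of_real (1/2)) ^ Suc l * cnj (?z ?m j ^ Suc l))"
        unfolding W_def by (subst sum.lessThan_Suc_shift) simp
      also have "cmod \<dots> \<le> (\<Sum>l<m. q ^ Suc l)"
      proof (rule sum_norm_le)
        fix l
        have "cmod (Y z / of_real (1/2)) \<le> q" using Y[OF z] by (simp add: norm_divide)
        then have "cmod (Y z / of_real (1/2)) ^ Suc l \<le> q ^ Suc l" by (rule power_mono) simp
        then show "cmod ((Y z / of_real (1/2)) ^ Suc l * cnj (?z ?m j ^ Suc l)) \<le> q ^ Suc l"
          by (simp only: norm_mult norm_power complex_mod_cnj norm_cis power_one mult_1_right)
      qed
      also have "\<dots> = q * (\<Sum>l<m. q ^ l)" by (simp add: sum_distrib_left)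
      also have "\<dots> \<le> q * (\<Sum>l. q ^ l)" using q by (intro mult_left_mono sum_le_suminf summable_geometric) auto
      also have "\<dots> = q / (1 - q)" using q by (subst suminf_geometric) auto
      finally show "cmod (W ?m j z) \<le> q / (1 - q)" .
    qed
    then have "hardy_le (D ?m) (\<Sum>j<?m. cmod (1 / of_nat ?m) * (q / (1 - q) * norm f))"
      unfolding D_def by (rule hardy_le_sum)
    moreover have "cmod (1 / of_nat ?m) = 1 / real ?m" by (simp only: norm_divide norm_one norm_of_nat)
    ultimately show ?thesis by simp
  qed
  show ?thesis
  proof (rule hardy_le_limit[where f = "\<lambda>m. D (Suc m)"])
    show "hardy_le (D (Suc m)) (q / (1 - q) * norm f)" for m by (rule D_le)
    have nz1: "1 + (b + \<eta> z) * (1 - z) / 2 \<noteq> 0" and nz2: "1 + b * (1 - z) / 2 \<noteq> 0" 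
      and s1: "hp_shift (\<lambda>z. b + \<eta> z) z \<in> ball 0 1" and s2: "hp_shift (\<lambda>_. b) z \<in> ball 0 1"
      if z: "z \<in> ball 0 1" for z
    proof -
      have "cmod (Y z) < 1" using Y[OF z] q by linarith
      moreover have "b + \<eta> z = b + ?r * Y z" using b by (simp add: Y_def)
      ultimately have p: "0 \<le> Re (b + \<eta> z)" using Re_pos by metis
      show "1 + (b + \<eta> z) * (1 - z) / 2 \<noteq> 0" "1 + b * (1 - z) / 2 \<noteq> 0"
        using hp_denominator(1) z p b by auto
      show "hp_shift (\<lambda>z. b + \<eta> z) z \<in> ball 0 1" "hp_shift (\<lambda>_. b) z \<in> ball 0 1"
        using hp_shift_in_disc[of z "\<lambda>z. b + \<eta> z"] hp_shift_in_disc[of z "\<lambda>z. b"] z p b by auto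
    qed
    have h1: "hp_shift (\<lambda>z. b + \<eta> z) holomorphic_on ball 0 1" "hp_shift (\<lambda>_. b) holomorphic_on ball 0 1"
      unfolding hp_shift_def by (intro holomorphic_intros \<eta> nz1 nz2; simp)+
    have "(hardy2_fun f \<circ> hp_shift (\<lambda>z. b + \<eta> z)) holomorphic_on ball 0 1"
      "(hardy2_fun f \<circ> hp_shift (\<lambda>_. b)) holomorphic_on ball 0 1"
      using s1 s2 by (auto intro!: holomorphic_on_compose_gen[OF _ hardy2_holomorphic] h1)
    then show "(\<lambda>z. G (b + \<eta> z) z - G b z) holomorphic_on ball 0 1"
      unfolding G_def hp_shift_def o_def
      by (intro holomorphic_on_diff holomorphic_on_mult holomorphic_intros \<eta> nz1 nz2) auto
    fix z :: complex assume z: "z \<in> ball 0 1"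
    have y: "cmod (Y z) < 1 / 2" using Y[OF z] q by linarith
    have kY: "k z (Y z) = G (b + \<eta> z) z" "k z 0 = G b z" using b by (auto simp: k_def Y_def)
    let ?v = "\<lambda>m j. k z (of_real (1/2) * ?z m j)"
    have "(\<lambda>m. (\<Sum>j<m. (\<Sum>l<m. (Y z / of_real (1/2)) ^ l * cnj (?z m j ^ l)) * ?v m j) / of_nat m) \<longlonglongrightarrow> k z (Y z)"
      by (rule discrete_cauchy[OF kh[OF z]]) (use y in auto)
    moreover have "(\<lambda>m. (\<Sum>j<m. (\<Sum>l<m. (0 / of_real (1/2)) ^ l * cnj (?z m j ^ l)) * ?v m j) / of_nat m) \<longlonglongrightarrow> k z 0"
      by (rule discrete_cauchy[OF kh[OF z]]) auto
    ultimately have "(\<lambda>m. (\<Sum>j<m. (\<Sum>l<m. (Y z / of_real (1/2)) ^ l * cnj (?z m j ^ l)) * ?v m j) / of_nat m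
        - (\<Sum>j<m. (\<Sum>l<m. (0 / of_real (1/2)) ^ l * cnj (?z m j ^ l)) * ?v m j) / of_nat m) \<longlonglongrightarrow> k z (Y z) - k z 0"
      by (rule tendsto_diff)
    moreover have "(\<Sum>j<m. (\<Sum>l<m. (Y z / of_real (1/2)) ^ l * cnj (?z m j ^ l)) * ?v m j) / of_nat m
        - (\<Sum>j<m. (\<Sum>l<m. (0 / of_real (1/2)) ^ l * cnj (?z m j ^ l)) * ?v m j) / of_nat m = D m z" for m
    proof -
      \<comment> \<open>At l = 0 the power 0 ^ 0 is 1, and j < m guarantees that this term
        occurs.\<close>
      have one: "(\<Sum>l<m. (0 / of_real (1/2)) ^ l * cnj (?z m j ^ l)) = (1::complex)" if "j < m" for j
        using that by (cases m) (auto simp: sum.lessThan_Suc_shift simp del: sum.lessThan_Suc)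
      have v: "?v m j = hardy2_fun (hp_translation (b + ?r * (of_real (1/2) * ?z m j)) f) z" for j
      proof -
        have "0 \<le> Re (b + ?r * (of_real (1/2) * ?z m j))"
          by (rule Re_pos) (simp add: norm_mult)
        then show ?thesis using hardy2_fun_hp_translation[OF _ z] by (simp only: k_def G_def)
      qed
      have "(\<Sum>j<m. (\<Sum>l<m. (Y z / of_real (1/2)) ^ l * cnj (?z m j ^ l)) * ?v m j)
        - (\<Sum>j<m. (\<Sum>l<m. (0 / of_real (1/2)) ^ l * cnj (?z m j ^ l)) * ?v m j) = (\<Sum>j<m. W m j z * ?v m j)"
      proof -
        have "(\<Sum>j<m. (\<Sum>l<m. (0 / of_real (1/2)) ^ l * cnj (?z m j ^ l)) * ?v m j) = (\<Sum>j<m. ?v m j)"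
          by (intro sum.cong refl) (simp only: one lessThan_iff mult_1)
        then show ?thesis by (simp only: sum_subtractf[symmetric] W_def left_diff_distrib mult_1)
      qed
      then show ?thesis unfolding D_def v[symmetric] diff_divide_distrib[symmetric]
        by (simp only: sum_divide_distrib times_divide_eq_left mult_1)
    qed
    ultimately have "(\<lambda>m. D m z) \<longlonglongrightarrow> G (b + \<eta> z) z - G b z" by (simp only: kY)
    then show "(\<lambda>m. D (Suc m) z) \<longlonglongrightarrow> G (b + \<eta> z) z - G b z" by (rule LIMSEQ_Suc)
  qed
qed

text \<open>The factor 1 + M with M = (b + \<eta>) (1 - z) / 2 cancels the weight of the perturbed
  translation and yields the composition operator. The error splits into 1 + M times the
  perturbation and M times the translation by \<open>b\<close>; |M| is at most 2 |b|, since |\<eta>|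
  \<le> |b| and |1 - z| \<le> 2.\<close>

lemma composition_near_translation:
  assumes b: "0 < Re b" and \<eta>: "\<eta> holomorphic_on ball 0 1" "\<And>z. z \<in> ball 0 1 \<Longrightarrow> cmod (\<eta> z) \<le> q * Re b / 2"
    and q: "0 \<le> q" "q < 1"
  shows "norm (composition_operator (hp_shift (\<lambda>z. b + \<eta> z)) f - hp_translation b f)
    \<le> ((1 + 2 * cmod b) * (q / (1 - q)) + 2 * cmod b) * norm f"
proof (rule norm_le_hardy_le)
  define G where "G x z = 1 / (1 + x * (1 - z) / 2) * hardy2_fun f (hp_shift (\<lambda>_. x) z)" for x z
  let ?M = "\<lambda>z. (b + \<eta> z) * (1 - z) / 2"
  have M: "cmod (?M z) \<le> 2 * cmod b" if z: "z \<in> ball 0 1" for z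
  proof -
    have "q * Re b / 2 \<le> 1 * Re b" using q b by (auto intro: mult_mono)
    then have "cmod (\<eta> z) \<le> cmod b"
      using \<eta>(2)[OF z] complex_Re_le_cmod[of b] by linarith
    then have "cmod (b + \<eta> z) \<le> 2 * cmod b" using norm_triangle_ineq[of b "\<eta> z"] by linarith
    moreover have "cmod (1 - z) \<le> 2" using norm_triangle_ineq4[of 1 z] z by simp
    ultimately have "cmod (b + \<eta> z) * cmod (1 - z) \<le> (2 * cmod b) * 2" by (intro mult_mono) auto
    then show ?thesis by (simp add: norm_mult norm_divide)
  qed
  have Mh: "?M holomorphic_on ball 0 1" by (intro holomorphic_intros \<eta>) auto
  have pos: "0 \<le> Re (b + \<eta> z)" if z: "z \<in> ball 0 1" for z
  proof -
    have "q * Re b / 2 \<le> 1 * Re b" using q b by (auto intro: mult_mono)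
    then show ?thesis using \<eta>(2)[OF z] abs_Re_le_cmod[of "\<eta> z"] by simp
  qed
  have sm: "disc_selfmap (hp_shift (\<lambda>z. b + \<eta> z))"
    by (intro disc_selfmap_hp_shift holomorphic_intros \<eta> pos)
  have "hardy_le (\<lambda>z. (1 + ?M z) * (G (b + \<eta> z) z - G b z) + ?M z * hardy2_fun (hp_translation b f) z)
    ((1 + 2 * cmod b) * (q / (1 - q) * norm f) + 2 * cmod b * norm f)"
  proof (intro hardy_le_add hardy_le_mult Mh M)
    show "hardy_le (\<lambda>z. G (b + \<eta> z) z - G b z) (q / (1 - q) * norm f)"
      unfolding G_def by (rule hp_translation_perturb[OF assms])
    show "(\<lambda>z. 1 + ?M z) holomorphic_on ball 0 1" by (intro holomorphic_intros \<eta>) auto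
    show "cmod (1 + ?M z) \<le> 1 + 2 * cmod b" if "z \<in> ball 0 1" for z
      using norm_triangle_ineq[of 1 "?M z"] M[OF that] by simp
    show "hardy_le (hardy2_fun (hp_translation b f)) (norm f)"
      by (rule hardy_le_mono[OF hardy_le_norm norm_hp_translation_le]) (use b in simp)
  qed
  then have "hardy_le (hardy2_fun (composition_operator (hp_shift (\<lambda>z. b + \<eta> z)) f - hp_translation b f))
    ((1 + 2 * cmod b) * (q / (1 - q) * norm f) + 2 * cmod b * norm f)"
  proof (rule hardy_le_cong)
    fix z :: complex assume z: "z \<in> ball 0 1"
    have G1: "(1 + ?M z) * G (b + \<eta> z) z = hardy2_fun f (hp_shift (\<lambda>z. b + \<eta> z) z)"
      using hp_denominator(1)[of z "b + \<eta> z"] pos[OF z] z by (simp add: G_def hp_shift_def)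
    have G2: "hardy2_fun (hp_translation b f) z = G b z"
      using b z by (simp add: G_def hardy2_fun_hp_translation)
    have "(1 + ?M z) * (G (b + \<eta> z) z - G b z) + ?M z * G b z = (1 + ?M z) * G (b + \<eta> z) z - G b z"
      by (simp only: ring_distribs mult_1) simp
    then show "(1 + ?M z) * (G (b + \<eta> z) z - G b z) + ?M z * hardy2_fun (hp_translation b f) z
      = hardy2_fun (composition_operator (hp_shift (\<lambda>z. b + \<eta> z)) f - hp_translation b f) z"
      by (simp only: G1 G2 minus_hardy2.rep_eq hardy2_fun_composition[OF sm z])
  qed
  then show "hardy_le (hardy2_fun (composition_operator (hp_shift (\<lambda>z. b + \<eta> z)) f - hp_translation b f))
    (((1 + 2 * cmod b) * (q / (1 - q)) + 2 * cmod b) * norm f)"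
    by (simp only: ring_distribs mult.assoc)
qed

section \<open>The spectrum lies in the spiral\<close>

text \<open>The lower bound supplies both injectivity and the norm of the inverse.\<close>

lemma clinear_inverse:
  fixes T :: "'a::complex_normed_vector \<Rightarrow> 'b::complex_normed_vector"
  assumes T: "bounded_clinear T" and c: "c > 0" "\<And>x. c * norm x \<le> norm (T x)"
    and surj: "surj T"
  obtains S where "bounded_clinear S" "\<And>x. S (T x) = x" "\<And>y. T (S y) = y" "\<And>y. norm (S y) \<le> norm y / c"
proof -
  note T' = bounded_clinear_simps[OF T]
  have inj: "x = y" if "T x = T y" for x y
  proof -
    have "c * norm (x - y) \<le> 0" using c(2)[of "x - y"] that by (simp add: T')
    then show ?thesis using c(1) by (simp add: mult_le_0_iff)
  qed
  define S where "S = inv T"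
  have TS: "T (S y) = y" for y unfolding S_def by (rule surj_f_inv_f[OF surj])
  have ST: "S (T x) = x" for x by (rule inj) (rule TS)
  have le: "norm (S y) \<le> norm y / c" for y
    using c(2)[of "S y"] c(1) by (simp add: TS field_simps)
  have SC: "S (d *\<^sub>C x) = d *\<^sub>C S x" for d x by (rule inj) (simp add: TS T')
  have "bounded_linear S"
  proof (rule bounded_linear_intro)
    show "S (x + y) = S x + S y" for x y by (rule inj) (simp add: TS T')
    show "S (r *\<^sub>R x) = r *\<^sub>R S x" for r x using SC[of "of_real r" x] by (simp add: scaleC_of_real)
    show "norm (S x) \<le> norm x * (1 / c)" for x using le[of x] by simp
  qed
  then have "bounded_clinear S" using SC by (simp add: bounded_clinear_def)
  then show ?thesis using that ST TS le by blast
qed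

lemma bounded_clinear_shift:
  fixes T :: "'a::complex_normed_vector \<Rightarrow> 'a"
  assumes T: "bounded_clinear T" shows "bounded_clinear (\<lambda>x. T x - l *\<^sub>C x)"
proof -
  have "bounded_linear (\<lambda>x. T x - l *\<^sub>C x)"
    by (intro bounded_linear_sub bounded_clinear_simps(1)[OF T] bounded_linear_scaleC)
  then show ?thesis
    by (auto simp: bounded_clinear_def bounded_clinear_simps[OF T] cvec.scale_right_diff_distrib mult.commute)
qed

lemma not_in_spectrumI:
  fixes T :: "'a::complex_normed_vector \<Rightarrow> 'a"
  assumes T: "bounded_clinear T" and c: "c > 0" "\<And>x. c * norm x \<le> norm (T x - l *\<^sub>C x)"
    and surj: "surj (\<lambda>x. T x - l *\<^sub>C x)"
  shows "l \<notin> spectrum T"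
proof -
  obtain S where "bounded_clinear S" "\<And>x. S (T x - l *\<^sub>C x) = x" "\<And>y. T (S y) - l *\<^sub>C S y = y"
    using clinear_inverse[OF bounded_clinear_shift[OF T] c surj] by metis
  then show ?thesis unfolding spectrum_def by blast
qed

text \<open>With S the inverse of T - l, a solution of T x - l' x = y is a fixed point of x = S (y +
  (l' - l) x). The admissible distance is the lower bound \<open>c\<close> itself, so steps along a
  path with uniform \<open>c\<close> do not shrink.\<close>

lemma surj_near:
  fixes T :: "'a::{banach,complex_normed_vector} \<Rightarrow> 'a"
  assumes T: "bounded_clinear T" and c: "c > 0" "\<And>x. c * norm x \<le> norm (T x - l *\<^sub>C x)"
    and surj: "surj (\<lambda>x. T x - l *\<^sub>C x)" and near: "cmod (l' - l) < c"
  shows "surj (\<lambda>x. T x - l' *\<^sub>C x)"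
proof -
  obtain S where S: "bounded_clinear S" "\<And>y. T (S y) - l *\<^sub>C S y = y" "\<And>y. norm (S y) \<le> norm y / c"
    using clinear_inverse[OF bounded_clinear_shift[OF T] c surj] by metis
  have "\<exists>x. y = T x - l' *\<^sub>C x" for y
  proof -
    let ?F = "\<lambda>x. S (y + (l' - l) *\<^sub>C x)"
    have "\<exists>!x. ?F x = x"
    proof (rule banach_fix_type)
      show "0 \<le> cmod (l' - l) / c" "cmod (l' - l) / c < 1" using c near by auto
      show "\<forall>x z. dist (?F x) (?F z) \<le> cmod (l' - l) / c * dist x z"
      proof (intro allI)
        fix x z
        have "?F x - ?F z = S ((l' - l) *\<^sub>C (x - z))"
          by (simp only: bounded_clinear_simps(4)[OF S(1), symmetric] cvec.scale_right_diff_distrib add_diff_add diff_self add_0)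
        then have "norm (?F x - ?F z) \<le> norm ((l' - l) *\<^sub>C (x - z)) / c" using S(3) by simp
        then show "dist (?F x) (?F z) \<le> cmod (l' - l) / c * dist x z" by (simp add: dist_norm norm_scaleC)
      qed
    qed
    then obtain x where "?F x = x" by blast
    then have "T x - l *\<^sub>C x = y + (l' - l) *\<^sub>C x" using S(2)[of "y + (l' - l) *\<^sub>C x"] by simp
    then have "y = T x - l' *\<^sub>C x" by (simp add: cvec.scale_left_diff_distrib algebra_simps)
    then show ?thesis by blast
  qed
  then show ?thesis unfolding surj_def by blast
qed

text \<open>The Neumann series for |l| above the norm bound, in the form of a contraction.\<close>

lemma surj_large:
  fixes T :: "'a::{banach,complex_normed_vector} \<Rightarrow> 'a"
  assumes T: "bounded_clinear T" and K: "\<And>x. norm (T x) \<le> norm x * K" "0 \<le> K" "K < cmod l"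
  shows "surj (\<lambda>x. T x - l *\<^sub>C x)"
proof -
  have l: "l \<noteq> 0" using K by auto
  have "\<exists>x. y = T x - l *\<^sub>C x" for y
  proof -
    let ?F = "\<lambda>x. (1 / l) *\<^sub>C (T x - y)"
    have "\<exists>!x. ?F x = x"
    proof (rule banach_fix_type)
      have "cmod l > 0" using l by simp
      then show "0 \<le> K / cmod l" "K / cmod l < 1" using K by (auto simp: divide_less_eq)
      show "\<forall>x z. dist (?F x) (?F z) \<le> K / cmod l * dist x z"
      proof (intro allI)
        fix x z
        have "?F x - ?F z = (1 / l) *\<^sub>C T (x - z)"
          by (simp add: bounded_clinear_simps[OF T] cvec.scale_right_diff_distrib)
        then have "norm (?F x - ?F z) = norm (T (x - z)) / cmod l" by (simp add: norm_scaleC norm_divide)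
        also have "\<dots> \<le> norm (x - z) * K / cmod l" by (intro divide_right_mono K) auto
        finally show "dist (?F x) (?F z) \<le> K / cmod l * dist x z" by (simp add: dist_norm mult.commute)
      qed
    qed
    then obtain x where "?F x = x" by blast
    then have "l *\<^sub>C x = l *\<^sub>C ?F x" by simp
    also have "\<dots> = T x - y" using l by (simp add: cvec.scale_right_diff_distrib)
    finally have "y = T x - l *\<^sub>C x" by simp
    then show ?thesis by blast
  qed
  then show ?thesis unfolding surj_def by blast
qed

text \<open>The ray \<open>\<tau> \<mapsto> l exp (a \<tau>)\<close> joins \<open>l\<close> to infinity; along it surjectivity is both an open and a closed
  condition.\<close>

lemma surj_along_ray:
  fixes T :: "'a::{banach,complex_normed_vector} \<Rightarrow> 'a"
  assumes T: "bounded_clinear T" and l: "l \<noteq> 0" and a: "Re a > 0" and c: "c > 0"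
    "\<And>\<tau> x. \<tau> \<ge> 0 \<Longrightarrow> c * norm x \<le> norm (T x - (l * exp (a * of_real \<tau>)) *\<^sub>C x)"
  shows "surj (\<lambda>x. T x - l *\<^sub>C x)"
proof -
  obtain K where K: "K > 0" "\<And>x. norm (T x) \<le> norm x * K"
    using bounded_linear.pos_bounded[OF bounded_clinear_simps(1)[OF T]] by blast
  let ?\<gamma> = "\<lambda>\<tau>. l * exp (a * of_real \<tau>)"
  let ?P = "\<lambda>\<tau>. surj (\<lambda>x. T x - ?\<gamma> \<tau> *\<^sub>C x)"
  have norm_\<gamma>: "cmod (?\<gamma> \<tau>) = cmod l * exp (Re a * \<tau>)" for \<tau> by (simp add: norm_mult)
  \<comment> \<open>At this parameter the modulus of the ray exceeds \<open>K\<close>, because exp x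
    > x.\<close>
  define m where "m = K / (cmod l * Re a)"
  have m: "m \<ge> 0" using K a l by (simp add: m_def)
  have "K < cmod (?\<gamma> m)"
  proof -
    have "K = cmod l * (Re a * m)" using l a by (simp add: m_def)
    also have "\<dots> < cmod l * exp (Re a * m)"
    proof (intro mult_strict_left_mono)
      show "Re a * m < exp (Re a * m)" using exp_ge_add_one_self[of "Re a * m"] by linarith
    qed (use l in auto)
    finally show ?thesis by (simp add: norm_\<gamma>)
  qed
  then have start: "?P m" using surj_large[OF T K(2), of "?\<gamma> m"] K(1) by simp
  have cont: "continuous_on {0..m} ?\<gamma>" by (intro continuous_intros)
  have "?P 0"
  proof (rule connected_induction_simple[where S = "{0..m}" and a = m and P = ?P])
    show "connected {0..m}" by simp
    fix t assume t: "t \<in> {0..m}"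
    \<comment> \<open>Radius c / 2: the images of any two parameters in this neighbourhood are less
      than \<open>c\<close> apart, the range of \<open>surj_near\<close>.\<close>
    let ?T = "{0..m} \<inter> ?\<gamma> -` ball (?\<gamma> t) (c / 2)"
    have op: "openin (top_of_set {0..m}) ?T"
      by (rule continuous_openin_preimage_gen[OF cont]) simp
    have step: "?P y" if "x \<in> ?T" "y \<in> ?T" "?P x" for x y
    proof (rule surj_near[OF T c(1)])
      show "c * norm v \<le> norm (T v - ?\<gamma> x *\<^sub>C v)" for v using that by (intro c(2)) auto
      show "?P x" by fact
      have "dist (?\<gamma> y) (?\<gamma> x) < c"
        by (rule dist_triangle_half_r[of "?\<gamma> t"]) (use that in simp_all)
      then show "cmod (?\<gamma> y - ?\<gamma> x) < c" by (simp add: dist_norm)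
    qed
    show "\<exists>T. openin (top_of_set {0..m}) T \<and> t \<in> T \<and> (\<forall>x\<in>T. \<forall>y\<in>T. ?P x \<longrightarrow> ?P y)"
    proof (rule exI[of _ ?T], intro conjI ballI impI)
      show "t \<in> ?T" using t c(1) by simp
    qed (rule op, rule step)
  qed (use m in simp, use m in simp, rule start)
  then show ?thesis by simp
qed

text \<open>If R inverts B A - l, then (A R B - 1) / l inverts A B - l.\<close>

lemma spectrum_comp_swap:
  fixes A :: "'b::complex_normed_vector \<Rightarrow> 'a::complex_normed_vector" and B :: "'a \<Rightarrow> 'b"
  assumes A: "bounded_clinear A" and B: "bounded_clinear B" and l: "l \<noteq> 0" "l \<notin> spectrum (\<lambda>x. B (A x))"
  shows "l \<notin> spectrum (\<lambda>x. A (B x))"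
proof -
  note A' = bounded_clinear_simps[OF A] and B' = bounded_clinear_simps[OF B]
  obtain R where R: "bounded_clinear R" "\<And>x. R (B (A x) - l *\<^sub>C x) = x" "\<And>x. B (A (R x)) - l *\<^sub>C R x = x"
    using l(2) unfolding spectrum_def by blast
  note R' = bounded_clinear_simps[OF R(1)]
  define S where "S x = (1 / l) *\<^sub>C (A (R (B x)) - x)" for x
  have lin: "bounded_linear (\<lambda>x. A (R (B x)) - x)"
    using bounded_linear_compose[OF A'(1) bounded_linear_compose[OF R'(1) B'(1)]]
    by (intro bounded_linear_sub bounded_linear_ident)
  from bounded_linear_compose[OF bounded_linear_scaleC lin] have "bounded_linear S" by (simp add: S_def[abs_def])
  moreover have "S (c *\<^sub>C x) = c *\<^sub>C S x" for c x
    by (simp add: S_def A' B' R' mult.commute flip: cvec.scale_right_diff_distrib)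
  ultimately have "bounded_clinear S" by (simp add: bounded_clinear_def)
  moreover have "S (A (B x) - l *\<^sub>C x) = x" for x
  proof -
    have "R (B (A (B x) - l *\<^sub>C x)) = B x" using R(2)[of "B x"] by (simp add: B')
    then show ?thesis using l(1) by (simp add: S_def)
  qed
  moreover have "A (B (S x)) - l *\<^sub>C S x = x" for x
  proof -
    have "B (A (R (B x))) - B x = l *\<^sub>C R (B x)" using R(3)[of "B x"] by (simp add: algebra_simps)
    then have "A (B (S x)) = A (R (B x))" using l(1) by (simp add: S_def A' B' flip: A'(4) B'(4))
    then show ?thesis using l(1) by (simp add: S_def)
  qed
  ultimately show ?thesis unfolding spectrum_def by blast
qed

text \<open>Moving \<open>l\<close> by \<tau> along its ray turns the difference into exp (a \<tau>)
  times the difference of \<open>l\<close> with the spiral at s + \<tau>. Hence the distance to the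
  spiral never drops below that of \<open>l\<close>, and one constant serves the whole ray.\<close>

lemma exp_spiral_distance:
  assumes a: "Re a > 0" and l: "l \<notin> {exp (- a * complex_of_real t) |t. t \<ge> 0} \<union> {0}"
  obtains d where "d > 0"
    "\<And>s \<tau>. s \<ge> 0 \<Longrightarrow> \<tau> \<ge> 0 \<Longrightarrow> d \<le> cmod (exp (- a * of_real s) - l * exp (a * of_real \<tau>))"
proof -
  have l0: "l \<noteq> 0" using l by auto
  let ?g = "\<lambda>s. cmod (exp (- a * of_real s) - l)"
  \<comment> \<open>Beyond \<open>S\<close> the spiral stays in the disc of radius |l| / 2, since
    exp x > x; on {0..S} compactness provides a minimum.\<close>
  define S where "S = 2 / (cmod l * Re a)"
  have S: "S > 0" using l0 a by (simp add: S_def)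
  have "\<exists>x\<in>{0..S}. \<forall>s\<in>{0..S}. ?g x \<le> ?g s"
    using S by (intro continuous_attains_inf continuous_intros) auto
  then obtain x where x: "x \<in> {0..S}" "\<And>s. s \<in> {0..S} \<Longrightarrow> ?g x \<le> ?g s" by blast
  define d where "d = min (?g x) (cmod l / 2)"
  have "?g x > 0" using l x(1) by auto
  then have "d > 0" using l0 by (simp add: d_def)
  have d: "d \<le> ?g s" if s: "s \<ge> 0" for s
  proof (cases "s \<le> S")
    case True
    then show ?thesis using x(2)[of s] s by (simp add: d_def min.coboundedI1)
  next
    case False
    have "Re a * S < exp (Re a * s)"
      using False a exp_ge_add_one_self[of "Re a * s"] mult_strict_left_mono[of S s "Re a"] by linarith
    moreover have "Re a * S = 2 / cmod l" using a by (simp add: S_def)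
    ultimately have "2 / cmod l < exp (Re a * s)" by simp
    then have "exp (- (Re a * s)) < cmod l / 2"
      using l0 by (simp add: exp_minus field_simps)
    then have "cmod (exp (- a * of_real s)) < cmod l / 2" by simp
    then have "cmod l / 2 \<le> ?g s"
      using norm_triangle_ineq2[of l "exp (- a * of_real s)"] by (simp add: norm_minus_commute)
    then show ?thesis by (simp add: d_def min.coboundedI2)
  qed
  have "d \<le> cmod (exp (- a * of_real s) - l * exp (a * of_real \<tau>))" if st: "s \<ge> 0" "\<tau> \<ge> 0" for s \<tau>
  proof -
    have e: "exp (- a * of_real s) - l * exp (a * of_real \<tau>) = exp (a * of_real \<tau>) * (exp (- a * of_real (s + \<tau>)) - l)"
      by (simp add: right_diff_distrib mult_exp_exp algebra_simps)
    have "1 * d \<le> exp (Re a * \<tau>) * ?g (s + \<tau>)"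
      using d[of "s + \<tau>"] st a \<open>d > 0\<close> by (intro mult_mono) auto
    then show ?thesis unfolding e norm_mult by simp
  qed
  then show ?thesis using that \<open>d > 0\<close> by blast
qed

section \<open>Restriction to smaller half-planes and rescaling\<close>

lemma composition_operator_cong:
  assumes "\<And>z. z \<in> ball 0 1 \<Longrightarrow> \<phi> z = \<psi> z"
  shows "composition_operator \<phi> = composition_operator \<psi>"
  using assms by (auto simp: fun_eq_iff composition_operator_def intro!: arg_cong[where f = Hardy2])

lemma composition_operator_compose:
  assumes "disc_selfmap \<phi>" "disc_selfmap \<psi>"
  shows "composition_operator (\<lambda>z. \<phi> (\<psi> z)) f = composition_operator \<psi> (composition_operator \<phi> f)"
proof (rule hardy2_eqI)
  fix z :: complex assume z: "z \<in> ball 0 1"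
  then have "\<psi> z \<in> ball 0 1" using assms(2) by (auto simp: disc_selfmap_def image_subset_iff)
  then show "hardy2_fun (composition_operator (\<lambda>z. \<phi> (\<psi> z)) f) z =
    hardy2_fun (composition_operator \<psi> (composition_operator \<phi> f)) z"
    using z by (simp only: hardy2_fun_composition assms disc_selfmap_compose)
qed

text \<open>In the half-plane coordinate, \<open>horo r\<close> is the affine bijection from \<open>Re > 1\<close> to \<open>Re > 1 / r\<close>, so it maps
  the disc onto a disc internally tangent at \<open>1\<close>.\<close>

definition horo :: "real \<Rightarrow> complex \<Rightarrow> complex" where "horo r z = 1 - of_real r * (1 - z)"

lemma horo_in_disc:
  assumes "0 < r" "r \<le> 1" "z \<in> ball 0 1" shows "horo r z \<in> ball 0 1"
proof -
  have "horo r z = of_real (1 - r) + of_real r * z" by (simp add: horo_def algebra_simps)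
  moreover have "cmod (of_real (1 - r)) = 1 - r" using assms by (simp only: norm_of_real)
  ultimately have "cmod (horo r z) \<le> (1 - r) + r * cmod z"
    using norm_triangle_ineq[of "of_real (1 - r)" "of_real r * z"] assms by (simp add: norm_mult del: of_real_diff)
  also have "\<dots> < (1 - r) + r * 1" using assms by (intro add_strict_left_mono mult_strict_left_mono) auto
  finally show ?thesis by simp
qed

lemma disc_selfmap_horo: "0 < r \<Longrightarrow> r \<le> 1 \<Longrightarrow> disc_selfmap (horo r)"
  using horo_in_disc by (auto simp: disc_selfmap_def horo_def[abs_def] intro!: holomorphic_intros)

lemma horo_horo: "horo r (horo s z) = horo (r * s) z"
  by (simp add: horo_def)

text \<open>Here \<open>u\<close> is the increment of the selfmap in the coordinate V = 2 / (1 - z),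
  and \<open>u_near\<close> is the expansion a + O(1 / V), as |1 - z| = 2 / |V|. The gain \<delta>
  lets the restriction to a smaller half-plane be repeated.\<close>

locale parabolic_map =
  fixes u :: "complex \<Rightarrow> complex" and a :: complex and \<delta> C :: real
  assumes u_hol: "u holomorphic_on ball 0 1" and \<delta>: "\<delta> > 0" and a: "Re a > 0" and C: "C \<ge> 0"
    and u_Re: "\<And>z. z \<in> ball 0 1 \<Longrightarrow> \<delta> \<le> Re (u z)"
    and u_near: "\<And>z. z \<in> ball 0 1 \<Longrightarrow> cmod (u z - a) \<le> C * cmod (1 - z)"
begin

text \<open>The increment of the rescaled map taking V to r \<Psi>(V / r), where \<Psi> is the
  selfmap in the half-plane coordinate; \<open>horo r\<close> is division of V by
  \<open>r\<close>.\<close>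

definition scaled :: "real \<Rightarrow> complex \<Rightarrow> complex" where "scaled r z = of_real r * u (horo r z)"

lemma scaled_hol:
  assumes "0 < r" "r \<le> 1" shows "scaled r holomorphic_on ball 0 1"
proof -
  have "(u \<circ> horo r) holomorphic_on ball 0 1"
    using disc_selfmap_horo[OF assms] by (intro holomorphic_on_compose_gen[OF _ u_hol]) (auto simp: disc_selfmap_def)
  then show ?thesis unfolding scaled_def[abs_def] o_def by (intro holomorphic_intros)
qed

lemma scaled_Re:
  assumes "0 < r" "r \<le> 1" "z \<in> ball 0 1" shows "r * \<delta> \<le> Re (scaled r z)"
  using u_Re[OF horo_in_disc[OF assms]] assms(1) by (simp add: scaled_def)

lemma scaled_Re_nonneg:
  assumes "0 < r" "r \<le> 1" "z \<in> ball 0 1" shows "0 \<le> Re (scaled r z)"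
  using scaled_Re[OF assms] \<delta> assms(1) by (smt (verit) mult_pos_pos)

definition \<Phi> :: "real \<Rightarrow> complex \<Rightarrow> complex" where "\<Phi> r = hp_shift (scaled r)"

lemma disc_selfmap_\<Phi>: "0 < r \<Longrightarrow> r \<le> 1 \<Longrightarrow> disc_selfmap (\<Phi> r)"
  unfolding \<Phi>_def by (intro disc_selfmap_hp_shift scaled_hol scaled_Re_nonneg)

lemma \<Phi>_coord:
  assumes "0 < r" "r \<le> 1" "z \<in> ball 0 1"
  shows "2 / (1 - \<Phi> r z) = 2 / (1 - z) + scaled r z" "\<Phi> r z \<noteq> 1"
  using hp_shift_coord[of z "scaled r"] hp_shift_neq_1[of z "scaled r"] scaled_Re_nonneg[OF assms] assms(3)
  by (auto simp: \<Phi>_def)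

text \<open>The image of \<open>\<Phi> r\<close> lies in Re V > 1 + r \<delta> = 1 / s, the range of
  \<open>horo s\<close>. So \<open>\<Phi> r\<close> is \<open>horo s\<close> after some \<psi>,
  while \<psi> after \<open>horo s\<close> is \<open>\<Phi> (r * s)\<close>: the two composition
  operators are products of the same factors in opposite order.\<close>

lemma spectrum_scaling_step:
  assumes r: "0 < r" "r \<le> 1" and l: "l \<noteq> 0" "l \<notin> spectrum (composition_operator (\<Phi> (r / (1 + r * \<delta>))))"
  shows "l \<notin> spectrum (composition_operator (\<Phi> r))"
proof -
  define s where "s = 1 / (1 + r * \<delta>)"
  have pos: "1 + r * \<delta> > 1" using r \<delta> by simp
  then have s: "0 < s" "s \<le> 1" by (auto simp: s_def)
  have rs: "r / (1 + r * \<delta>) = r * s" by (simp add: s_def)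
  have rs': "0 < r * s" "r * s \<le> 1" using r s by (auto simp: mult_le_one)
  define \<psi> where "\<psi> z = 1 - (1 - \<Phi> r z) / of_real s" for z
  have \<psi>1: "\<psi> z \<noteq> 1" "2 / (1 - \<psi> z) = of_real s * (2 / (1 - \<Phi> r z))" if "z \<in> ball 0 1" for z
    using \<Phi>_coord(2)[OF r that] s by (auto simp: \<psi>_def)
  have \<psi>: "disc_selfmap \<psi>" unfolding disc_selfmap_def
  proof
    show "\<psi> holomorphic_on ball 0 1" unfolding \<psi>_def
      using disc_selfmap_\<Phi>[OF r] s by (intro holomorphic_intros) (auto simp: disc_selfmap_def)
    show "\<psi> ` ball 0 1 \<subseteq> ball 0 1"
    proof (clarify)
      fix z :: complex assume z: "z \<in> ball 0 1"
      have z1: "z \<noteq> 1" using z by auto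
      have "Re (2 / (1 - z)) > 1" using cmod_less_1_iff[OF z1] z by simp
      then have "1 + r * \<delta> < Re (2 / (1 - \<Phi> r z))"
        using \<Phi>_coord(1)[OF r z] scaled_Re[OF r z] by simp
      then have "1 < s * Re (2 / (1 - \<Phi> r z))"
        using pos by (simp add: s_def field_simps)
      then have "1 < Re (2 / (1 - \<psi> z))" unfolding \<psi>1(2)[OF z]
        by (simp only: times_complex.sel Re_complex_of_real Im_complex_of_real mult_zero_left diff_zero)
      then show "\<psi> z \<in> ball 0 1" using cmod_less_1_iff[OF \<psi>1(1)[OF z]] by simp
    qed
  qed
  have h: "disc_selfmap (horo s)" by (rule disc_selfmap_horo[OF s])
  have "composition_operator (\<Phi> r) = composition_operator (\<lambda>z. horo s (\<psi> z))"
    by (rule composition_operator_cong) (use s in \<open>auto simp: horo_def \<psi>_def\<close>)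
  then have 1: "composition_operator (\<Phi> r) = (\<lambda>f. composition_operator \<psi> (composition_operator (horo s) f))"
    using composition_operator_compose[OF h \<psi>] by auto
  have "composition_operator (\<Phi> (r * s)) = composition_operator (\<lambda>z. \<psi> (horo s z))"
  proof (rule composition_operator_cong)
    fix z :: complex assume z: "z \<in> ball 0 1"
    note hz = horo_in_disc[OF s z]
    have z1: "1 - z \<noteq> 0" using z by auto
    have "2 / (1 - \<psi> (horo s z)) = of_real s * (2 / (1 - horo s z) + scaled r (horo s z))"
      by (simp only: \<psi>1(2)[OF hz] \<Phi>_coord(1)[OF r hz])
    also have "\<dots> = 2 / (1 - z) + scaled (r * s) z"
    proof -
      have "of_real s * (2 / (1 - horo s z)) = 2 / (1 - z)" using s z1 by (simp add: horo_def)
      moreover have "of_real s * scaled r (horo s z) = scaled (r * s) z"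
        by (simp add: scaled_def horo_horo)
      ultimately show ?thesis by (simp only: distrib_left)
    qed
    also have "\<dots> = 2 / (1 - \<Phi> (r * s) z)" by (simp only: \<Phi>_coord(1)[OF rs' z])
    finally have "1 - \<psi> (horo s z) = 1 - \<Phi> (r * s) z"
      using \<psi>1(1)[OF hz] \<Phi>_coord(2)[OF rs' z] by (simp add: frac_eq_eq)
    then show "\<Phi> (r * s) z = \<psi> (horo s z)" by simp
  qed
  then have 2: "composition_operator (\<Phi> (r * s)) = (\<lambda>f. composition_operator (horo s) (composition_operator \<psi> f))"
    using composition_operator_compose[OF \<psi> h] by auto
  show ?thesis unfolding 1
    by (rule spectrum_comp_swap[OF bounded_clinear_composition[OF \<psi>] bounded_clinear_composition[OF h] l(1)])
      (rule l(2)[unfolded rs 2])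
qed

lemma spectrum_scaled_small:
  assumes l: "l \<notin> {exp (- a * complex_of_real t) |t. t \<ge> 0} \<union> {0}"
  shows "eventually (\<lambda>r. l \<notin> spectrum (composition_operator (\<Phi> r))) (at_right 0)"
proof -
  obtain d where d: "d > 0"
    "\<And>s \<tau>. s \<ge> 0 \<Longrightarrow> \<tau> \<ge> 0 \<Longrightarrow> d \<le> cmod (exp (- a * of_real s) - l * exp (a * of_real \<tau>))"
    using exp_spiral_distance[OF a l] by blast
  \<comment> \<open>The offset from b = r a is at most 2 C r^2; equating this with q Re b / 2, where
    Re b = r Re a, gives \<open>q\<close>.\<close>
  define q where "q r = 4 * C * r / Re a" for r
  define E where "E r = (1 + 2 * (r * cmod a)) * (q r / (1 - q r)) + 2 * (r * cmod a)" for r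
  have q0: "(q \<longlongrightarrow> 4 * C * 0 / Re a) (at_right 0)"
    unfolding q_def[abs_def] using a by (intro tendsto_intros) auto
  have "(E \<longlongrightarrow> (1 + 2 * (0 * cmod a)) * ((4 * C * 0 / Re a) / (1 - 4 * C * 0 / Re a)) + 2 * (0 * cmod a)) (at_right 0)"
    unfolding E_def[abs_def] by (intro tendsto_intros q0) auto
  then have "eventually (\<lambda>r. E r < d / 2) (at_right 0)"
    using d(1) by (intro order_tendstoD(2)) auto
  moreover have "eventually (\<lambda>r. q r < 1) (at_right 0)"
    using q0 by (intro order_tendstoD(2)) auto
  moreover have "eventually (\<lambda>r. r < 1) (at_right (0::real))" "eventually (\<lambda>r. 0 < r) (at_right (0::real))"
    by (auto simp: eventually_at_right_field intro: exI[of _ 1])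
  ultimately show ?thesis
  proof eventually_elim
    case (elim r)
    then have r: "0 < r" "r \<le> 1" by auto
    let ?b = "of_real r * a" and ?\<eta> = "\<lambda>z. of_real r * (u (horo r z) - a)"
    let ?T = "composition_operator (\<Phi> r)"
    have T: "bounded_clinear ?T" by (intro bounded_clinear_composition disc_selfmap_\<Phi> r)
    have \<Phi>_eq: "\<Phi> r = hp_shift (\<lambda>z. ?b + ?\<eta> z)"
      by (simp add: \<Phi>_def scaled_def[abs_def] algebra_simps)
    have bRe: "Re ?b > 0" using r a by simp
    have near: "norm (?T f - hp_translation ?b f) \<le> E r * norm f" for f
    proof -
      have "norm (?T f - hp_translation ?b f) \<le> ((1 + 2 * cmod ?b) * (q r / (1 - q r)) + 2 * cmod ?b) * norm f"
        unfolding \<Phi>_eq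
      proof (rule composition_near_translation[OF bRe])
        have "(\<lambda>z. scaled r z - ?b) holomorphic_on ball 0 1" by (intro holomorphic_intros scaled_hol r)
        then show "?\<eta> holomorphic_on ball 0 1" by (simp add: scaled_def[abs_def] right_diff_distrib)
        show "0 \<le> q r" "q r < 1" using elim r C a by (auto simp: q_def)
        fix z :: complex assume z: "z \<in> ball 0 1"
        have "cmod (1 - z) \<le> 2" using norm_triangle_ineq4[of 1 z] z by simp
        then have "C * (r * cmod (1 - z)) \<le> C * (r * 2)" using C r by (intro mult_left_mono) auto
        moreover have "cmod (u (horo r z) - a) \<le> C * (r * cmod (1 - z))"
          using u_near[OF horo_in_disc[OF r z]] r by (simp add: horo_def norm_mult)
        ultimately have "r * cmod (u (horo r z) - a) \<le> r * (C * (r * 2))"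
          using r by (intro mult_left_mono) auto
        then show "cmod (?\<eta> z) \<le> q r * Re ?b / 2"
          using r a by (simp add: norm_mult q_def)
      qed
      then show ?thesis using r by (simp add: E_def norm_mult)
    qed
    \<comment> \<open>Half of \<open>d\<close> absorbs the perturbation. All points of the ray are
      covered, since surjectivity is propagated along it.\<close>
    have below: "d / 2 * norm f \<le> norm (?T f - (l * exp (a * of_real \<tau>)) *\<^sub>C f)" if \<tau>: "\<tau> \<ge> 0" for \<tau> f
    proof -
      let ?l = "l * exp (a * of_real \<tau>)"
      have "d * norm f \<le> norm (hp_translation ?b f - ?l *\<^sub>C f)"
      proof (rule hp_translation_bounded_below)
        fix s :: real assume "s \<ge> 0"
        then show "d \<le> cmod (exp (- ?b * of_real s) - ?l)" using d(2)[of "r * s" \<tau>] \<tau> r by (simp add: mult_ac)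
      qed (use bRe d in auto)
      also have "hp_translation ?b f - ?l *\<^sub>C f = (?T f - ?l *\<^sub>C f) - (?T f - hp_translation ?b f)" by simp
      also have "norm \<dots> \<le> norm (?T f - ?l *\<^sub>C f) + norm (?T f - hp_translation ?b f)" by (rule norm_triangle_ineq4)
      also have "norm (?T f - hp_translation ?b f) \<le> d / 2 * norm f"
        using near[of f] elim(1) by (meson less_imp_le mult_right_mono norm_ge_zero order_trans)
      finally show ?thesis by simp
    qed
    show "l \<notin> spectrum ?T"
    proof (rule not_in_spectrumI[OF T])
      show "d / 2 > 0" using d by simp
      show "d / 2 * norm f \<le> norm (?T f - l *\<^sub>C f)" for f using below[of 0 f] by simp
      show "surj (\<lambda>f. ?T f - l *\<^sub>C f)"
        by (rule surj_along_ray[OF T _ a _ below]) (use l d in auto)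
    qed
  qed
qed

theorem spectrum_subset:
  "spectrum (composition_operator (hp_shift u)) \<subseteq> {exp (- a * complex_of_real t) |t. t \<ge> 0} \<union> {0}"
proof (rule ccontr)
  assume "\<not> ?thesis"
  then obtain l where l: "l \<in> spectrum (composition_operator (hp_shift u))"
    "l \<notin> {exp (- a * complex_of_real t) |t. t \<ge> 0} \<union> {0}" by blast
  \<comment> \<open>These radii start at \<open>r 0 = 1\<close>, and passing from one to the next is
    exactly one scaling step.\<close>
  define r where "r n = 1 / (1 + real n * \<delta>)" for n
  have r: "0 < r n" "r n \<le> 1" for n using \<delta> by (auto simp: r_def add_pos_nonneg)
  have "r \<longlonglongrightarrow> 0"
  proof -
    have "filterlim (\<lambda>n. 1 + real n * \<delta>) at_top sequentially"
      using \<delta> by (intro filterlim_tendsto_add_at_top[OF tendsto_const]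
        filterlim_at_top_mult_tendsto_pos[OF tendsto_const] filterlim_real_sequentially) auto
    then show ?thesis unfolding r_def[abs_def]
      by (intro tendsto_divide_0[OF tendsto_const] filterlim_at_top_imp_at_infinity)
  qed
  then have "filterlim r (at_right 0) sequentially"
    using r(1) by (auto simp: filterlim_at intro!: always_eventually) (metis less_irrefl)
  then have "eventually (\<lambda>n. l \<notin> spectrum (composition_operator (\<Phi> (r n)))) sequentially"
    using spectrum_scaled_small[OF l(2)] by (auto simp: filterlim_iff)
  then obtain n where n: "l \<notin> spectrum (composition_operator (\<Phi> (r n)))"
    by (auto simp: eventually_sequentially)
  \<comment> \<open>Climbing back from a small radius \<open>r n\<close> to \<open>r 0\<close>, one
    swap per step.\<close>
  have "l \<notin> spectrum (composition_operator (\<Phi> (r (n - k))))" if "k \<le> n" for k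
    using that
  proof (induction k)
    case (Suc k)
    then have "n - k = Suc (n - Suc k)" by simp
    moreover have "r (Suc m) = r m / (1 + r m * \<delta>)" for m
    proof -
      have "1 + real m * \<delta> > 0" using \<delta> by (simp add: add_pos_nonneg)
      then have "1 + r m * \<delta> = (1 + real (Suc m) * \<delta>) / (1 + real m * \<delta>)"
        by (simp add: r_def field_simps)
      then show ?thesis using \<open>1 + real m * \<delta> > 0\<close> by (simp add: r_def)
    qed
    ultimately have "l \<notin> spectrum (composition_operator (\<Phi> (r (n - Suc k) / (1 + r (n - Suc k) * \<delta>))))"
      using Suc by simp
    moreover have "l \<noteq> 0" using l(2) by auto
    ultimately show ?case using spectrum_scaling_step[OF r(1) r(2)] by blast
  qed (use n in simp)
  from this[of n] have "l \<notin> spectrum (composition_operator (\<Phi> 1))" by (simp add: r_def)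
  moreover have "\<Phi> 1 = hp_shift u" by (simp add: \<Phi>_def scaled_def[abs_def] horo_def)
  ultimately show False using l by simp
qed

end

section \<open>Fredholm operators and pointwise null sequences\<close>

text \<open>The open mapping theorem onto a closed range, in quantitative form. Baire is applied to
  the subspace topology of the range, which is completely metrizable because the range is
  closed.\<close>

lemma open_mapping_bound:
  fixes T :: "'a::banach \<Rightarrow> 'b::banach"
  assumes T: "bounded_linear T" and closed: "closed (range T)"
  obtains M where "M \<ge> 0" "\<And>y. y \<in> range T \<Longrightarrow> \<exists>x. T x = y \<and> norm x \<le> M * norm y"
proof -
  interpret bounded_linear T by fact
  let ?Y = "range T"
  let ?X = "top_of_set ?Y"
  define R where "R n = T ` ball 0 (real (Suc n))" for n
  have cm: "completely_metrizable_space ?X"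
    by (rule completely_metrizable_space_closedin[OF completely_metrizable_space_euclidean closed[unfolded closed_closedin]])
  have RY: "closure (R n) \<subseteq> ?Y" for n
    by (rule closure_minimal[OF _ closed]) (auto simp: R_def)
  have "\<exists>n. ?X interior_of (closure (R n)) \<noteq> {}"
  proof (rule ccontr)
    assume "\<not> ?thesis"
    then have "?X interior_of \<Union> (range (\<lambda>n. closure (R n))) = {}"
    proof (intro Baire_category_alt disjI1 cm)
      fix A assume "A \<in> range (\<lambda>n. closure (R n))"
      then obtain n where "A = closure (R n)" by blast
      then show "closedin ?X A \<and> ?X interior_of A = {}"
        using \<open>\<not> (\<exists>n. ?X interior_of (closure (R n)) \<noteq> {})\<close> closed_subset[OF RY[of n] closed_closure] by simp
    qed simp
    moreover have "\<Union> (range (\<lambda>n. closure (R n))) = topspace ?X"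
    proof -
      have "T x \<in> (\<Union>n. closure (R n))" for x
      proof -
        obtain n where "norm x < real n" using reals_Archimedean2 by blast
        then have "T x \<in> R n" by (auto simp: R_def)
        then show ?thesis using closure_subset[of "R n"] by blast
      qed
      then show ?thesis using RY by auto
    qed
    ultimately have "?Y = {}" by (metis interior_of_topspace topspace_euclidean_subtopology)
    then show False by simp
  qed
  then obtain n y0 where "y0 \<in> ?X interior_of (closure (R n))" by blast
  then obtain U where U: "open U" "y0 \<in> U" "y0 \<in> ?Y" "?Y \<inter> U \<subseteq> closure (R n)"
    unfolding interior_of_def openin_open by blast
  obtain e where e: "e > 0" "ball y0 e \<subseteq> U" using U openE by blast
  \<comment> \<open>The multiple c y with c = e / (2 |y|) is approximated by the image of a vector
    of norm at most 2 (n + 1); dividing that vector by c gives K |y|.\<close>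
  define K where "K = 4 * real (Suc n) / e"
  have K: "K > 0" using e by (simp add: K_def)
  have approx: "\<exists>x. norm x \<le> K * norm y \<and> norm (y - T x) \<le> norm y / 2" if y: "y \<in> ?Y" for y
  proof (cases "y = 0")
    case True
    then show ?thesis by (intro exI[of _ 0]) (simp add: zero)
  next
    case False
    define c where "c = e / (2 * norm y)"
    have c: "c > 0" using e False by (simp add: c_def)
    have "c *\<^sub>R y \<in> ?Y" using y scaleR by (metis rangeE rangeI)
    then have "y0 + c *\<^sub>R y \<in> ?Y" using U(3) add by (metis (no_types, lifting) rangeE rangeI)
    moreover have "y0 + c *\<^sub>R y \<in> ball y0 e" using e False by (simp add: dist_norm c_def)
    ultimately have 1: "y0 + c *\<^sub>R y \<in> closure (R n)" using U e by blast
    have 2: "y0 \<in> closure (R n)" using U by blast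
    define \<eta> where "\<eta> = c * norm y / 4"
    have \<eta>: "\<eta> > 0" using c False by (simp add: \<eta>_def)
    obtain p where p: "norm p < real (Suc n)" "dist (T p) (y0 + c *\<^sub>R y) < \<eta>"
      using 1 \<eta> unfolding closure_approachable R_def by (metis imageE mem_ball_0)
    obtain q where q: "norm q < real (Suc n)" "dist (T q) y0 < \<eta>"
      using 2 \<eta> unfolding closure_approachable R_def by (metis imageE mem_ball_0)
    have "norm (c *\<^sub>R y - T (p - q)) = norm ((T q - y0) - (T p - (y0 + c *\<^sub>R y)))" 
      by (simp add: diff algebra_simps)
    also have "\<dots> \<le> \<eta> + \<eta>"
      using p(2) q(2) norm_triangle_ineq4[of "T q - y0" "T p - (y0 + c *\<^sub>R y)"] by (simp add: dist_norm)
    finally have "norm (c *\<^sub>R y - T (p - q)) \<le> c * norm y / 2" by (simp add: \<eta>_def)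
    moreover have "c *\<^sub>R y - T (p - q) = c *\<^sub>R (y - T ((1 / c) *\<^sub>R (p - q)))"
    proof -
      have "c *\<^sub>R T ((1 / c) *\<^sub>R (p - q)) = T (p - q)" using c by (subst scaleR) simp
      then show ?thesis by (simp only: scaleR_right_diff_distrib[of c y])
    qed
    ultimately have "norm (c *\<^sub>R (y - T ((1 / c) *\<^sub>R (p - q)))) \<le> c * norm y / 2" by simp
    then have A: "norm (y - T ((1 / c) *\<^sub>R (p - q))) \<le> norm y / 2"
      using c by simp
    have "norm (p - q) \<le> 2 * real (Suc n)"
      using order_trans[OF norm_triangle_ineq4 add_mono[OF less_imp_le[OF p(1)] less_imp_le[OF q(1)]]]
      by (simp only: mult_2)
    then have "norm ((1 / c) *\<^sub>R (p - q)) \<le> (1 / c) * (2 * real (Suc n))"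
      using c by (simp add: divide_right_mono)
    also have "\<dots> = K * norm y" using e False by (simp add: c_def K_def)
    finally show ?thesis using A by blast
  qed
  then obtain g where g: "\<And>y. y \<in> ?Y \<Longrightarrow> norm (g y) \<le> K * norm y" "\<And>y. y \<in> ?Y \<Longrightarrow> norm (y - T (g y)) \<le> norm y / 2"
    by metis
  have "\<exists>x. T x = y \<and> norm x \<le> (2 * K) * norm y" if y: "y \<in> ?Y" for y
  proof -
    \<comment> \<open>Iterated residuals: each has at most half the previous bound, so the
      corrections sum to an exact preimage with constant 2 K.\<close>
    define r where "r k = ((\<lambda>y. y - T (g y)) ^^ k) y" for k
    have r_Suc: "r (Suc k) = r k - T (g (r k))" for k by (simp add: r_def)
    have rY: "r k \<in> ?Y" for k
    proof (induction k)
      case (Suc k)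
      then show ?case unfolding r_Suc by (metis diff rangeE rangeI)
    qed (use y in \<open>simp add: r_def\<close>)
    have r_le: "norm (r k) \<le> norm y * (1 / 2) ^ k" for k
    proof (induction k)
      case (Suc k)
      then show ?case using g(2)[OF rY[of k]] by (simp add: r_Suc)
    qed (simp add: r_def)
    have gr: "norm (g (r k)) \<le> K * norm y * (1 / 2) ^ k" for k
      using order_trans[OF g(1)[OF rY[of k]] mult_left_mono[OF r_le[of k] less_imp_le[OF K]]]
      by (simp only: mult.assoc)
    have sb: "summable (\<lambda>k. K * norm y * (1 / 2) ^ k)" by (intro summable_mult summable_geometric) simp
    have sg: "summable (\<lambda>k. g (r k))" by (rule summable_comparison_test'[OF sb, of 0]) (use gr in auto)
    have "(\<lambda>k. norm y * (1 / 2) ^ k) \<longlonglongrightarrow> 0" by (intro tendsto_mult_right_zero LIMSEQ_power_zero) simp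
    then have "r \<longlonglongrightarrow> 0" using r_le by (intro Lim_null_comparison[of r "\<lambda>k. norm y * (1 / 2) ^ k"]) auto
    then have "(\<lambda>k. r k - r (Suc k)) sums (r 0 - 0)" by (rule telescope_sums')
    then have "(\<lambda>k. T (g (r k))) sums y" by (simp add: r_Suc) (simp add: r_def)
    moreover have "(\<lambda>k. T (g (r k))) sums T (\<Sum>k. g (r k))" by (rule sums[OF summable_sums[OF sg]])
    ultimately have "T (\<Sum>k. g (r k)) = y" by (metis sums_unique2)
    moreover have "norm (\<Sum>k. g (r k)) \<le> (\<Sum>k. K * norm y * (1 / 2) ^ k)"
      by (rule norm_suminf_le[OF gr sb])
    moreover have "(\<Sum>k. K * norm y * (1 / 2) ^ k) = (2 * K) * norm y"
      by (simp add: suminf_mult suminf_geometric)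
    ultimately show ?thesis by (intro exI[of _ "\<Sum>k. g (r k)"]) simp
  qed
  then show ?thesis using that[of "2 * K"] K by simp
qed

text \<open>On a finite-dimensional space of functions pointwise convergence implies norm convergence.\<close>

lemma pointwise_projection:
  fixes B :: "hardy2 set"
  assumes "finite B"
  shows "\<exists>L. (\<forall>u v. L (u + v) = L u + L v) \<and> (\<forall>c u. L (c *\<^sub>C u) = c *\<^sub>C L u) \<and>
    (\<forall>u\<in>cvec.span B. L u = u) \<and>
    (\<forall>X. (\<forall>z\<in>ball 0 1. (\<lambda>n. hardy2_fun (X n) z) \<longlonglongrightarrow> 0) \<longrightarrow> (\<lambda>n. L (X n)) \<longlonglongrightarrow> 0)"
  using assms
proof (induction B)
  case empty
  show ?case by (rule exI[of _ "\<lambda>_. 0"]) auto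
next
  case (insert b B)
  then obtain L where L: "\<And>u v. L (u + v) = L u + L v" "\<And>c u. L (c *\<^sub>C u) = c *\<^sub>C L u"
    "\<And>u. u \<in> cvec.span B \<Longrightarrow> L u = u"
    "\<And>X. (\<And>z. z \<in> ball 0 1 \<Longrightarrow> (\<lambda>n. hardy2_fun (X n) z) \<longlonglongrightarrow> 0) \<Longrightarrow> (\<lambda>n. L (X n)) \<longlonglongrightarrow> 0"
    by blast
  \<comment> \<open>The part of \<open>b\<close> that \<open>L\<close> misses; if it vanishes,
    \<open>L\<close> already fixes the larger span.\<close>
  define r where "r = b - L b"
  have span: "\<exists>t v. v \<in> cvec.span B \<and> u = t *\<^sub>C b + v \<and> L u = u - t *\<^sub>C r" if u: "u \<in> cvec.span (insert b B)" for u
  proof -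
    obtain t where t: "u - t *\<^sub>C b \<in> cvec.span B" using u cvec.span_breakdown_eq[of u b B] by blast
    let ?v = "u - t *\<^sub>C b"
    have "L u = L (t *\<^sub>C b + ?v)" by simp
    also have "\<dots> = t *\<^sub>C L b + ?v" by (simp only: L(1,2) L(3)[OF t])
    finally have "L u = u - t *\<^sub>C r" by (simp add: r_def cvec.scale_right_diff_distrib)
    then show ?thesis using t by (intro exI[of _ t] exI[of _ ?v]) simp
  qed
  show ?case
  proof (cases "r = 0")
    case True
    then have "L u = u" if "u \<in> cvec.span (insert b B)" for u using span[OF that] by auto
    then show ?thesis using L by (intro exI[of _ L]) blast
  next
    case False
    then obtain z0 where z0: "z0 \<in> ball 0 1" "hardy2_fun r z0 \<noteq> 0"
      using hardy2_eqI[of r 0] by (auto simp: zero_hardy2.rep_eq)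
    \<comment> \<open>Evaluation at a point where \<open>r\<close> does not vanish, normalised at
      \<open>r\<close>. It respects pointwise convergence and reads off the multiple of
      \<open>r\<close> by which \<open>L u\<close> falls short of \<open>u\<close>.\<close>
    define ev where "ev f = hardy2_fun f z0 / hardy2_fun r z0" for f
    have ev: "ev (f + g) = ev f + ev g" "ev (f - g) = ev f - ev g" "ev (c *\<^sub>C f) = c * ev f" for f g c
      by (simp_all add: ev_def plus_hardy2.rep_eq minus_hardy2.rep_eq scaleC_hardy2.rep_eq add_divide_distrib diff_divide_distrib)
    have ev_r: "ev r = 1" using z0 by (simp add: ev_def)
    define L' where "L' u = L u + ev (u - L u) *\<^sub>C r" for u
    have "L' (u + v) = L' u + L' v" for u v
      by (simp add: L'_def L ev cvec.scale_left_distrib cvec.scale_left_diff_distrib)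
    moreover have "L' (c *\<^sub>C u) = c *\<^sub>C L' u" for c u
      by (simp add: L'_def L ev cvec.scale_right_distrib cvec.scale_left_diff_distrib cvec.scale_right_diff_distrib)
    moreover have "L' u = u" if u: "u \<in> cvec.span (insert b B)" for u
    proof -
      obtain t where "L u = u - t *\<^sub>C r" using span[OF u] by blast
      then show ?thesis by (simp add: L'_def ev ev_r)
    qed
    moreover have "(\<lambda>n. L' (X n)) \<longlonglongrightarrow> 0" if X: "\<And>z. z \<in> ball 0 1 \<Longrightarrow> (\<lambda>n. hardy2_fun (X n) z) \<longlonglongrightarrow> 0" for X
    proof -
      have LX: "(\<lambda>n. L (X n)) \<longlonglongrightarrow> 0" by (rule L(4)[OF X])
      then have "(\<lambda>n. hardy2_fun (L (X n)) z0) \<longlonglongrightarrow> hardy2_fun 0 z0"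
        using z0 by (intro hardy2_eval_tendsto) auto
      then have "(\<lambda>n. hardy2_fun (X n) z0 / hardy2_fun r z0 - hardy2_fun (L (X n)) z0 / hardy2_fun r z0) \<longlonglongrightarrow> 0 / hardy2_fun r z0 - 0 / hardy2_fun r z0"
        using z0 by (intro tendsto_intros X) (auto simp: zero_hardy2.rep_eq)
      then have "(\<lambda>n. ev (X n - L (X n))) \<longlonglongrightarrow> 0" by (simp add: ev) (simp add: ev_def)
      then have "(\<lambda>n. norm (ev (X n - L (X n)) *\<^sub>C r)) \<longlonglongrightarrow> 0"
        unfolding norm_scaleC by (intro tendsto_mult_left_zero tendsto_norm_zero)
      then have "(\<lambda>n. ev (X n - L (X n)) *\<^sub>C r) \<longlonglongrightarrow> 0" by (rule tendsto_norm_zero_cancel)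
      from tendsto_add[OF LX this] show ?thesis by (simp add: L'_def)
    qed
    ultimately show ?thesis by (intro exI[of _ L']) blast
  qed
qed

text \<open>If T - l were Fredholm, its values at \<open>X n\<close> would have preimages tending to
  0. Subtracting these moves \<open>X n\<close> into the finite-dimensional kernel, where pointwise
  convergence to 0 is norm convergence, against the lower bound \<open>c\<close>.\<close>

lemma weyl_essential_spectrum:
  assumes c: "c > 0" "\<And>n. c \<le> norm (X n)"
    and pw: "\<And>z. z \<in> ball 0 1 \<Longrightarrow> (\<lambda>n. hardy2_fun (X n) z) \<longlonglongrightarrow> 0"
    and TX: "(\<lambda>n. T (X n) - l *\<^sub>C X n) \<longlonglongrightarrow> 0"
  shows "l \<in> essential_spectrum T"
proof (rule ccontr)
  let ?D = "\<lambda>x. T x - l *\<^sub>C x"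
  assume "l \<notin> essential_spectrum T"
  then have "fredholm ?D" by (simp add: essential_spectrum_def)
  then obtain B where D: "bounded_clinear ?D" "closed (range ?D)" and B: "finite B" "{x. ?D x = 0} \<subseteq> cvec.span B"
    unfolding fredholm_def by blast
  note D' = bounded_clinear_simps[OF D(1)]
  obtain M where M: "M \<ge> 0" "\<And>y. y \<in> range ?D \<Longrightarrow> \<exists>x. ?D x = y \<and> norm x \<le> M * norm y"
    using open_mapping_bound[OF D'(1) D(2)] by blast
  then have "\<exists>x. ?D x = ?D (X n) \<and> norm x \<le> M * norm (?D (X n))" for n by blast
  then obtain x where x: "\<And>n. ?D (x n) = ?D (X n)" "\<And>n. norm (x n) \<le> M * norm (?D (X n))" by metis
  have "(\<lambda>n. M * norm (?D (X n))) \<longlonglongrightarrow> 0"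
    using TX by (intro tendsto_mult_right_zero tendsto_norm_zero)
  then have x0: "x \<longlonglongrightarrow> 0"
    using x(2) by (intro Lim_null_comparison[of x "\<lambda>n. M * norm (?D (X n))"]) auto
  obtain L where L: "\<And>u. u \<in> cvec.span B \<Longrightarrow> L u = u"
    "\<And>X. (\<And>z. z \<in> ball 0 1 \<Longrightarrow> (\<lambda>n. hardy2_fun (X n) z) \<longlonglongrightarrow> 0) \<Longrightarrow> (\<lambda>n. L (X n)) \<longlonglongrightarrow> 0"
    using pointwise_projection[OF B(1)] by blast
  have ker: "X n - x n \<in> cvec.span B" for n
  proof -
    have "?D (X n - x n) = ?D (X n) - ?D (x n)" by (rule D'(4))
    then show ?thesis using x(1) B(2) by auto
  qed
  have "(\<lambda>n. L (X n - x n)) \<longlonglongrightarrow> 0"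
  proof (rule L(2))
    fix z :: complex assume z: "z \<in> ball 0 1"
    have "(\<lambda>n. hardy2_fun (x n) z) \<longlonglongrightarrow> hardy2_fun 0 z" using z by (intro hardy2_eval_tendsto x0) auto
    from tendsto_diff[OF pw[OF z] this] show "(\<lambda>n. hardy2_fun (X n - x n) z) \<longlonglongrightarrow> 0"
      by (simp add: minus_hardy2.rep_eq zero_hardy2.rep_eq)
  qed
  then have "(\<lambda>n. X n - x n) \<longlonglongrightarrow> 0" by (simp only: L(1)[OF ker])
  from tendsto_add[OF this x0] have "X \<longlonglongrightarrow> 0" by simp
  then have "(\<lambda>n. norm (X n)) \<longlonglongrightarrow> 0" by (rule tendsto_norm_zero)
  then have "c \<le> 0" by (rule LIMSEQ_le_const) (use c in auto)
  then show False using c by simp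
qed

lemma essential_spectrum_subset_spectrum:
  fixes T :: "'a::complex_normed_vector \<Rightarrow> 'a"
  assumes T: "bounded_clinear T" shows "essential_spectrum T \<subseteq> spectrum T"
proof
  fix l assume l: "l \<in> essential_spectrum T"
  show "l \<in> spectrum T"
  proof (rule ccontr)
    assume "l \<notin> spectrum T"
    then obtain S where S: "bounded_clinear S" "\<And>x. S (T x - l *\<^sub>C x) = x" "\<And>x. T (S x) - l *\<^sub>C S x = x"
      unfolding spectrum_def by blast
    have surj: "range (\<lambda>x. T x - l *\<^sub>C x) = UNIV" using S(3) by (metis surjI)
    have inj: "x = 0" if "T x - l *\<^sub>C x = 0" for x
      using S(2)[of x] bounded_clinear_simps(5)[OF S(1)] that by simp
    have "fredholm (\<lambda>x. T x - l *\<^sub>C x)"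
      unfolding fredholm_def surj
    proof (intro conjI bounded_clinear_shift[OF T] closed_UNIV)
      show "\<exists>B. finite B \<and> {x. T x - l *\<^sub>C x = 0} \<subseteq> cvec.span B"
        using inj cvec.span_zero by (intro exI[of _ "{}"]) auto
      show "\<exists>B. finite B \<and> cvec.span (UNIV \<union> B) = UNIV"
        by (intro exI[of _ "{}"]) simp
    qed
    then show False using l by (simp add: essential_spectrum_def)
  qed
qed

section \<open>Approximate eigenvectors\<close>

lemma circle_mean_square_le:
  assumes le: "\<And>z. cmod z = r \<Longrightarrow> (cmod (f z))\<^sup>2 \<le> (cmod (g z))\<^sup>2 + e" and r: "r \<ge> 0" and m: "m > 0"
  shows "(circle_mean m r f)\<^sup>2 \<le> (circle_mean m r g)\<^sup>2 + e"
proof -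
  let ?z = "\<lambda>j. of_real r * cis (2 * pi * real j / real m)"
  have sq: "(circle_mean m r h)\<^sup>2 = (\<Sum>j<m. (cmod (h (?z j)))\<^sup>2) / real m" for h
    by (simp add: circle_mean_def L2_set_def power_divide sum_nonneg)
  have "(\<Sum>j<m. (cmod (f (?z j)))\<^sup>2) \<le> (\<Sum>j<m. (cmod (g (?z j)))\<^sup>2 + e)"
    using r by (intro sum_mono le) (simp add: norm_mult)
  also have "\<dots> = (\<Sum>j<m. (cmod (g (?z j)))\<^sup>2) + real m * e" by (simp add: sum.distrib)
  finally show ?thesis unfolding sq using m by (simp add: field_simps)
qed

text \<open>The right-hand side is the Poisson kernel with pole at 1; it governs both the modulus of
  the singular inner function and the half-plane condition near the circle.\<close>

lemma hp_coord_minus_1: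
  assumes "z \<noteq> 1" shows "Re (2 / (1 - z)) - 1 = (1 - (cmod z)\<^sup>2) / (cmod (1 - z))\<^sup>2"
proof -
  have pos: "(cmod (1 - z))\<^sup>2 > 0" using assms by simp
  have "Re (2 / (1 - z)) = 2 * (1 - Re z) / (cmod (1 - z))\<^sup>2"
    unfolding cmod_power2 Re_divide by simp
  then have "Re (2 / (1 - z)) - 1 = (2 * (1 - Re z) - (cmod (1 - z))\<^sup>2) / (cmod (1 - z))\<^sup>2"
    using pos by (simp add: diff_divide_distrib)
  also have "2 * (1 - Re z) - (cmod (1 - z))\<^sup>2 = 1 - (cmod z)\<^sup>2"
    unfolding cmod_power2 by (simp add: power2_eq_square algebra_simps)
  finally show ?thesis .
qed

text \<open>The singular inner function \<open>exp (- t (V - 1))\<close>, \<open>V = 2 / (1 - z)\<close>, has radial limits of modulus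
  one away from \<open>1\<close>, and the decay of \<open>k\<close> at \<open>1\<close> makes the exceptional point harmless.\<close>

lemma hardy_le_inner_cancel:
  assumes k: "k holomorphic_on ball 0 1" and t: "t \<ge> 0"
    and B: "\<And>z. z \<in> ball 0 1 \<Longrightarrow> cmod (k z) \<le> B * cmod (1 - z)"
    and F: "hardy_le (\<lambda>z. exp (- of_real t * (2 / (1 - z) - 1)) * k z) M"
  shows "hardy_le k M"
proof (rule hardy_leI_limit[OF k])
  let ?F = "\<lambda>z. exp (- of_real t * (2 / (1 - z) - 1)) * k z"
  show M: "0 \<le> M" using F by (simp add: hardy_le_def)
  let ?g = "\<lambda>r. sqrt (M\<^sup>2 + 2 * t * (1 - r\<^sup>2) * B\<^sup>2)"
  have "(?g \<longlongrightarrow> sqrt (M\<^sup>2 + 2 * t * (1 - 1\<^sup>2) * B\<^sup>2)) (at_left 1)"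
    by (intro tendsto_intros)
  then show "(?g \<longlongrightarrow> M) (at_left 1)" using M by simp
  fix r :: real assume r: "0 < r" "r < 1"
  have le: "(cmod (k z))\<^sup>2 \<le> (cmod (?F z))\<^sup>2 + 2 * t * (1 - r\<^sup>2) * B\<^sup>2" if z: "cmod z = r" for z
  proof -
    have z1: "z \<noteq> 1" and zb: "z \<in> ball 0 1" using z r by auto
    let ?x = "(1 - r\<^sup>2) / (cmod (1 - z))\<^sup>2"
    have x: "Re (2 / (1 - z)) - 1 = ?x" using hp_coord_minus_1[OF z1] z by simp
    have r2: "0 \<le> 1 - r\<^sup>2" using r by (simp add: power_le_one)
    have "(cmod (?F z))\<^sup>2 = (exp (- (t * ?x)))\<^sup>2 * (cmod (k z))\<^sup>2"
      by (simp add: norm_mult power_mult_distrib flip: x)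
    also have "(exp (- (t * ?x)))\<^sup>2 = exp (- (2 * t * ?x))" by (simp add: power2_eq_square mult_exp_exp)
    finally have "(cmod (?F z))\<^sup>2 = exp (- (2 * t * ?x)) * (cmod (k z))\<^sup>2" .
    \<comment> \<open>By 1 + x \<le> exp x the loss is at most 2 t times the Poisson kernel times
      |k|^2, and the factor |1 - z|^2 in the bound for |k|^2 cancels the denominator of that
      kernel.\<close>
    moreover have "(1 + - (2 * t * ?x)) * (cmod (k z))\<^sup>2 \<le> exp (- (2 * t * ?x)) * (cmod (k z))\<^sup>2"
      by (intro mult_right_mono exp_ge_add_one_self) simp
    ultimately have "(cmod (k z))\<^sup>2 - 2 * t * ?x * (cmod (k z))\<^sup>2 \<le> (cmod (?F z))\<^sup>2"
      by (simp only: distrib_right mult_1 mult_minus_left diff_conv_add_uminus)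
    moreover have "2 * t * ?x * (cmod (k z))\<^sup>2 \<le> 2 * t * ?x * (B * cmod (1 - z))\<^sup>2"
      using B[OF zb] t r2 by (intro mult_left_mono power_mono) auto
    moreover have "2 * t * ?x * (B * cmod (1 - z))\<^sup>2 = 2 * t * (1 - r\<^sup>2) * B\<^sup>2"
      using z1 by (simp add: power_mult_distrib)
    ultimately show ?thesis by linarith
  qed
  define X where "X m = sqrt ((M * (1 + r ^ m / sqrt (1 - r\<^sup>2)))\<^sup>2 + 2 * t * (1 - r\<^sup>2) * B\<^sup>2)" for m
  have "X \<longlonglongrightarrow> ?g r"
    unfolding X_def by (intro tendsto_intros circle_bound_tendsto) (use r in auto)
  moreover have "circle_mean m r k \<le> X m" if m: "m > 0" for m
  proof -
    have "(circle_mean m r k)\<^sup>2 \<le> (circle_mean m r ?F)\<^sup>2 + 2 * t * (1 - r\<^sup>2) * B\<^sup>2"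
      by (rule circle_mean_square_le[OF le]) (use r m in auto)
    also have "(circle_mean m r ?F)\<^sup>2 \<le> (M * (1 + r ^ m / sqrt (1 - r\<^sup>2)))\<^sup>2"
      by (intro power_mono circle_mean_upper[OF F] circle_mean_nonneg) (use r m in auto)
    finally show ?thesis unfolding X_def by (intro real_le_rsqrt) simp
  qed
  ultimately show "\<exists>X. X \<longlonglongrightarrow> ?g r \<and> (\<forall>m>0. circle_mean m r k \<le> X m)" by blast
qed

lemma norm_hker:
  assumes "Re P > 0" shows "(norm (hker P))\<^sup>2 = 1 / (4 * Re P)"
proof -
  have "complex_of_real ((norm (\<Sum>i\<in>{()}. 1 *\<^sub>C hker P))\<^sup>2) = (\<Sum>i\<in>{()}. \<Sum>j\<in>{()}. 1 * cnj 1 / (2 * (P + cnj P)))"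
    by (rule norm_sum_hker) (use assms in auto)
  then have "complex_of_real ((norm (hker P))\<^sup>2) = complex_of_real (1 / (4 * Re P))"
    by (simp add: complex_add_cnj)
  then show ?thesis by (simp only: of_real_eq_iff)
qed

section \<open>Bumps and singular inner functions\<close>

lemma sqrt_shift_at_top: "filterlim (\<lambda>n. sqrt (real n + 2)) at_top sequentially"
proof (rule filterlim_compose[OF sqrt_at_top])
  show "filterlim (\<lambda>n. real n + 2) at_top sequentially"
    using filterlim_tendsto_add_at_top[OF tendsto_const filterlim_real_sequentially, of 2]
    by (simp add: add.commute)
qed

text \<open>On the right half-plane it is of order 1 for |p| near \<open>S\<close> and small for |p|
  far below or far above \<open>S\<close>; the value at p = S is 1/4.\<close>

definition bump :: "real \<Rightarrow> complex \<Rightarrow> complex"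
  where "bump S p = p * of_real S / (p + of_real S)\<^sup>2"

text \<open>In the half-plane |p + S| dominates both \<open>S\<close> and |p|. The last form, v -
  v^2 with v = S / (p + S), is the one suited to differences.\<close>

lemma bump_bounds:
  assumes S: "S > 0" and p: "Re p > 0"
  shows "p + of_real S \<noteq> 0" "cmod (of_real S / (p + of_real S)) \<le> 1" "cmod (p / (p + of_real S)) \<le> 1"
    "cmod (bump S p) \<le> cmod p / S"
    "bump S p = of_real S / (p + of_real S) - (of_real S / (p + of_real S))\<^sup>2"
proof -
  have "S \<le> Re (p + of_real S)" using p by simp
  then have ge: "S \<le> cmod (p + of_real S)" using complex_Re_le_cmod order_trans by blast
  show nz: "p + of_real S \<noteq> 0" using ge S by auto
  show 1: "cmod (of_real S / (p + of_real S)) \<le> 1" using ge S by (simp add: norm_divide divide_le_eq)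
  have "(cmod p)\<^sup>2 \<le> (cmod (p + of_real S))\<^sup>2"
    unfolding cmod_power2 using p S by (simp add: power_mono)
  then have "cmod p \<le> cmod (p + of_real S)" by (rule power2_le_imp_le) simp
  then show "cmod (p / (p + of_real S)) \<le> 1" using nz by (simp add: norm_divide divide_le_eq)
  have e: "bump S p = p / of_real S * (of_real S / (p + of_real S))\<^sup>2"
    using S by (simp add: bump_def power2_eq_square)
  have "cmod (bump S p) \<le> cmod p / S * 1\<^sup>2"
    unfolding e norm_mult norm_power using S 1 by (intro mult_mono power_mono) (auto simp: norm_divide)
  then show "cmod (bump S p) \<le> cmod p / S" by simp
  have "(p + of_real S)\<^sup>2 * bump S p = p * of_real S" using nz by (simp add: bump_def)
  also have "\<dots> = (p + of_real S)\<^sup>2 * (of_real S / (p + of_real S)) - (p + of_real S)\<^sup>2 * (of_real S / (p + of_real S))\<^sup>2"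
  proof -
    have "(p + of_real S)\<^sup>2 * (of_real S / (p + of_real S)) = (p + of_real S) * of_real S"
      using nz by (simp add: power2_eq_square)
    moreover have "(p + of_real S)\<^sup>2 * (of_real S / (p + of_real S))\<^sup>2 = (of_real S)\<^sup>2"
      using nz by (simp add: power_divide)
    ultimately show ?thesis by (simp add: power2_eq_square algebra_simps)
  qed
  finally have "(p + of_real S)\<^sup>2 * bump S p = (p + of_real S)\<^sup>2 * (of_real S / (p + of_real S) - (of_real S / (p + of_real S))\<^sup>2)"
    by (simp only: right_diff_distrib)
  then show "bump S p = of_real S / (p + of_real S) - (of_real S / (p + of_real S))\<^sup>2"
    using nz by (simp only: mult_cancel_left) simp
qed

text \<open>With v and w the values of S / (p + S) at the two points, the difference is (1 - v - w)
  (v - w); the first factor is at most 3 and the second at most |p - q| / S.\<close>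

lemma bump_diff:
  assumes S: "S > 0" and p: "Re p > 0" "Re q > 0"
  shows "cmod (bump S p - bump S q) \<le> 3 * cmod (p - q) / S"
proof -
  define v w where "v = of_real S / (p + of_real S)" and "w = of_real S / (q + of_real S)"
  note b = bump_bounds[OF S p(1)] and c = bump_bounds[OF S p(2)]
  have vw: "cmod v \<le> 1" "cmod w \<le> 1" using b(2) c(2) by (auto simp: v_def w_def)
  have "v - w = v * w * ((q - p) / of_real S)"
    using b(1) c(1) S unfolding v_def w_def by (simp add: diff_frac_eq) (simp add: field_simps)
  then have "cmod (v - w) = cmod v * cmod w * (cmod (p - q) / S)"
    using S by (simp add: norm_mult norm_divide norm_minus_commute)
  also have "\<dots> \<le> 1 * 1 * (cmod (p - q) / S)" using vw S by (intro mult_mono) auto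
  finally have 1: "cmod (v - w) \<le> cmod (p - q) / S" by simp
  have 2: "cmod (1 - v - w) \<le> 3" using norm_triangle_ineq4[of "1 - v" w] norm_triangle_ineq4[of 1 v] vw by simp
  have "bump S p - bump S q = (1 - v - w) * (v - w)"
    unfolding b(5) c(5) v_def[symmetric] w_def[symmetric] by (simp add: power2_eq_square algebra_simps)
  then have "cmod (bump S p - bump S q) = cmod (1 - v - w) * cmod (v - w)" by (simp add: norm_mult)
  also have "\<dots> \<le> 3 * (cmod (p - q) / S)" using 1 2 by (intro mult_mono) auto
  finally show ?thesis by simp
qed

lemma hp_coord_disc:
  assumes "z \<in> ball 0 1"
  shows "Re (2 / (1 - z)) > 1" "cmod (2 / (1 - z)) \<ge> 1" "1 - z \<noteq> 0"
proof -
  have z: "z \<noteq> 1" using assms by auto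
  show *: "Re (2 / (1 - z)) > 1" using cmod_less_1_iff[OF z] assms by simp
  show "cmod (2 / (1 - z)) \<ge> 1" using * complex_Re_le_cmod[of "2 / (1 - z)"] by linarith
  show "1 - z \<noteq> 0" using z by simp
qed

text \<open>exp (- t V) is an eigenfunction of the translation by \<open>a\<close> with eigenvalue
  exp (- a t). Using V - 1 in the exponent makes it inner, and sqrt S keeps the norm of the bump of
  order 1.\<close>

definition weyl :: "real \<Rightarrow> real \<Rightarrow> complex \<Rightarrow> complex"
  where "weyl t S z = exp (- of_real t * (2 / (1 - z) - 1)) * (of_real (sqrt S) * bump S (2 / (1 - z)))"

lemma exp_factor_le_1:
  assumes "t \<ge> 0" "z \<in> ball 0 1" shows "cmod (exp (- of_real t * (2 / (1 - z) - 1))) \<le> 1"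
  using hp_coord_disc(1)[OF assms(2)] assms(1) by simp

lemma bump_hol:
  assumes S: "S > 0" shows "(\<lambda>z. of_real (sqrt S) * bump S (2 / (1 - z))) holomorphic_on ball 0 1"
proof -
  have "2 / (1 - z) + of_real S \<noteq> 0" if "z \<in> ball 0 1" for z :: complex
    using bump_bounds(1)[OF S] hp_coord_disc(1)[OF that] by (meson less_trans zero_less_one)
  then show ?thesis unfolding bump_def
    by (intro holomorphic_intros) (use hp_coord_disc(3) in auto)
qed

lemma exp_factor_hol: "(\<lambda>z. exp (- of_real t * (2 / (1 - z) - 1))) holomorphic_on ball 0 1"
  by (intro holomorphic_intros) (use hp_coord_disc(3) in auto)

text \<open>The scaled bump is S / (V + S) times 2 sqrt S times the kernel with parameter S + 1,
  whose norm is explicit; S / (V + S) and the inner factor have modulus at most 1.\<close>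

lemma weyl_hardy_le:
  assumes t: "t \<ge> 0" and S: "S > 0" shows "hardy_le (weyl t S) 1"
proof -
  have "hardy_le (hardy2_fun (of_real (2 * sqrt S) *\<^sub>C hker (of_real (S + 1)))) 1"
  proof (rule hardy_le_mono[OF hardy_le_norm])
    have "(norm (of_real (2 * sqrt S) *\<^sub>C hker (of_real (S + 1))))\<^sup>2 = 4 * S * (1 / (4 * (S + 1)))"
      unfolding norm_scaleC power_mult_distrib using S norm_hker[of "of_real (S + 1)"]
      by (simp add: power_mult_distrib)
    also have "\<dots> \<le> 1\<^sup>2" using S by simp
    finally show "norm (of_real (2 * sqrt S) *\<^sub>C hker (of_real (S + 1))) \<le> 1" by (rule power2_le_imp_le) simp
  qed
  then have "hardy_le (\<lambda>z. (of_real S / (2 / (1 - z) + of_real S)) * hardy2_fun (of_real (2 * sqrt S) *\<^sub>C hker (of_real (S + 1))) z) (1 * 1)"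
  proof (rule hardy_le_mult)
    have b: "2 / (1 - z) + of_real S \<noteq> 0 \<and> cmod (of_real S / (2 / (1 - z) + of_real S)) \<le> 1" if "z \<in> ball 0 1" for z
      using bump_bounds(1,2)[OF S, of "2 / (1 - z)"] hp_coord_disc(1)[OF that] by simp
    then show "cmod (of_real S / (2 / (1 - z) + of_real S)) \<le> 1" if "z \<in> ball 0 1" for z using that by blast
    show "(\<lambda>z. of_real S / (2 / (1 - z) + of_real S)) holomorphic_on ball 0 1"
      by (intro holomorphic_intros) (use b hp_coord_disc(3) in auto)
  qed
  then have "hardy_le (\<lambda>z. exp (- of_real t * (2 / (1 - z) - 1)) *
      ((of_real S / (2 / (1 - z) + of_real S)) * hardy2_fun (of_real (2 * sqrt S) *\<^sub>C hker (of_real (S + 1))) z)) (1 * (1 * 1))"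
    by (rule hardy_le_mult) (use exp_factor_hol exp_factor_le_1[OF t] in auto)
  then have "hardy_le (weyl t S) (1 * (1 * 1))"
  proof (rule hardy_le_cong)
    fix z :: complex assume z: "z \<in> ball 0 1"
    let ?p = "2 / (1 - z)"
    have p: "?p + of_real S \<noteq> 0" using bump_bounds(1)[OF S] hp_coord_disc(1)[OF z] by (meson less_trans zero_less_one)
    have "hardy2_fun (of_real (2 * sqrt S) *\<^sub>C hker (of_real (S + 1))) z = of_real (2 * sqrt S) * (1 / (2 + of_real S * (1 - z)))"
      using S z by (simp add: scaleC_hardy2.rep_eq hardy2_fun_hker)
    also have "2 + of_real S * (1 - z) = (1 - z) * (?p + of_real S)"
    proof -
      have "(1 - z) * ?p = 2"
        unfolding times_divide_eq_right by (rule nonzero_mult_div_cancel_left[OF hp_coord_disc(3)[OF z]])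
      then show ?thesis by (simp only: distrib_left mult.commute)
    qed
    also have "of_real (2 * sqrt S) * (1 / ((1 - z) * (?p + of_real S))) = of_real (sqrt S) * ?p / (?p + of_real S)"
      by simp
    finally have h: "hardy2_fun (of_real (2 * sqrt S) *\<^sub>C hker (of_real (S + 1))) z = of_real (sqrt S) * ?p / (?p + of_real S)" .
    have "(of_real S / (?p + of_real S)) * (of_real (sqrt S) * ?p / (?p + of_real S)) = of_real (sqrt S) * bump S ?p"
    proof -
      have "(of_real S / (p + of_real S)) * (of_real (sqrt S) * p / (p + of_real S)) = of_real (sqrt S) * bump S p" for p
        by (simp add: bump_def power2_eq_square mult_ac)
      then show ?thesis .
    qed
    then show "exp (- of_real t * (?p - 1)) * ((of_real S / (?p + of_real S)) * hardy2_fun (of_real (2 * sqrt S) *\<^sub>C hker (of_real (S + 1))) z) = weyl t S z"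
      by (simp only: h weyl_def)
  qed
  then show ?thesis by simp
qed

text \<open>Once the inner factor is cancelled, the value of the bump at V = S is played against the
  point evaluation bound.\<close>

lemma weyl_lower:
  assumes t: "t \<ge> 0" and S: "S \<ge> 2" and M: "hardy_le (weyl t S) M" shows "1 / 4 \<le> M"
proof -
  have S0: "S > 0" using S by simp
  let ?k = "\<lambda>z. of_real (sqrt S) * bump S (2 / (1 - z))"
  have k: "hardy_le ?k M"
  proof (rule hardy_le_inner_cancel[OF bump_hol[OF S0] t])
    show "hardy_le (\<lambda>z. exp (- of_real t * (2 / (1 - z) - 1)) * ?k z) M" using M by (simp add: weyl_def[abs_def])
    fix z :: complex assume z: "z \<in> ball 0 1"
    let ?p = "2 / (1 - z)"
    have p0: "Re ?p > 0" using hp_coord_disc(1)[OF z] by linarith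
    have bp: "p * bump S p = of_real S * (p / (p + of_real S))\<^sup>2" for p
      by (simp add: bump_def power2_eq_square)
    have "cmod (?p * bump S ?p) = S * (cmod (?p / (?p + of_real S)))\<^sup>2"
      unfolding bp using S0 by (simp only: norm_mult norm_power norm_of_real abs_of_pos)
    also have "\<dots> \<le> S * 1\<^sup>2" using bump_bounds(3)[OF S0 p0] S0 by (intro mult_left_mono power_mono) auto
    finally have "cmod ?p * cmod (bump S ?p) \<le> S" by (simp only: norm_mult) simp
    then have "2 * cmod (bump S ?p) \<le> S * cmod (1 - z)"
      using hp_coord_disc(3)[OF z] by (simp add: norm_divide divide_le_eq)
    then have "sqrt S * cmod (bump S ?p) \<le> sqrt S * (S / 2 * cmod (1 - z))"
      using S0 by (intro mult_left_mono) auto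
    then show "cmod (?k z) \<le> (sqrt S * S / 2) * cmod (1 - z)"
      using S0 by (simp only: norm_mult norm_of_real) simp
  qed
  \<comment> \<open>The point with coordinate V = S; it is nonnegative because S \<ge> 2.\<close>
  define x where "x = 1 - 2 / S"
  have x: "0 \<le> x" "x < 1" using S by (auto simp: x_def)
  have "2 / (1 - of_real x) = complex_of_real S" using S0 by (simp add: x_def)
  then have kx: "?k (of_real x) = of_real (sqrt S / 4)"
    using S0 by (simp add: bump_def power2_eq_square)
  have "cmod (?k (of_real x)) \<le> M / sqrt (1 - (cmod (of_real x))\<^sup>2)"
    by (rule hardy_le_point[OF k]) (use x in simp)
  then have le: "sqrt S / 4 \<le> M / sqrt (1 - x\<^sup>2)"
    unfolding kx using S0 by (simp only: norm_of_real) simp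
  have y: "1 - x\<^sup>2 = 4 * (S - 1) / S\<^sup>2" using S0 by (simp add: x_def power2_eq_square field_simps)
  then have pos: "1 - x\<^sup>2 > 0" using S by simp
  then have "sqrt S / 4 * sqrt (1 - x\<^sup>2) \<le> M" using le by (simp add: le_divide_eq)
  moreover have "1 \<le> S * (1 - x\<^sup>2)" using S unfolding y by (simp add: power2_eq_square le_divide_eq)
  then have "1 \<le> sqrt S * sqrt (1 - x\<^sup>2)" by (simp flip: real_sqrt_mult)
  ultimately show ?thesis by simp
qed

section \<open>Action of the operator on the approximate eigenvectors\<close>

context parabolic_map
begin

text \<open>The quantity 2 C bounds |u - a| on the disc. The first summand pays for the exponential
  factor, the second for the variation of the bump.\<close>

definition weyl_const :: "real \<Rightarrow> real"
  where "weyl_const t = t * (2 * C) * exp (t * (2 * C)) * (1 + cmod a + 2 * C) + 3 * (cmod a + 2 * C)"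

text \<open>The relative error exp (- t (u - a)) - 1 is only O(1 / V), so it need not be small at
  bounded V; but the bump is O(V / S), and the product is O(1 / S) throughout. A sup norm estimate
  is enough, as it dominates the Hardy norm.\<close>

lemma weyl_approx:
  assumes t: "t \<ge> 0" and S: "S > 0" and z: "z \<in> ball 0 1"
  shows "cmod (weyl t S (hp_shift u z) - exp (- a * of_real t) * weyl t S z) \<le> weyl_const t / sqrt S"
proof -
  let ?p = "2 / (1 - z)" and ?h = "u z - a" and ?H = "2 * C"
  let ?P = "?p + u z"
  have uRe: "0 \<le> Re (u z)" using u_Re[OF z] \<delta> by linarith
  have P: "2 / (1 - hp_shift u z) = ?P" using hp_shift_coord[of z u] z uRe by simp
  have p: "Re ?p > 1" "cmod ?p \<ge> 1" "1 - z \<noteq> 0" using hp_coord_disc[OF z] by auto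
  have Re_pos: "Re ?p > 0" "Re ?P > 0" using p uRe by auto
  have h: "cmod ?h \<le> ?H / cmod ?p"
    using u_near[OF z] p(3) by (simp add: norm_divide)
  also have "\<dots> \<le> ?H" using p(2) C by (simp add: divide_le_eq mult_le_cancel_left1)
  finally have h2: "cmod ?h \<le> ?H" .
  have uz: "cmod (u z) \<le> cmod a + ?H" using norm_triangle_ineq[of a ?h] h2 by simp
  have E: "cmod (exp (- of_real t * ?h) - 1) \<le> t * ?H * exp (t * ?H) / cmod ?p"
  proof -
    have "cmod (exp (- of_real t * ?h) - 1) \<le> exp \<bar>Re (- of_real t * ?h)\<bar> * cmod (- of_real t * ?h)"
      using Taylor_exp[of "- of_real t * ?h" 0] by simp
    also have "\<dots> \<le> exp (t * ?H) * (t * (?H / cmod ?p))"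
    proof (intro mult_mono)
      have e: "cmod (- of_real t * ?h) = t * cmod ?h" using t by (simp add: norm_mult)
      show "cmod (- of_real t * ?h) \<le> t * (?H / cmod ?p)" unfolding e by (rule mult_left_mono[OF h t])
      have "\<bar>Re (- of_real t * ?h)\<bar> \<le> cmod (- of_real t * ?h)" by (rule abs_Re_le_cmod)
      also have "\<dots> \<le> t * ?H" unfolding e by (rule mult_left_mono[OF h2 t])
      finally show "exp \<bar>Re (- of_real t * ?h)\<bar> \<le> exp (t * ?H)" by simp
    qed auto
    finally show ?thesis by (simp add: mult_ac)
  qed
  have bP: "cmod (bump S ?P) \<le> cmod ?p * (1 + cmod a + ?H) / S"
  proof -
    have "cmod ?P \<le> cmod ?p + (cmod a + ?H)" using norm_triangle_ineq[of ?p "u z"] uz by linarith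
    also have "\<dots> \<le> cmod ?p + cmod ?p * (cmod a + ?H)" using mult_right_mono[OF p(2), of "cmod a + ?H"] C by simp
    also have "\<dots> = cmod ?p * (1 + cmod a + ?H)" by (simp add: distrib_left)
    finally have "cmod ?P / S \<le> cmod ?p * (1 + cmod a + ?H) / S" using S by (intro divide_right_mono) auto
    then show ?thesis using bump_bounds(4)[OF S Re_pos(2)] by linarith
  qed
  have A: "cmod ((exp (- of_real t * ?h) - 1) * bump S ?P) \<le> t * ?H * exp (t * ?H) * (1 + cmod a + ?H) / S"
  proof -
    have "cmod ((exp (- of_real t * ?h) - 1) * bump S ?P)
      \<le> (t * ?H * exp (t * ?H) / cmod ?p) * (cmod ?p * (1 + cmod a + ?H) / S)"
      unfolding norm_mult using E bP t C by (intro mult_mono) auto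
    also have "\<dots> = t * ?H * exp (t * ?H) * (1 + cmod a + ?H) / S"
    proof -
      have "cmod ?p \<noteq> 0" using p(2) by linarith
      moreover have "(A / x) * (x * B / S) = A * B / S" if "x \<noteq> 0" for A B x :: real
        using that by simp
      ultimately show ?thesis by blast
    qed
    finally show ?thesis .
  qed
  have "cmod (bump S ?P - bump S ?p) \<le> 3 * cmod (u z) / S"
    using bump_diff[OF S Re_pos(2,1)] by simp
  also have "\<dots> \<le> 3 * (cmod a + ?H) / S" using uz S by (intro divide_right_mono mult_left_mono) auto
  finally have D: "cmod (bump S ?P - bump S ?p) \<le> 3 * (cmod a + ?H) / S" .
  have sum_le: "cmod ((exp (- of_real t * ?h) - 1) * bump S ?P + (bump S ?P - bump S ?p)) \<le> weyl_const t / S"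
    using norm_triangle_ineq[of "(exp (- of_real t * ?h) - 1) * bump S ?P" "bump S ?P - bump S ?p"] A D
    unfolding weyl_const_def add_divide_distrib by linarith
  let ?e = "exp (- of_real t * (?p - 1))"
  have ex: "exp (- of_real t * (?P - 1)) = ?e * exp (- a * of_real t) * exp (- of_real t * ?h)"
    unfolding mult_exp_exp by (simp add: algebra_simps)
  have eq: "weyl t S (hp_shift u z) - exp (- a * of_real t) * weyl t S z
    = ?e * exp (- a * of_real t) * (of_real (sqrt S) * ((exp (- of_real t * ?h) - 1) * bump S ?P + (bump S ?P - bump S ?p)))"
    unfolding weyl_def P ex by (simp only: ring_distribs) (simp add: algebra_simps)
  have "cmod (?e * exp (- a * of_real t) * (of_real (sqrt S) * ((exp (- of_real t * ?h) - 1) * bump S ?P + (bump S ?P - bump S ?p))))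
    \<le> (1 * 1) * (sqrt S * (weyl_const t / S))"
    unfolding norm_mult
  proof (intro mult_mono sum_le exp_factor_le_1[OF t z])
    show "cmod (exp (- a * of_real t)) \<le> 1" using a t by simp
    show "cmod (of_real (sqrt S)) \<le> sqrt S" using S by simp
  qed (use S in auto)
  also have "(1 * 1) * (sqrt S * (weyl_const t / S)) = weyl_const t / sqrt S"
    using S real_sqrt_mult_self[of S] by (simp add: field_simps)
  finally show ?thesis unfolding eq .
qed

lemma disc_selfmap_u: "disc_selfmap (hp_shift u)"
  using u_Re \<delta> by (intro disc_selfmap_hp_shift u_hol) (meson less_imp_le order_trans)

lemma weyl_properties:
  assumes t: "t \<ge> 0" and S: "S \<ge> 2"
  defines "F \<equiv> to_hardy2 (weyl t S)"
  shows "1 / 4 \<le> norm F" "norm F \<le> 1"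
    "norm (composition_operator (hp_shift u) F - exp (- a * of_real t) *\<^sub>C F) \<le> weyl_const t / sqrt S"
    "z \<in> ball 0 1 \<Longrightarrow> cmod (hardy2_fun F z) \<le> cmod (2 / (1 - z)) / sqrt S"
proof -
  have S0: "S > 0" using S by simp
  note le1 = weyl_hardy_le[OF t S0]
  have F: "hardy2_fun F z = weyl t S z" if "z \<in> ball 0 1" for z
    unfolding F_def by (rule hardy2_fun_to_hardy2[OF le1 that])
  show "norm F \<le> 1" unfolding F_def by (rule norm_to_hardy2[OF le1])
  have "hardy_le (weyl t S) (norm F)" by (rule hardy_le_cong[OF hardy_le_norm]) (rule F)
  then show "1 / 4 \<le> norm F" by (rule weyl_lower[OF t S])
  show "cmod (hardy2_fun F z) \<le> cmod (2 / (1 - z)) / sqrt S" if z: "z \<in> ball 0 1"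
  proof -
    have Re_pos: "Re (2 / (1 - z)) > 0" using hp_coord_disc(1)[OF z] by linarith
    have "cmod (weyl t S z) \<le> 1 * (sqrt S * (cmod (2 / (1 - z)) / S))"
      unfolding weyl_def norm_mult 
      by (intro mult_mono exp_factor_le_1[OF t z] bump_bounds(4)[OF S0 Re_pos]) (use S0 in auto)
    also have "\<dots> = cmod (2 / (1 - z)) / sqrt S"
      using S0 real_sqrt_mult_self[of S] by (simp add: field_simps)
    finally show ?thesis using F[OF z] by simp
  qed
  show "norm (composition_operator (hp_shift u) F - exp (- a * of_real t) *\<^sub>C F) \<le> weyl_const t / sqrt S"
  proof (rule norm_le_hardy_le, rule hardy_le_cong[OF hardy_le_bounded])
    let ?f = "\<lambda>z. weyl t S (hp_shift u z) - exp (- a * of_real t) * weyl t S z"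
    have w: "weyl t S holomorphic_on ball 0 1" using le1 by (simp add: hardy_le_def)
    have "(weyl t S \<circ> hp_shift u) holomorphic_on ball 0 1"
      using disc_selfmap_u by (intro holomorphic_on_compose_gen[OF _ w]) (auto simp: disc_selfmap_def)
    then show "?f holomorphic_on ball 0 1" unfolding o_def by (intro holomorphic_intros w)
    show "cmod (?f z) \<le> weyl_const t / sqrt S" if "z \<in> ball 0 1" for z
      by (rule weyl_approx[OF t S0 that])
    fix z :: complex assume z: "z \<in> ball 0 1"
    then have "hp_shift u z \<in> ball 0 1" using disc_selfmap_u by (auto simp: disc_selfmap_def image_subset_iff)
    then show "?f z = hardy2_fun (composition_operator (hp_shift u) F - exp (- a * of_real t) *\<^sub>C F) z"
      using z by (simp only: minus_hardy2.rep_eq scaleC_hardy2.rep_eq hardy2_fun_composition[OF disc_selfmap_u] F)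
  qed
qed

lemma weyl_pointwise:
  assumes t: "\<And>n. t n \<ge> 0" and S: "\<And>n. S n \<ge> real n + 2" and z: "z \<in> ball 0 1"
  shows "(\<lambda>n. hardy2_fun (to_hardy2 (weyl (t n) (S n))) z) \<longlonglongrightarrow> 0"
proof (rule Lim_null_comparison)
  have lim: "filterlim (\<lambda>n. sqrt (real n + 2)) at_top sequentially"
    by (rule sqrt_shift_at_top)
  show "(\<lambda>n. cmod (2 / (1 - z)) / sqrt (real n + 2)) \<longlonglongrightarrow> 0"
    by (intro tendsto_divide_0[OF tendsto_const] filterlim_at_top_imp_at_infinity lim)
  show "\<forall>\<^sub>F n in sequentially. cmod (hardy2_fun (to_hardy2 (weyl (t n) (S n))) z) \<le> cmod (2 / (1 - z)) / sqrt (real n + 2)"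
  proof (intro always_eventually allI)
    fix n
    have "S n \<ge> 2" using S[of n] by linarith
    from weyl_properties(4)[OF t this z]
    have "cmod (hardy2_fun (to_hardy2 (weyl (t n) (S n))) z) \<le> cmod (2 / (1 - z)) / sqrt (S n)" .
    also have "\<dots> \<le> cmod (2 / (1 - z)) / sqrt (real n + 2)"
      using S[of n] by (intro divide_left_mono) auto
    finally show "cmod (hardy2_fun (to_hardy2 (weyl (t n) (S n))) z) \<le> cmod (2 / (1 - z)) / sqrt (real n + 2)" .
  qed
qed

theorem spiral_subset_essential_spectrum:
  "{exp (- a * complex_of_real t) |t. t \<ge> 0} \<union> {0} \<subseteq> essential_spectrum (composition_operator (hp_shift u))"
proof -
  let ?T = "composition_operator (hp_shift u)"
  have "exp (- a * of_real t) \<in> essential_spectrum ?T" if t: "t \<ge> 0" for t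
  proof (rule weyl_essential_spectrum)
    let ?X = "\<lambda>n. to_hardy2 (weyl t (real n + 2))"
    show "1 / 4 \<le> norm (?X n)" for n by (rule weyl_properties(1)[OF t]) simp
    show "(\<lambda>n. hardy2_fun (?X n) z) \<longlonglongrightarrow> 0" if "z \<in> ball 0 1" for z
      by (rule weyl_pointwise) (use t that in auto)
    have lim: "filterlim (\<lambda>n. sqrt (real n + 2)) at_top sequentially"
      by (rule sqrt_shift_at_top)
    have w0: "(\<lambda>n. weyl_const t / sqrt (real n + 2)) \<longlonglongrightarrow> 0"
      by (intro tendsto_divide_0[OF tendsto_const] filterlim_at_top_imp_at_infinity lim)
    have wle: "norm (?T (?X n) - exp (- a * of_real t) *\<^sub>C ?X n) \<le> weyl_const t / sqrt (real n + 2)" for n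
      by (rule weyl_properties(3)[OF t]) simp
    show "(\<lambda>n. ?T (?X n) - exp (- a * of_real t) *\<^sub>C ?X n) \<longlonglongrightarrow> 0"
      by (rule Lim_null_comparison[OF always_eventually[OF allI[OF wle]] w0])
  qed simp
  moreover have "0 \<in> essential_spectrum ?T"
  proof (rule weyl_essential_spectrum)
    \<comment> \<open>The choice t = n drives the eigenvalue exp (- a n) to 0, while
      \<open>S\<close> grows fast enough to keep \<open>weyl_const (real n) / sqrt (S n)\<close>
      below 1 / (n + 1).\<close>
    define S where "S n = real n + 2 + (weyl_const (real n) * (real n + 1))\<^sup>2" for n
    have S: "S n \<ge> real n + 2" for n by (simp add: S_def)
    have S2: "S n \<ge> 2" for n using S[of n] by linarith
    let ?X = "\<lambda>n. to_hardy2 (weyl (real n) (S n))"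
    show "1 / 4 \<le> norm (?X n)" for n by (rule weyl_properties(1)[OF _ S2]) simp
    show "(\<lambda>n. hardy2_fun (?X n) z) \<longlonglongrightarrow> 0" if "z \<in> ball 0 1" for z
      by (rule weyl_pointwise) (use S that in auto)
    have le: "norm (?T (?X n) - 0 *\<^sub>C ?X n) \<le> 1 / (real n + 1) + exp (- Re a) ^ n" for n
    proof -
      have nonneg: "0 \<le> real n" by simp
      have "weyl_const (real n) * (real n + 1) \<le> sqrt (S n)"
        by (rule real_le_rsqrt) (simp add: S_def)
      then have w: "weyl_const (real n) / sqrt (S n) \<le> 1 / (real n + 1)"
        using S2[of n] by (simp add: divide_le_eq le_divide_eq mult.commute)
      have "norm (?T (?X n)) \<le> norm (?T (?X n) - exp (- a * of_real (real n)) *\<^sub>C ?X n) + norm (exp (- a * of_real (real n)) *\<^sub>C ?X n)"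
        by (metis diff_add_cancel norm_triangle_ineq)
      also have "norm (?T (?X n) - exp (- a * of_real (real n)) *\<^sub>C ?X n) \<le> 1 / (real n + 1)"
        using weyl_properties(3)[OF nonneg S2] w by (rule order_trans)
      also have "norm (exp (- a * of_real (real n)) *\<^sub>C ?X n) \<le> exp (- Re a) ^ n * 1"
      proof -
        have "cmod (exp (- a * of_real (real n))) = exp (- Re a) ^ n"
          by (simp add: exp_of_nat_mult[symmetric] mult.commute)
        then show ?thesis unfolding norm_scaleC
          using weyl_properties(2)[OF nonneg S2] by (intro mult_mono) auto
      qed
      finally show ?thesis by simp
    qed
    have lim: "(\<lambda>n. 1 / (real n + 1) + exp (- Re a) ^ n) \<longlonglongrightarrow> 0 + 0"
    proof (intro tendsto_add LIMSEQ_power_zero)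
      show "(\<lambda>n. 1 / (real n + 1)) \<longlonglongrightarrow> 0"
        using LIMSEQ_inverse_real_of_nat by (simp add: inverse_eq_divide add.commute)
      show "norm (exp (- Re a)) < 1" using a by simp
    qed
    show "(\<lambda>n. ?T (?X n) - 0 *\<^sub>C ?X n) \<longlonglongrightarrow> 0"
      by (rule Lim_null_comparison[OF always_eventually[OF allI[OF le]] lim[unfolded add_0_left]])
  qed simp
  ultimately show ?thesis by blast
qed

end

section \<open>Boundary behaviour of the selfmap\<close>

lemma at_1_within_disc_nontrivial: "at (1::complex) within ball 0 1 \<noteq> bot"
  unfolding trivial_limit_within by (simp add: islimpt_ball)

text \<open>The mean value inequality on the convex set of points of the disc no further from 1 than
  \<open>z\<close>, with the second point sent to 1. Each integration gains one power of |z -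
  1|.\<close>

lemma boundary_integrate:
  fixes f f' :: "complex \<Rightarrow> complex"
  assumes f: "\<And>z. z \<in> ball 0 1 \<Longrightarrow> (f has_field_derivative f' z) (at z)"
    and f': "\<And>z. z \<in> ball 0 1 \<Longrightarrow> cmod (z - 1) < s \<Longrightarrow> cmod (f' z) \<le> M * cmod (z - 1) ^ k"
    and M: "M \<ge> 0" and lim: "(f \<longlongrightarrow> 0) (at 1 within ball 0 1)"
    and z: "z \<in> ball 0 1" "cmod (z - 1) < s"
  shows "cmod (f z) \<le> M * cmod (z - 1) ^ Suc k"
proof -
  let ?D = "ball (0::complex) 1 \<inter> cball 1 (cmod (z - 1))"
  have bd: "cmod (f z - f w) \<le> M * cmod (z - 1) ^ k * cmod (z - w)" if w: "w \<in> ?D" for w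
  proof (rule field_differentiable_bound[where S = ?D and f' = f'])
    show "convex ?D" by (intro convex_Int) simp_all
    show "(f has_field_derivative f' x) (at x within ?D)" if "x \<in> ?D" for x
      using f[of x] that by (auto intro: has_field_derivative_at_within)
    show "cmod (f' x) \<le> M * cmod (z - 1) ^ k" if "x \<in> ?D" for x
    proof -
      have x: "cmod (x - 1) \<le> cmod (z - 1)" using that by (simp add: dist_norm norm_minus_commute)
      have "cmod (f' x) \<le> M * cmod (x - 1) ^ k" using f'[of x] that x z by simp
      also have "\<dots> \<le> M * cmod (z - 1) ^ k" using x M by (intro mult_left_mono power_mono) auto
      finally show ?thesis .
    qed
    show "z \<in> ?D" using z by (simp add: dist_norm norm_minus_commute)
  qed (rule w)
  have z1: "z \<noteq> 1" using z by auto
  have "\<forall>\<^sub>F w in at 1 within ball 0 1. w \<in> ?D"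
    unfolding eventually_at using z1
    by (intro exI[of _ "cmod (z - 1)"]) (auto simp: dist_norm norm_minus_commute)
  then have "\<forall>\<^sub>F w in at 1 within ball 0 1. cmod (f z - f w) \<le> M * cmod (z - 1) ^ k * cmod (z - w)"
    by (rule eventually_mono) (rule bd)
  moreover have "((\<lambda>w. cmod (f z - f w)) \<longlongrightarrow> cmod (f z - 0)) (at 1 within ball 0 1)"
    by (intro tendsto_intros lim)
  moreover have "((\<lambda>w. M * cmod (z - 1) ^ k * cmod (z - w)) \<longlongrightarrow> M * cmod (z - 1) ^ k * cmod (z - 1)) (at 1 within ball 0 1)"
    by (intro tendsto_intros)
  ultimately have "cmod (f z - 0) \<le> M * cmod (z - 1) ^ k * cmod (z - 1)"
    using tendsto_le[OF at_1_within_disc_nontrivial] by blast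
  then show ?thesis by (simp add: mult_ac)
qed

text \<open>Three integrations towards 1, starting from a bound on the third derivative near 1; the
  boundary values of \<phi> and its first two derivatives are the constants of integration.\<close>

lemma boundary_taylor:
  assumes \<phi>: "\<phi> holomorphic_on ball 0 1"
    and b0: "has_boundary_value \<phi> 1 1" and b1: "has_boundary_value (deriv \<phi>) 1 1"
    and b2: "has_boundary_value ((deriv ^^ 2) \<phi>) 1 a"
    and g: "continuous_on (insert 1 (ball 0 1)) g" "\<And>z. z \<in> ball 0 1 \<Longrightarrow> g z = (deriv ^^ 3) \<phi> z"
  obtains s M where "s > 0" "M \<ge> 0"
    "\<And>z. z \<in> ball 0 1 \<Longrightarrow> cmod (z - 1) < s \<Longrightarrow> cmod (\<phi> z - 1 - (z - 1) - a / 2 * (z - 1)\<^sup>2) \<le> M * cmod (z - 1) ^ 3"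
proof -
  have "(g \<longlongrightarrow> g 1) (at 1 within insert 1 (ball 0 1))"
    using g(1) by (auto simp: continuous_on_def)
  then have "\<forall>\<^sub>F z in at 1 within insert 1 (ball 0 1). dist (g z) (g 1) < 1"
    by (rule tendstoD) simp
  then obtain s where s: "s > 0" "\<And>z. z \<in> ball 0 1 \<Longrightarrow> z \<noteq> 1 \<Longrightarrow> dist z 1 < s \<Longrightarrow> dist (g z) (g 1) < 1"
    unfolding eventually_at by blast
  define M where "M = cmod (g 1) + 1"
  have M: "M \<ge> 0" by (simp add: M_def)
  have d3: "cmod ((deriv ^^ 3) \<phi> z) \<le> M * cmod (z - 1) ^ 0" if z: "z \<in> ball 0 1" "cmod (z - 1) < s" for z
  proof -
    have "z \<noteq> 1" using z by auto
    then have "cmod (g z - g 1) < 1" using s(2)[of z] z by (simp add: dist_norm)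
    then show ?thesis using norm_triangle_ineq2[of "g z" "g 1"] g(2)[OF z(1)] by (simp add: M_def)
  qed
  have der: "((deriv ^^ n) \<phi> has_field_derivative (deriv ^^ Suc n) \<phi> z) (at z)" if "z \<in> ball 0 1" for n z
    using holomorphic_derivI[OF holomorphic_higher_deriv[OF \<phi> open_ball] open_ball that, of n] by simp
  have der0: "(\<phi> has_field_derivative deriv \<phi> z) (at z)" "(deriv \<phi> has_field_derivative (deriv ^^ 2) \<phi> z) (at z)"
    "((deriv ^^ 2) \<phi> has_field_derivative (deriv ^^ 3) \<phi> z) (at z)" if "z \<in> ball 0 1" for z
    using der[OF that, of 0] der[OF that, of 1] der[OF that, of 2] by (simp_all add: numeral_eq_Suc)
  have e2: "cmod ((deriv ^^ 2) \<phi> z - a) \<le> M * cmod (z - 1) ^ Suc 0" if z: "z \<in> ball 0 1" "cmod (z - 1) < s" for z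
  proof (rule boundary_integrate[where f' = "(deriv ^^ 3) \<phi>" and s = s, OF _ d3 M _ z])
    show "((\<lambda>z. (deriv ^^ 2) \<phi> z - a) has_field_derivative (deriv ^^ 3) \<phi> z) (at z)" if "z \<in> ball 0 1" for z
      using DERIV_diff[OF der0(3)[OF that] DERIV_const[of a]] by simp
    show "((\<lambda>z. (deriv ^^ 2) \<phi> z - a) \<longlongrightarrow> 0) (at 1 within ball 0 1)" by (rule LIM_zero[OF b2])
  qed
  have e1: "cmod (deriv \<phi> z - 1 - a * (z - 1)) \<le> M * cmod (z - 1) ^ Suc (Suc 0)" if z: "z \<in> ball 0 1" "cmod (z - 1) < s" for z
  proof (rule boundary_integrate[where f' = "\<lambda>z. (deriv ^^ 2) \<phi> z - a" and s = s, OF _ e2 M _ z])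
    show "((\<lambda>z. deriv \<phi> z - 1 - a * (z - 1)) has_field_derivative (deriv ^^ 2) \<phi> z - a) (at z)" if "z \<in> ball 0 1" for z
      by (rule derivative_eq_intros der0(2)[OF that] refl | simp)+
    have "((\<lambda>z. deriv \<phi> z - 1 - a * (z - 1)) \<longlongrightarrow> 1 - 1 - a * (1 - 1)) (at 1 within ball 0 1)"
      by (intro tendsto_intros b1)
    then show "((\<lambda>z. deriv \<phi> z - 1 - a * (z - 1)) \<longlongrightarrow> 0) (at 1 within ball 0 1)" by simp
  qed
  have e0: "cmod (\<phi> z - 1 - (z - 1) - a / 2 * (z - 1)\<^sup>2) \<le> M * cmod (z - 1) ^ Suc (Suc (Suc 0))" if z: "z \<in> ball 0 1" "cmod (z - 1) < s" for z
  proof (rule boundary_integrate[where f' = "\<lambda>z. deriv \<phi> z - 1 - a * (z - 1)" and s = s, OF _ e1 M _ z])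
    show "((\<lambda>z. \<phi> z - 1 - (z - 1) - a / 2 * (z - 1)\<^sup>2) has_field_derivative deriv \<phi> z - 1 - a * (z - 1)) (at z)" if "z \<in> ball 0 1" for z
      by (rule derivative_eq_intros der0(1)[OF that] refl | simp)+
    have "((\<lambda>z. \<phi> z - 1 - (z - 1) - a / 2 * (z - 1)\<^sup>2) \<longlongrightarrow> 1 - 1 - (1 - 1) - a / 2 * (1 - 1)\<^sup>2) (at 1 within ball 0 1)"
      by (intro tendsto_intros b0)
    then show "((\<lambda>z. \<phi> z - 1 - (z - 1) - a / 2 * (z - 1)\<^sup>2) \<longlongrightarrow> 0) (at 1 within ball 0 1)" by simp
  qed
  show ?thesis
    using that[OF s(1) M] e0 by (simp add: numeral_eq_Suc)
qed

text \<open>With \<open>x = 1 - z\<close> and \<open>y = 1 - \<phi> z\<close>, the second-order Taylor expansion at the boundary says that \<open>\<phi>\<close> is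
  translation by \<open>a\<close> up to \<open>O(x)\<close> in the half-plane coordinate.\<close>

lemma reciprocal_expansion:
  fixes x y a R :: complex
  assumes y: "y = x - a / 2 * x\<^sup>2 - R" and R: "cmod R \<le> M * cmod x ^ 3" and M: "M \<ge> 0"
    and x: "x \<noteq> 0" "cmod x \<le> 1" "(cmod a + 2 * M) * cmod x \<le> 1"
  shows "cmod (2 / y - 2 / x - a) \<le> 2 * (2 * M + (cmod a)\<^sup>2 / 2 + cmod a * M) * cmod x"
proof -
  let ?K = "2 * M + (cmod a)\<^sup>2 / 2 + cmod a * M"
  have R2: "cmod R \<le> M * (cmod x)\<^sup>2"
  proof -
    have "cmod x ^ 3 \<le> (cmod x)\<^sup>2" using x by (intro power_decreasing) auto
    then show ?thesis using R M mult_left_mono order_trans by blast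
  qed
  have ylow: "cmod x / 2 \<le> cmod y"
  proof -
    have "cmod (a / 2 * x\<^sup>2 + R) \<le> cmod a / 2 * (cmod x)\<^sup>2 + M * (cmod x)\<^sup>2"
      using norm_triangle_ineq[of "a / 2 * x\<^sup>2" R] R2 by (simp add: norm_mult norm_divide norm_power)
    also have "\<dots> = ((cmod a + 2 * M) * cmod x) * (cmod x / 2)"
      by (simp add: power2_eq_square algebra_simps)
    also have "\<dots> \<le> 1 * (cmod x / 2)" using x by (intro mult_right_mono) auto
    finally have "cmod (a / 2 * x\<^sup>2 + R) \<le> cmod x / 2" by simp
    moreover have "y = x - (a / 2 * x\<^sup>2 + R)" by (simp add: y)
    ultimately show ?thesis using norm_triangle_ineq2[of x "a / 2 * x\<^sup>2 + R"] by simp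
  qed
  have x0: "cmod x > 0" using x by simp
  then have y0: "y \<noteq> 0" using ylow by auto
  \<comment> \<open>The coefficient a / 2 makes the terms in x and x^2 cancel; what is left is of
    third order.\<close>
  have num: "2 * x - (2 + a * x) * y = 2 * R + a\<^sup>2 / 2 * x ^ 3 + a * R * x"
    unfolding y by (simp add: power2_eq_square power3_eq_cube algebra_simps)
  have "2 / y - 2 / x - a = (2 * x - (2 + a * x) * y) / (x * y)"
    using x y0 by (simp add: field_simps)
  then have "cmod (2 / y - 2 / x - a) = cmod (2 * R + a\<^sup>2 / 2 * x ^ 3 + a * R * x) / (cmod x * cmod y)"
    unfolding num by (simp add: norm_divide norm_mult)
  also have "\<dots> \<le> (?K * cmod x ^ 3) / (cmod x * (cmod x / 2))"
  proof (intro frac_le)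
    have "cmod (2 * R + a\<^sup>2 / 2 * x ^ 3 + a * R * x) \<le> cmod (2 * R) + cmod (a\<^sup>2 / 2 * x ^ 3) + cmod (a * R * x)"
      using norm_triangle_ineq[of "2 * R + a\<^sup>2 / 2 * x ^ 3" "a * R * x"] norm_triangle_ineq[of "2 * R" "a\<^sup>2 / 2 * x ^ 3"] by linarith
    also have "\<dots> \<le> 2 * (M * cmod x ^ 3) + (cmod a)\<^sup>2 / 2 * cmod x ^ 3 + cmod a * (M * cmod x ^ 3) * 1"
    proof (intro add_mono)
      show "cmod (2 * R) \<le> 2 * (M * cmod x ^ 3)" using R by (simp add: norm_mult)
      show "cmod (a\<^sup>2 / 2 * x ^ 3) \<le> (cmod a)\<^sup>2 / 2 * cmod x ^ 3" by (simp add: norm_mult norm_divide norm_power)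
      show "cmod (a * R * x) \<le> cmod a * (M * cmod x ^ 3) * 1"
        unfolding norm_mult using R x M by (intro mult_mono) auto
    qed
    also have "\<dots> = ?K * cmod x ^ 3" by (simp add: algebra_simps)
    finally show "cmod (2 * R + a\<^sup>2 / 2 * x ^ 3 + a * R * x) \<le> ?K * cmod x ^ 3" .
    show "cmod x * (cmod x / 2) \<le> cmod x * cmod y" using ylow by (intro mult_left_mono) auto
  qed (use x0 M in auto)
  also have "\<dots> = 2 * ?K * cmod x" using x0 by (simp add: power3_eq_cube)
  finally show ?thesis .
qed

text \<open>Compactness: points at distance at least \<open>s\<close> from 1 whose images tend to 1
  accumulate either inside the disc, where |\<phi>| < 1, or at a boundary point other than 1 whose
  cluster set contains 1.\<close>

lemma away_from_cluster:
  assumes \<phi>: "disc_selfmap \<phi>" and cl: "\<And>\<zeta>. \<zeta> \<in> sphere 0 1 \<Longrightarrow> 1 \<in> cluster_set \<phi> \<zeta> \<Longrightarrow> \<zeta> = 1" and s: "s > 0"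
  obtains m where "m > 0" "\<And>z. z \<in> ball 0 1 \<Longrightarrow> s \<le> cmod (1 - z) \<Longrightarrow> m \<le> cmod (1 - \<phi> z)"
proof -
  have "\<exists>m>0. \<forall>z\<in>ball 0 1. s \<le> cmod (1 - z) \<longrightarrow> m \<le> cmod (1 - \<phi> z)"
  proof (rule ccontr)
    assume "\<not> ?thesis"
    then have "\<forall>n. \<exists>z\<in>ball 0 1. s \<le> cmod (1 - z) \<and> cmod (1 - \<phi> z) < 1 / real (Suc n)"
      by (meson not_le of_nat_0_less_iff zero_less_Suc zero_less_divide_1_iff)
    then obtain z where z: "\<And>n. z n \<in> ball 0 1" "\<And>n. s \<le> cmod (1 - z n)" "\<And>n. cmod (1 - \<phi> (z n)) < 1 / real (Suc n)"
      by metis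
    have "\<forall>n. z n \<in> cball 0 1" using z(1) by (auto simp: less_imp_le)
    then obtain \<zeta> k where \<zeta>: "\<zeta> \<in> cball 0 1" "strict_mono k" "(z \<circ> k) \<longlonglongrightarrow> \<zeta>"
      using compact_cball[of "0::complex" 1] unfolding compact_def by blast
    have "(\<lambda>n. 1 / real (Suc n)) \<longlonglongrightarrow> 0" using LIMSEQ_inverse_real_of_nat by (simp add: inverse_eq_divide)
    then have "(\<lambda>n. 1 - \<phi> (z n)) \<longlonglongrightarrow> 0"
      by (rule Lim_null_comparison[rotated]) (use z(3) in \<open>simp add: less_imp_le\<close>)
    then have "(\<lambda>n. 1 - (1 - \<phi> (z n))) \<longlonglongrightarrow> 1 - 0" by (intro tendsto_diff tendsto_const)
    then have "(\<lambda>n. \<phi> (z n)) \<longlonglongrightarrow> 1" by simp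
    then have lim: "(\<lambda>n. \<phi> ((z \<circ> k) n)) \<longlonglongrightarrow> 1"
      using LIMSEQ_subseq_LIMSEQ[OF _ \<zeta>(2), of "\<lambda>n. \<phi> (z n)"] by (simp add: o_def)
    have far: "s \<le> cmod (1 - \<zeta>)"
    proof (rule LIMSEQ_le_const)
      show "(\<lambda>n. cmod (1 - (z \<circ> k) n)) \<longlonglongrightarrow> cmod (1 - \<zeta>)" by (intro tendsto_intros \<zeta>)
    qed (use z(2) in auto)
    show False
    proof (cases "\<zeta> \<in> ball 0 1")
      case True
      have "isCont \<phi> \<zeta>"
        using \<phi> True by (auto simp: disc_selfmap_def intro!: holomorphic_on_imp_continuous_on
          continuous_on_interior[of "ball 0 1"])
      then have "(\<lambda>n. \<phi> ((z \<circ> k) n)) \<longlonglongrightarrow> \<phi> \<zeta>" using \<zeta>(3) by (rule isCont_tendsto_compose)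
      then have "\<phi> \<zeta> = 1" using lim LIMSEQ_unique by blast
      moreover have "\<phi> \<zeta> \<in> ball 0 1" using \<phi> True by (auto simp: disc_selfmap_def image_subset_iff)
      ultimately show False by simp
    next
      case False
      then have "\<zeta> \<in> sphere 0 1" using \<zeta>(1) by auto
      moreover have "1 \<in> cluster_set \<phi> \<zeta>"
        unfolding cluster_set_def using z(1) \<zeta>(3) lim by (auto intro!: exI[of _ "z \<circ> k"])
      ultimately have "\<zeta> = 1" by (rule cl)
      then show False using far s by simp
    qed
  qed
  then show ?thesis using that by blast
qed

text \<open>Containment gives |c| + r \<le> 1 and tangency gives |1 - c| = r. So equality holds in
  the triangle inequality, and \<open>c\<close> lies on the segment from 0 to 1.\<close>

lemma tangent_disc_center:
  fixes c :: complex
  assumes r: "r > 0" and sub: "ball c r \<subset> ball 0 1" and one: "1 \<in> sphere c r"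
  shows "c = of_real (1 - r)" "r < (1::real)"
proof -
  have cr: "cmod c + r \<le> 1" using sub r by (auto simp: psubset_eq ball_subset_ball_iff)
  have d: "cmod (1 - c) = r" using one by (simp add: dist_norm norm_minus_commute)
  have "1 \<le> cmod (1 - c) + cmod c" using norm_triangle_ineq[of "1 - c" c] by simp
  then have cc: "cmod c = 1 - r" using cr d by simp
  have "(cmod (1 - c))\<^sup>2 = 1 - 2 * Re c + (cmod c)\<^sup>2" unfolding cmod_power2 by (simp add: power2_eq_square algebra_simps)
  then have "2 * Re c = 1 + (1 - r)\<^sup>2 - r\<^sup>2" unfolding d cc by simp
  then have Re: "Re c = 1 - r" by (simp add: power2_eq_square algebra_simps)
  have "(Re c)\<^sup>2 + (Im c)\<^sup>2 = (1 - r)\<^sup>2" using cc cmod_power2[of c] by simp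
  then have "Im c = 0" using Re by simp
  then show c: "c = of_real (1 - r)" using Re by (simp add: complex_eq_iff)
  show "r < 1"
  proof (rule ccontr)
    assume "\<not> r < 1"
    then have "r = 1" "c = 0" using cc c by auto (metis norm_ge_zero diff_ge_0_iff_ge order_antisym not_less)+
    then show False using sub by simp
  qed
qed

text \<open>Near 1 this is the reciprocal expansion. Elsewhere 1 - \<phi> stays away from 0, so the
  left side is bounded, while |1 - z| is bounded below.\<close>

lemma parabolic_expansion:
  assumes \<phi>: "disc_selfmap \<phi>" and cl: "\<And>\<zeta>. \<zeta> \<in> sphere 0 1 \<Longrightarrow> 1 \<in> cluster_set \<phi> \<zeta> \<Longrightarrow> \<zeta> = 1"
    and bv: "has_boundary_value \<phi> 1 1" "has_boundary_value (deriv \<phi>) 1 1"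
      "has_boundary_value ((deriv ^^ 2) \<phi>) 1 a"
    and g: "continuous_on (insert 1 (ball 0 1)) g" "\<And>z. z \<in> ball 0 1 \<Longrightarrow> g z = (deriv ^^ 3) \<phi> z"
  obtains C where "C \<ge> 0"
    "\<And>z. z \<in> ball 0 1 \<Longrightarrow> cmod (2 / (1 - \<phi> z) - 2 / (1 - z) - a) \<le> C * cmod (1 - z)"
proof -
  have hol: "\<phi> holomorphic_on ball 0 1" using \<phi> by (simp add: disc_selfmap_def)
  obtain s M where s: "s > 0" and M: "M \<ge> 0"
    and T: "\<And>z. z \<in> ball 0 1 \<Longrightarrow> cmod (z - 1) < s \<Longrightarrow> cmod (\<phi> z - 1 - (z - 1) - a / 2 * (z - 1)\<^sup>2) \<le> M * cmod (z - 1) ^ 3"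
    using boundary_taylor[OF hol bv g] by blast
  \<comment> \<open>Small enough for both smallness conditions of the reciprocal expansion.\<close>
  define s' where "s' = min s (1 / (cmod a + 2 * M + 1))"
  have pos: "cmod a + 2 * M + 1 > 0" using M by (simp add: add_nonneg_pos)
  have s': "s' > 0" "s' \<le> s" using s pos by (auto simp: s'_def)
  define K where "K = 2 * (2 * M + (cmod a)\<^sup>2 / 2 + cmod a * M)"
  have K: "K \<ge> 0" using M by (simp add: K_def)
  have near: "cmod (2 / (1 - \<phi> z) - 2 / (1 - z) - a) \<le> K * cmod (1 - z)"
    if z: "z \<in> ball 0 1" "cmod (1 - z) < s'" for z
    unfolding K_def
  proof (rule reciprocal_expansion[OF _ _ M])
    show "1 - \<phi> z = (1 - z) - a / 2 * (1 - z)\<^sup>2 - (\<phi> z - 1 - (z - 1) - a / 2 * (z - 1)\<^sup>2)"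
      by (simp add: power2_eq_square algebra_simps)
    show "cmod (\<phi> z - 1 - (z - 1) - a / 2 * (z - 1)\<^sup>2) \<le> M * cmod (1 - z) ^ 3"
      using T[of z] z s'(2) by (simp add: norm_minus_commute)
    show "1 - z \<noteq> 0" using z by auto
    have "cmod (1 - z) \<le> 1 / (cmod a + 2 * M + 1)" using z(2) by (simp add: s'_def)
    then have x: "(cmod a + 2 * M + 1) * cmod (1 - z) \<le> 1" using pos by (simp add: le_divide_eq mult.commute)
    have "1 * cmod (1 - z) \<le> (cmod a + 2 * M + 1) * cmod (1 - z)" using M by (intro mult_right_mono) auto
    then show "cmod (1 - z) \<le> 1" using x by linarith
    have "(cmod a + 2 * M) * cmod (1 - z) \<le> (cmod a + 2 * M + 1) * cmod (1 - z)" by (intro mult_right_mono) auto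
    then show "(cmod a + 2 * M) * cmod (1 - z) \<le> 1" using x by linarith
  qed
  obtain m where m: "m > 0" "\<And>z. z \<in> ball 0 1 \<Longrightarrow> s' \<le> cmod (1 - z) \<Longrightarrow> m \<le> cmod (1 - \<phi> z)"
    using away_from_cluster[OF \<phi> cl s'(1)] by blast
  define L where "L = 2 / m + 2 / s' + cmod a"
  have L: "L \<ge> 0" using m s' by (simp add: L_def)
  have far: "cmod (2 / (1 - \<phi> z) - 2 / (1 - z) - a) \<le> L / s' * cmod (1 - z)"
    if z: "z \<in> ball 0 1" "s' \<le> cmod (1 - z)" for z
  proof -
    have "cmod (2 / (1 - \<phi> z)) \<le> 2 / m" using m(2)[OF z] m(1) by (simp add: norm_divide frac_le)
    moreover have "cmod (2 / (1 - z)) \<le> 2 / s'" using z(2) s' by (simp add: norm_divide frac_le)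
    ultimately have "cmod (2 / (1 - \<phi> z) - 2 / (1 - z) - a) \<le> L"
      using norm_triangle_ineq4[of "2 / (1 - \<phi> z) - 2 / (1 - z)" a] norm_triangle_ineq4[of "2 / (1 - \<phi> z)" "2 / (1 - z)"]
      unfolding L_def by linarith
    also have "\<dots> = L / s' * s'" using s' by simp
    also have "\<dots> \<le> L / s' * cmod (1 - z)" using z(2) L s' by (intro mult_left_mono) auto
    finally show ?thesis .
  qed
  have "cmod (2 / (1 - \<phi> z) - 2 / (1 - z) - a) \<le> max K (L / s') * cmod (1 - z)" if z: "z \<in> ball 0 1" for z
  proof (cases "cmod (1 - z) < s'")
    case True
    have "K * cmod (1 - z) \<le> max K (L / s') * cmod (1 - z)" by (intro mult_right_mono) auto
    then show ?thesis using near[OF z True] by linarith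
  next
    case False
    have "L / s' * cmod (1 - z) \<le> max K (L / s') * cmod (1 - z)" by (intro mult_right_mono) auto
    then show ?thesis using far[OF z] False by linarith
  qed
  then show ?thesis using that[of "max K (L / s')"] K by simp
qed

text \<open>Moving along the line \<open>Re V = 1 + e / 2\<close> towards the boundary point \<open>1\<close>.\<close>

lemma Re_translation_pos:
  assumes e: "e > 0" and C: "C \<ge> 0"
    and u: "\<And>z. z \<in> ball 0 1 \<Longrightarrow> 1 + e < Re (2 / (1 - z)) + Re (u z)"
    and near: "\<And>z. z \<in> ball 0 1 \<Longrightarrow> cmod (u z - a) \<le> C * cmod (1 - z)"
  shows "Re a > 0"
proof -
  \<comment> \<open>Large enough that 2 C / y is at most e / 4.\<close>
  define y where "y = 8 * C / e + 1"
  have y: "y \<ge> 1" using e C by (simp add: y_def)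
  define V where "V = Complex (1 + e / 2) y"
  have V: "cmod V \<ge> y" using abs_Im_le_cmod[of V] y by (simp add: V_def)
  then have V0: "V \<noteq> 0" using y by auto
  define z where "z = 1 - 2 / V"
  have zV: "2 / (1 - z) = V" "z \<noteq> 1" using V0 by (simp_all add: z_def)
  have z: "z \<in> ball 0 1" using cmod_less_1_iff[OF zV(2)] e by (simp add: zV(1)) (simp add: V_def)
  have "cmod (u z - a) \<le> C * (2 / cmod V)" using near[OF z] by (simp add: z_def norm_divide)
  also have "\<dots> \<le> C * (2 / y)" using V y C by (intro mult_left_mono frac_le) auto
  also have "\<dots> \<le> e / 4"
  proof -
    have "8 * C \<le> e * y" using e by (simp add: y_def distrib_left)
    then show ?thesis using y by (simp add: divide_le_eq mult.commute)
  qed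
  finally have "\<bar>Re (u z - a)\<bar> \<le> e / 4" using abs_Re_le_cmod order_trans by blast
  moreover have "e / 2 < Re (u z)" using u[OF z] unfolding zV(1) by (simp add: V_def)
  moreover have "Re (u z - a) = Re (u z) - Re a" by simp
  ultimately show ?thesis using e by linarith
qed

text \<open>Minimum principle for the harmonic function \<open>Re u\<close>: near the circle it is bounded below, away from
  \<open>1\<close> by the tangent-disc condition and near \<open>1\<close> by its limit \<open>Re a\<close>.\<close>

lemma Re_translation_bounded_below:
  assumes e: "e > 0" and C: "C \<ge> 0" and a: "Re a > 0" and hol: "u holomorphic_on ball 0 1"
    and u: "\<And>z. z \<in> ball 0 1 \<Longrightarrow> 1 + e < Re (2 / (1 - z)) + Re (u z)"
    and near: "\<And>z. z \<in> ball 0 1 \<Longrightarrow> cmod (u z - a) \<le> C * cmod (1 - z)"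
    and z: "z \<in> ball 0 1"
  shows "min (e / 2) (Re a / 2) \<le> Re (u z)"
proof -
  \<comment> \<open>Within distance \<beta> of 1 the real part of \<open>u\<close> is at least Re a
    / 2.\<close>
  define \<beta> where "\<beta> = Re a / (2 * (C + 1))"
  have \<beta>: "\<beta> > 0" using a C by (simp add: \<beta>_def)
  have C\<beta>: "C * \<beta> \<le> Re a / 2"
  proof -
    have "(C + 1) * \<beta> = Re a / 2" using C by (simp add: \<beta>_def field_simps)
    then show ?thesis using \<beta> by (simp add: distrib_right)
  qed
  have "((\<lambda>r. (1 - r\<^sup>2) / \<beta>\<^sup>2) \<longlongrightarrow> (1 - 1\<^sup>2) / \<beta>\<^sup>2) (at_left (1::real))"
    using \<beta> by (intro tendsto_intros) auto
  then have "\<forall>\<^sub>F r in at_left (1::real). (1 - r\<^sup>2) / \<beta>\<^sup>2 < e / 2"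
    using e by (intro order_tendstoD(2)) auto
  moreover have "\<forall>\<^sub>F r in at_left (1::real). cmod z < r"
    using z by (intro eventually_at_left_field[THEN iffD2] exI[of _ "cmod z"]) auto
  moreover have "\<forall>\<^sub>F r in at_left (1::real). r < 1"
    by (auto simp: eventually_at_left_field intro: exI[of _ 0])
  ultimately have "\<forall>\<^sub>F r in at_left (1::real). (1 - r\<^sup>2) / \<beta>\<^sup>2 < e / 2 \<and> cmod z < r \<and> r < 1"
    by eventually_elim auto
  \<comment> \<open>On this circle the Poisson kernel is below e / 2 wherever |1 - w| \<ge>
    \<beta>.\<close>
  then obtain r :: real where r: "(1 - r\<^sup>2) / \<beta>\<^sup>2 < e / 2" "cmod z < r" "r < 1"
    using eventually_happens'[OF trivial_limit_at_left_real] by blast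
  have r0: "r > 0" using r(2) norm_ge_zero[of z] by linarith
  let ?d = "min (e / 2) (Re a / 2)"
  have sub: "cball 0 r \<subseteq> ball (0::complex) 1" using r by auto
  \<comment> \<open>The modulus of exp (- u) is exp (- Re u), so the maximum principle for it bounds
    Re u from below.\<close>
  have "cmod (exp (- u z)) \<le> exp (- ?d)"
  proof (rule maximum_modulus_frontier[where S = "cball 0 r" and f = "\<lambda>z. exp (- u z)"])
    show "(\<lambda>z. exp (- u z)) holomorphic_on interior (cball 0 r)"
      using hol r by (intro holomorphic_intros holomorphic_on_subset[OF hol]) auto
    show "continuous_on (closure (cball 0 r)) (\<lambda>z. exp (- u z))"
      using holomorphic_on_imp_continuous_on[OF holomorphic_on_subset[OF hol sub]]
      by (intro continuous_intros) simp
    show "bounded (cball (0::complex) r)" by simp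
    show "z \<in> cball 0 r" using r by simp
    fix w :: complex assume "w \<in> frontier (cball 0 r)"
    then have w: "cmod w = r" using r0 by simp
    then have wb: "w \<in> ball 0 1" and w1: "w \<noteq> 1" using r by auto
    have "?d \<le> Re (u w)"
    proof (cases "\<beta> \<le> cmod (1 - w)")
      case True
      have "(1 - r\<^sup>2) / (cmod (1 - w))\<^sup>2 \<le> (1 - r\<^sup>2) / \<beta>\<^sup>2"
        using True \<beta> r r0 by (intro divide_left_mono power_mono mult_pos_pos) (auto simp: power_le_one w1)
      then have "Re (2 / (1 - w)) \<le> 1 + e / 2" using hp_coord_minus_1[OF w1, unfolded w] r(1) by linarith
      then show ?thesis using u[OF wb] by linarith
    next
      case False
      have "cmod (u w - a) \<le> C * \<beta>"
        using near[OF wb] False C by (meson less_imp_le mult_left_mono not_le order_trans)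
      then have "\<bar>Re (u w - a)\<bar> \<le> Re a / 2" using abs_Re_le_cmod[of "u w - a"] C\<beta> by linarith
      moreover have "Re (u w - a) = Re (u w) - Re a" by simp
      ultimately have "Re a / 2 \<le> Re (u w)" by linarith
      then show ?thesis by (rule min.coboundedI2)
    qed
    then show "cmod (exp (- u w)) \<le> exp (- ?d)" by simp
  qed
  then show ?thesis by simp
qed

text \<open>Re V grows at least linearly along orbits and |1 - z| = 2 / |V|, so orbits approach 1 at
  rate 1 / n.\<close>

lemma denjoy_wolff_at_1:
  assumes \<phi>: "disc_selfmap \<phi>" and d: "d > 0"
    and step: "\<And>z. z \<in> ball 0 1 \<Longrightarrow> Re (2 / (1 - z)) + d \<le> Re (2 / (1 - \<phi> z))"
  shows "denjoy_wolff_point \<phi> 1"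
  unfolding denjoy_wolff_point_def
proof (intro conjI ballI)
  fix z :: complex assume z: "z \<in> ball 0 1"
  have iter: "(\<phi> ^^ n) z \<in> ball 0 1 \<and> real n * d \<le> Re (2 / (1 - (\<phi> ^^ n) z))" for n
  proof (induction n)
    case 0
    show ?case using z hp_coord_disc(1)[OF z] by simp
  next
    case (Suc n)
    then have "(\<phi> ^^ Suc n) z \<in> ball 0 1" using \<phi> by (auto simp: disc_selfmap_def image_subset_iff)
    moreover have "real (Suc n) * d \<le> Re (2 / (1 - (\<phi> ^^ Suc n) z))"
      using Suc step[of "(\<phi> ^^ n) z"] by (simp add: distrib_right)
    ultimately show ?case ..
  qed
  have le: "cmod ((\<phi> ^^ Suc n) z - 1) \<le> 2 / d * (1 / real (Suc n))" for n
  proof -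
    let ?w = "(\<phi> ^^ Suc n) z"
    have w: "?w \<in> ball 0 1" "real (Suc n) * d \<le> Re (2 / (1 - ?w))" using iter[of "Suc n"] by auto
    have "real (Suc n) * d \<le> cmod (2 / (1 - ?w))" using w(2) complex_Re_le_cmod order_trans by blast
    moreover have "cmod (1 - ?w) > 0" using hp_coord_disc(3)[OF w(1)] by simp
    ultimately have "real (Suc n) * d * cmod (1 - ?w) \<le> 2" by (simp only: norm_divide pos_le_divide_eq norm_numeral)
    then have "cmod (1 - ?w) \<le> 2 / (real (Suc n) * d)" using d by (simp only: pos_le_divide_eq mult.commute mult_pos_pos of_nat_0_less_iff zero_less_Suc)
    then show ?thesis by (simp only: norm_minus_commute times_divide_times_eq mult_1_right mult.commute)
  qed
  have "(\<lambda>n. 2 / d * (1 / real (Suc n))) \<longlonglongrightarrow> 0"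
    using LIMSEQ_inverse_real_of_nat by (intro tendsto_mult_right_zero) (simp add: inverse_eq_divide)
  then have "(\<lambda>n. (\<phi> ^^ Suc n) z - 1) \<longlonglongrightarrow> 0"
    by (rule Lim_null_comparison[OF always_eventually[OF allI[OF le]]])
  then have "(\<lambda>n. (\<phi> ^^ Suc n) z) \<longlonglongrightarrow> 1" by (rule LIM_zero_cancel)
  then show "(\<lambda>n. (\<phi> ^^ n) z) \<longlonglongrightarrow> 1" by (rule LIMSEQ_imp_Suc)
qed simp

text \<open>Approach along the radius. This serves to identify the contact point \<eta> and the
  point \<open>\<zeta>\<^sub>0\<close> of the definition with 1.\<close>

lemma boundary_value_in_cluster_set:
  assumes "has_boundary_value \<phi> 1 w" shows "w \<in> cluster_set \<phi> 1"
proof -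
  define z where "z n = complex_of_real (1 - 1 / real (Suc n))" for n
  have z: "z n \<in> ball 0 1" for n
  proof -
    have "\<bar>1 - 1 / real (Suc n)\<bar> < 1" by (simp add: field_simps)
    then show ?thesis unfolding z_def mem_ball_0 norm_of_real .
  qed
  have "(\<lambda>n. 1 / real (Suc n)) \<longlonglongrightarrow> 0" using LIMSEQ_inverse_real_of_nat by (simp add: inverse_eq_divide)
  then have "(\<lambda>n. complex_of_real (1 - 1 / real (Suc n))) \<longlonglongrightarrow> of_real (1 - 0)"
    by (intro tendsto_of_real tendsto_diff tendsto_const)
  then have lim: "z \<longlonglongrightarrow> 1" by (simp add: z_def[abs_def])
  moreover have "z n \<noteq> 1" for n using z[of n] by auto
  ultimately have "filterlim z (at 1 within ball 0 1) sequentially"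
    using z by (auto simp: filterlim_at intro!: always_eventually)
  then have "(\<lambda>n. \<phi> (z n)) \<longlonglongrightarrow> w" by (rule filterlim_compose[OF assms])
  then show ?thesis using z lim by (auto simp: cluster_set_def)
qed

theorem theorem4p3:
  fixes \<phi> :: "complex \<Rightarrow> complex" and a :: complex
  assumes "essentially_linear_fractional \<phi>"
    and "has_boundary_value \<phi> 1 1"
    and "has_boundary_value (deriv \<phi>) 1 1"
    and "has_boundary_value ((deriv ^^ 2) \<phi>) 1 a"
  shows "denjoy_wolff_point \<phi> 1 \<and> Re a > 0
    \<and> spectrum (composition_operator \<phi>) = {exp (- a * complex_of_real t) | t. t \<ge> 0} \<union> {0}
    \<and> essential_spectrum (composition_operator \<phi>) = {exp (- a * complex_of_real t) | t. t \<ge> 0} \<union> {0}"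
proof -
  have \<phi>: "disc_selfmap \<phi>"
    using assms(1) unfolding essentially_linear_fractional_def by (rule conjunct1)
  obtain \<eta> where tangent_disc: "\<exists>c r. r > 0 \<and> ball c r \<subset> ball 0 1 \<and> sphere c r \<inter> sphere 0 1 = {\<eta>}
      \<and> \<phi> ` ball 0 1 \<subseteq> ball c r"
    and contact: "\<exists>\<zeta>\<^sub>0. {\<zeta> \<in> sphere 0 1. \<eta> \<in> cluster_set \<phi> \<zeta>} = {\<zeta>\<^sub>0}
        \<and> (\<exists>g. continuous_on (insert \<zeta>\<^sub>0 (ball 0 1)) g \<and> (\<forall>z\<in>ball 0 1. g z = (deriv ^^ 3) \<phi> z))"
    using assms(1)[unfolded essentially_linear_fractional_def, THEN conjunct2] by (elim bexE conjE)
  obtain c r where r: "r > 0"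
    and cr: "ball c r \<subset> ball 0 1" "sphere c r \<inter> sphere 0 1 = {\<eta>}" "\<phi> ` ball 0 1 \<subseteq> ball c r"
    using tangent_disc by (elim exE conjE)
  obtain \<zeta>\<^sub>0 g where cl: "{\<zeta> \<in> sphere 0 1. \<eta> \<in> cluster_set \<phi> \<zeta>} = {\<zeta>\<^sub>0}"
    and g: "continuous_on (insert \<zeta>\<^sub>0 (ball 0 1)) g" "\<And>z. z \<in> ball 0 1 \<Longrightarrow> g z = (deriv ^^ 3) \<phi> z"
    using contact by auto
  have c1: "1 \<in> cluster_set \<phi> 1" by (rule boundary_value_in_cluster_set[OF assms(2)])
  \<comment> \<open>A limit of values of \<phi> lies in the closed tangent disc; being on the unit
    circle it is outside the open one, hence it is the tangency point.\<close>
  have "1 \<in> cball c r"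
  proof -
    obtain z where z: "\<And>n. z n \<in> ball 0 1" "(\<lambda>n. \<phi> (z n)) \<longlonglongrightarrow> 1" using c1 by (auto simp: cluster_set_def)
    have "\<phi> (z n) \<in> cball c r" for n using cr(3) z(1)[of n] by (auto simp: image_subset_iff less_imp_le)
    then show ?thesis by (rule closed_sequentially[OF closed_cball _ z(2)])
  qed
  moreover have "1 \<notin> ball c r" using cr(1) by auto
  ultimately have one: "1 \<in> sphere c r" by auto
  then have "1 \<in> sphere c r \<inter> sphere 0 1" by simp
  then have "1 \<in> {\<eta>}" by (simp only: cr(2))
  then have \<eta>1: "\<eta> = 1" by simp
  have "1 \<in> {\<zeta> \<in> sphere 0 1. \<eta> \<in> cluster_set \<phi> \<zeta>}" using c1 by (simp add: \<eta>1)
  then have "1 \<in> {\<zeta>\<^sub>0}" by (simp only: cl)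
  then have \<zeta>1: "\<zeta>\<^sub>0 = 1" by simp
  have cl': "\<zeta> = 1" if "\<zeta> \<in> sphere 0 1" "1 \<in> cluster_set \<phi> \<zeta>" for \<zeta>
  proof -
    have "\<zeta> \<in> {\<zeta> \<in> sphere 0 1. \<eta> \<in> cluster_set \<phi> \<zeta>}" using that by (simp add: \<eta>1)
    then have "\<zeta> \<in> {\<zeta>\<^sub>0}" by (simp only: cl)
    then show ?thesis by (simp add: \<zeta>1)
  qed
  note cen = tangent_disc_center[OF r cr(1) one]
  \<comment> \<open>In the coordinate V the tangent disc of radius \<open>r\<close> is the
    half-plane Re V > 1 / r = 1 + e.\<close>
  define e where "e = 1 / r - 1"
  have e: "e > 0" using r cen(2) by (simp add: e_def)
  define u where "u z = 2 / (1 - \<phi> z) - 2 / (1 - z)" for z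
  have \<phi>b: "\<phi> z \<in> ball 0 1" if "z \<in> ball 0 1" for z using \<phi> that by (auto simp: disc_selfmap_def image_subset_iff)
  have tangent: "1 + e < Re (2 / (1 - z)) + Re (u z)" if z: "z \<in> ball 0 1" for z
  proof -
    \<comment> \<open>The point that \<open>horo r\<close> sends to \<open>\<phi> z\<close>.\<close>
    define w where "w = 1 - (1 - \<phi> z) / of_real r"
    have \<phi>1: "1 - \<phi> z \<noteq> 0" using \<phi>b[OF z] by auto
    have "\<phi> z - c = of_real r * w" unfolding cen(1) w_def using r by (simp add: field_simps)
    moreover have "cmod (\<phi> z - c) < r" using cr(3) z by (auto simp: image_subset_iff dist_norm norm_minus_commute)
    ultimately have "cmod w < 1" using r by (simp add: norm_mult)
    moreover have "w \<noteq> 1" using \<phi>1 r by (simp add: w_def)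
    ultimately have "1 < Re (2 / (1 - w))" using cmod_less_1_iff by blast
    also have "2 / (1 - w) = of_real r * (2 / (1 - \<phi> z))" using r by (simp add: w_def)
    also have "Re \<dots> = r * Re (2 / (1 - \<phi> z))"
      by (simp only: times_complex.sel Re_complex_of_real Im_complex_of_real mult_zero_left diff_zero)
    finally have "1 / r < Re (2 / (1 - \<phi> z))" using r by (simp only: pos_divide_less_eq mult.commute)
    then show ?thesis by (simp add: e_def u_def)
  qed
  obtain C where C: "C \<ge> 0" "\<And>z. z \<in> ball 0 1 \<Longrightarrow> cmod (u z - a) \<le> C * cmod (1 - z)"
    using parabolic_expansion[OF \<phi> cl' assms(2,3,4) g[unfolded \<zeta>1]] unfolding u_def by blast
  have Re_a: "Re a > 0" by (rule Re_translation_pos[OF e C(1) tangent C(2)])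
  have u_hol: "u holomorphic_on ball 0 1"
    unfolding u_def using \<phi> \<phi>b by (intro holomorphic_intros) (auto simp: disc_selfmap_def, fastforce)
  define d where "d = min (e / 2) (Re a / 2)"
  have d: "d > 0" using e Re_a by (simp add: d_def)
  have Re_u: "d \<le> Re (u z)" if "z \<in> ball 0 1" for z
    unfolding d_def by (rule Re_translation_bounded_below[OF e C(1) Re_a u_hol tangent C(2) that])
  interpret parabolic_map u a d C
    by unfold_locales (use u_hol d Re_a C Re_u in auto)
  have dw: "denjoy_wolff_point \<phi> 1"
  proof (rule denjoy_wolff_at_1[OF \<phi> d])
    fix z :: complex assume z: "z \<in> ball 0 1"
    then show "Re (2 / (1 - z)) + d \<le> Re (2 / (1 - \<phi> z))" using Re_u[OF z] by (simp add: u_def)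
  qed
  have "composition_operator \<phi> = composition_operator (hp_shift u)"
  proof (rule composition_operator_cong)
    fix z :: complex assume z: "z \<in> ball 0 1"
    have nz: "1 - z \<noteq> 0" "1 - \<phi> z \<noteq> 0" using z \<phi>b[OF z] by auto
    have "1 + u z * (1 - z) / 2 = (1 - z) / (1 - \<phi> z)" 
    proof -
      have "1 + (2 / q - 2 / p) * p / 2 = p / q" if "p \<noteq> 0" "q \<noteq> 0" for p q :: complex
        using that by (simp add: field_simps)
      then show ?thesis using nz unfolding u_def by blast
    qed
    then show "\<phi> z = hp_shift u z" using nz by (simp add: hp_shift_def)
  qed
  then have T: "composition_operator (hp_shift u) = composition_operator \<phi>" by simp
  have "essential_spectrum (composition_operator \<phi>) \<subseteq> spectrum (composition_operator \<phi>)"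
    by (rule essential_spectrum_subset_spectrum[OF bounded_clinear_composition[OF \<phi>]])
  \<comment> \<open>The inclusions close up: spiral in essential spectrum, in spectrum, in
    spiral.\<close>
  then show ?thesis
    using dw Re_a spectrum_subset[unfolded T] spiral_subset_essential_spectrum[unfolded T] by blast
qed

end
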